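(* The impulse control problem (QVI) stated in the context possesses a nonempty set of solutions $\mathbb{S}(u) \subset H_0^1(\Omega)$ for all $u \in H^{-1}_+(\Omega)$, and this solution set possesses unique smallest and largest elements $m(u)$ and $M(u)$ (w.r.t. the a.e.-order). The map $M\colon H^{-1}_+(\Omega) \to H_0^1(\Omega)$, $u \mapsto M(u)$, is concave in the sense that \[ \lambda M(u_1) + (1-\lambda)M(u_2) \leq M(\lambda u_1 + (1-\lambda)u_2) \] holds a.e. in $\Omega$ for all $u_1,u_2 \in H^{-1}_+(\Omega)$ and $\lambda \in [0,1]$. Further, $M$ is directionally differentiable in the sense that, for all $u \in H^{-1}_+(\Omega)$ and $h \in H^{-1}(\Omega)$ satisfying $u+\tau_0 h \in H^{-1}_+(\Omega)$ for a $\tau_0>0$, there exists a unique $M'(u;h) \in L^0(\Omega,(-\infty,\infty])$ such that the difference quotients \[ \frac{M(u+\tau h)-M(u)}{\tau}, \qquad \tau \in (0,\tau_0), \] converge pointwise a.e. in $\Omega$ to $M'(u;h)$ along every sequence $\{\tau_n\}\subset(0,\tau_0)$ with $\tau_n \to 0$.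
   Context: Setting. $\Omega \subset \mathbb{R}^d$, $d \in \mathbb{N}$, is a bounded open nonempty set; $H_0^1(\Omega)$ and $H^{-1}(\Omega)$ are the usual Sobolev space and its dual, with dual pairing $\langle\cdot,\cdot\rangle$; $\Delta\colon H_0^1(\Omega)\to H^{-1}(\Omega)$ is the distributional Laplacian. $\kappa \geq 0$ is a constant, $c_0$ is a nonnegative real-valued Lebesgue measurable function on $\mathbb{R}^d$ (an a.e.-equivalence class), and $f\colon\mathbb{R}\to\mathbb{R}$ is nondecreasing, globally Lipschitz continuous and convex with $f(0)=0$, acting by superposition. $H^{-1}_+(\Omega) := \{z \in H^{-1}(\Omega) \mid \langle z,v\rangle \geq 0 \text{ for all } 0 \leq v \in H_0^1(\Omega)\}$. Inequalities between functions hold a.e.; $L^0(\Omega,(-\infty,\infty])$ is the set of a.e.-equivalence classes of measurable functions on $\Omega$ with values in $(-\infty,\infty]$. For $y \in L^2(\Omega)$ with $y \geq -\kappa$, set \[ \Theta(y)(x) := \kappa + \operatorname*{ess\,inf}_{0 \leq \xi \in \mathbb{R}^d,\ x+\xi\in\Omega} \left( c_0(\xi) + y(x+\xi) \right) \quad \text{for a.a. } x \in \Omega, \] where $\xi \geq 0$ is understood componentwise. (QVI) with parameter $u \in H^{-1}_+(\Omega)$: find $y \in H_0^1(\Omega)$ with $0 \leq y \leq \Theta(y)$ and \[ \langle -\Delta y + f(y) - u, v - y\rangle \geq 0 \quad \text{for all } v \in H_0^1(\Omega) \text{ with } v \leq \Theta(y). \] *)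

theory Defs
  imports "HOL-Analysis.Analysis" "HOL-Probability.Essential_Supremum"
begin

text \<open>
  Elements of function spaces over \<open>\<Omega>\<close> are represented by functions on the whole space that are only
  inspected on \<open>\<Omega>\<close>; equality and order are understood almost everywhere w.r.t. \<open>lebesgue_on \<Omega>\<close>.
\<close>

definition ae_le :: "'a::euclidean_space set \<Rightarrow> ('a \<Rightarrow> 'b::order) \<Rightarrow> ('a \<Rightarrow> 'b) \<Rightarrow> bool" where
  "ae_le \<Omega> v w \<longleftrightarrow> (AE x in lebesgue_on \<Omega>. v x \<le> w x)"

definition ae_eq :: "'a::euclidean_space set \<Rightarrow> ('a \<Rightarrow> 'b) \<Rightarrow> ('a \<Rightarrow> 'b) \<Rightarrow> bool" where
  "ae_eq \<Omega> v w \<longleftrightarrow> (AE x in lebesgue_on \<Omega>. v x = w x)"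

definition ae_smallest ::
  "'a::euclidean_space set \<Rightarrow> ('a \<Rightarrow> 'b::order) set \<Rightarrow> ('a \<Rightarrow> 'b) \<Rightarrow> bool" where
  "ae_smallest \<Omega> S y \<longleftrightarrow> y \<in> S \<and> (\<forall>z\<in>S. ae_le \<Omega> y z)"

definition ae_largest ::
  "'a::euclidean_space set \<Rightarrow> ('a \<Rightarrow> 'b::order) set \<Rightarrow> ('a \<Rightarrow> 'b) \<Rightarrow> bool" where
  "ae_largest \<Omega> S y \<longleftrightarrow> y \<in> S \<and> (\<forall>z\<in>S. ae_le \<Omega> z y)"

definition ess_inf :: "'a measure \<Rightarrow> ('a \<Rightarrow> ereal) \<Rightarrow> ereal" where
  "ess_inf M g = - esssup M (\<lambda>x. - g x)"


section \<open>Sobolev spaces\<close>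

definition partial_deriv :: "'n::finite \<Rightarrow> (real^'n \<Rightarrow> real) \<Rightarrow> real^'n \<Rightarrow> real" where
  "partial_deriv i \<phi> x = frechet_derivative \<phi> (at x) (axis i 1)"

fun Ck :: "nat \<Rightarrow> (real^'n::finite \<Rightarrow> real) \<Rightarrow> bool" where
  "Ck 0 \<phi> \<longleftrightarrow> continuous_on UNIV \<phi>"
| "Ck (Suc k) \<phi> \<longleftrightarrow> (\<forall>x. \<phi> differentiable (at x)) \<and> (\<forall>i. Ck k (partial_deriv i \<phi>))"

definition test_functions :: "(real^'n::finite) set \<Rightarrow> (real^'n \<Rightarrow> real) set" where
  "test_functions \<Omega> =
     {\<phi>. (\<forall>k. Ck k \<phi>) \<and> compact (closure {x. \<phi> x \<noteq> 0}) \<and> closure {x. \<phi> x \<noteq> 0} \<subseteq> \<Omega>}"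

definition L2 :: "(real^'n::finite) set \<Rightarrow> (real^'n \<Rightarrow> real) set" where
  "L2 \<Omega> = {v \<in> borel_measurable (lebesgue_on \<Omega>). integrable (lebesgue_on \<Omega>) (\<lambda>x. (v x)\<^sup>2)}"

definition is_weak_gradient ::
  "(real^'n::finite) set \<Rightarrow> (real^'n \<Rightarrow> real) \<Rightarrow> (real^'n \<Rightarrow> real^'n) \<Rightarrow> bool" where
  "is_weak_gradient \<Omega> v G \<longleftrightarrow>
     (\<forall>i. (\<lambda>x. G x $ i) \<in> L2 \<Omega> \<and>
        (\<forall>\<phi>\<in>test_functions \<Omega>.
           (\<integral>x. v x * partial_deriv i \<phi> x \<partial>lebesgue_on \<Omega>) = - (\<integral>x. G x $ i * \<phi> x \<partial>lebesgue_on \<Omega>)))"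

definition H1 :: "(real^'n::finite) set \<Rightarrow> (real^'n \<Rightarrow> real) set" where
  "H1 \<Omega> = {v \<in> L2 \<Omega>. \<exists>G. is_weak_gradient \<Omega> v G}"

text \<open>Weak gradients are unique up to null sets; a representative is chosen.\<close>

definition weak_gradient :: "(real^'n::finite) set \<Rightarrow> (real^'n \<Rightarrow> real) \<Rightarrow> real^'n \<Rightarrow> real^'n" where
  "weak_gradient \<Omega> v = (SOME G. is_weak_gradient \<Omega> v G)"

definition H1_norm :: "(real^'n::finite) set \<Rightarrow> (real^'n \<Rightarrow> real) \<Rightarrow> real" where
  "H1_norm \<Omega> v =
     sqrt ((\<integral>x. (v x)\<^sup>2 \<partial>lebesgue_on \<Omega>) + (\<integral>x. (norm (weak_gradient \<Omega> v x))\<^sup>2 \<partial>lebesgue_on \<Omega>))"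

definition H10 :: "(real^'n::finite) set \<Rightarrow> (real^'n \<Rightarrow> real) set" where
  "H10 \<Omega> = {v \<in> H1 \<Omega>. \<exists>\<phi>. (\<forall>k::nat. \<phi> k \<in> test_functions \<Omega>) \<and>
                        (\<lambda>k. H1_norm \<Omega> (\<lambda>x. v x - \<phi> k x)) \<longlonglongrightarrow> 0}"

text \<open>
  The dual of \<open>H10 \<Omega>\<close>. Functionals are determined by their values on \<open>H10 \<Omega>\<close> only, and the bound
  forces them to respect equality almost everywhere. The dual pairing of \<open>z\<close> and \<open>v\<close> is \<open>z v\<close>.
\<close>

definition Hm1 :: "(real^'n::finite) set \<Rightarrow> ((real^'n \<Rightarrow> real) \<Rightarrow> real) set" where
  "Hm1 \<Omega> = {z. (\<forall>v\<in>H10 \<Omega>. \<forall>w\<in>H10 \<Omega>. z (\<lambda>x. v x + w x) = z v + z w) \<and>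
               (\<forall>a. \<forall>v\<in>H10 \<Omega>. z (\<lambda>x. a * v x) = a * z v) \<and>
               (\<exists>C. \<forall>v\<in>H10 \<Omega>. \<bar>z v\<bar> \<le> C * H1_norm \<Omega> v)}"

definition Hm1_plus :: "(real^'n::finite) set \<Rightarrow> ((real^'n \<Rightarrow> real) \<Rightarrow> real) set" where
  "Hm1_plus \<Omega> = {z \<in> Hm1 \<Omega>. \<forall>v\<in>H10 \<Omega>. ae_le \<Omega> (\<lambda>_. 0) v \<longrightarrow> 0 \<le> z v}"

text \<open>
  On test functions this is the distribution \<open>\<phi> \<mapsto> \<integral> y \<Delta>\<phi>\<close>; the right-hand side is its continuous
  extension to \<open>H10 \<Omega>\<close>.
\<close>

definition Laplacian ::
  "(real^'n::finite) set \<Rightarrow> (real^'n \<Rightarrow> real) \<Rightarrow> (real^'n \<Rightarrow> real) \<Rightarrow> real" where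
  "Laplacian \<Omega> y w = - (\<integral>x. weak_gradient \<Omega> y x \<bullet> weak_gradient \<Omega> w x \<partial>lebesgue_on \<Omega>)"

text \<open>The embedding of \<open>L2 \<Omega>\<close> into \<open>Hm1 \<Omega>\<close>.\<close>

definition L2_functional ::
  "(real^'n::finite) set \<Rightarrow> (real^'n \<Rightarrow> real) \<Rightarrow> (real^'n \<Rightarrow> real) \<Rightarrow> real" where
  "L2_functional \<Omega> g w = (\<integral>x. g x * w x \<partial>lebesgue_on \<Omega>)"


section \<open>The impulse control problem\<close>

text \<open>The order on \<open>real^'n\<close> is componentwise.\<close>

definition \<Theta> ::
  "(real^'n::finite) set \<Rightarrow> real \<Rightarrow> (real^'n \<Rightarrow> real) \<Rightarrow> (real^'n \<Rightarrow> real) \<Rightarrow> real^'n \<Rightarrow> ereal" where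
  "\<Theta> \<Omega> \<kappa> c0 y x =
     ereal \<kappa> + ess_inf (lebesgue_on {\<xi>. 0 \<le> \<xi> \<and> x + \<xi> \<in> \<Omega>}) (\<lambda>\<xi>. ereal (c0 \<xi> + y (x + \<xi>)))"

definition QVI_solutions ::
  "(real^'n::finite) set \<Rightarrow> real \<Rightarrow> (real^'n \<Rightarrow> real) \<Rightarrow> (real \<Rightarrow> real) \<Rightarrow>
     ((real^'n \<Rightarrow> real) \<Rightarrow> real) \<Rightarrow> (real^'n \<Rightarrow> real) set" where
  "QVI_solutions \<Omega> \<kappa> c0 f u =
     {y \<in> H10 \<Omega>.
        ae_le \<Omega> (\<lambda>_. 0) y \<and> ae_le \<Omega> (\<lambda>x. ereal (y x)) (\<Theta> \<Omega> \<kappa> c0 y) \<and>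
        (\<forall>v\<in>H10 \<Omega>. ae_le \<Omega> (\<lambda>x. ereal (v x)) (\<Theta> \<Omega> \<kappa> c0 y) \<longrightarrow>
           (let w = (\<lambda>x. v x - y x)
            in - Laplacian \<Omega> y w + L2_functional \<Omega> (\<lambda>x. f (y x)) w - u w \<ge> 0))}"

definition min_solution ::
  "(real^'n::finite) set \<Rightarrow> real \<Rightarrow> (real^'n \<Rightarrow> real) \<Rightarrow> (real \<Rightarrow> real) \<Rightarrow>
     ((real^'n \<Rightarrow> real) \<Rightarrow> real) \<Rightarrow> real^'n \<Rightarrow> real" where
  "min_solution \<Omega> \<kappa> c0 f u = (SOME y. ae_smallest \<Omega> (QVI_solutions \<Omega> \<kappa> c0 f u) y)"

definition max_solution ::
  "(real^'n::finite) set \<Rightarrow> real \<Rightarrow> (real^'n \<Rightarrow> real) \<Rightarrow> (real \<Rightarrow> real) \<Rightarrow>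
     ((real^'n \<Rightarrow> real) \<Rightarrow> real) \<Rightarrow> real^'n \<Rightarrow> real" where
  "max_solution \<Omega> \<kappa> c0 f u = (SOME y. ae_largest \<Omega> (QVI_solutions \<Omega> \<kappa> c0 f u) y)"

text \<open>Representatives of measurable functions with values in \<open>(-\<infinity>, \<infinity>]\<close>.\<close>

definition L0_ext :: "(real^'n::finite) set \<Rightarrow> (real^'n \<Rightarrow> ereal) set" where
  "L0_ext \<Omega> = {g \<in> borel_measurable (lebesgue_on \<Omega>). AE x in lebesgue_on \<Omega>. g x \<noteq> -\<infinity>}"

text \<open>The exceptional null set may depend on the sequence of step sizes.\<close>

definition is_dir_deriv ::
  "(real^'n::finite) set \<Rightarrow> (((real^'n \<Rightarrow> real) \<Rightarrow> real) \<Rightarrow> real^'n \<Rightarrow> real) \<Rightarrow> real \<Rightarrow>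
     ((real^'n \<Rightarrow> real) \<Rightarrow> real) \<Rightarrow> ((real^'n \<Rightarrow> real) \<Rightarrow> real) \<Rightarrow> (real^'n \<Rightarrow> ereal) \<Rightarrow> bool" where
  "is_dir_deriv \<Omega> M \<tau>0 u h D \<longleftrightarrow>
     (\<forall>\<tau>::nat \<Rightarrow> real. (\<forall>n. 0 < \<tau> n \<and> \<tau> n < \<tau>0) \<and> \<tau> \<longlonglongrightarrow> 0 \<longrightarrow>
        (AE x in lebesgue_on \<Omega>.
           (\<lambda>n. ereal ((M (\<lambda>v. u v + \<tau> n * h v) x - M u x) / \<tau> n)) \<longlonglongrightarrow> D x))"

end

theory Submission
  imports Defs
begin

text \<open>
  Let \<open>S u y\<close> be the solution of the obstacle problem for \<open>- \<Delta> z + f z = u\<close> with upper obstacle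
  \<open>\<Theta> y\<close>. Solutions of the quasi-variational inequality are the nonnegative fixed points of \<open>S u\<close>
  (\<open>QVI_solutions_iff\<close>, \<open>fixed_point_QVI_solution\<close>). Two facts make this fixed point equation
  tractable. First, \<open>\<Theta>\<close> is an essential infimum of functions that are affine in \<open>y\<close>, so it is
  monotone and concave (\<open>T_mono\<close>, \<open>T_concave\<close>). Second, a solution of an obstacle problem is the
  largest subsolution of the equation below the obstacle (\<open>obstacle_solution_subsolution\<close>,
  \<open>subsolution_le_obstacle_solution\<close>). Hence \<open>S u\<close> is monotone.

  Extremal fixed points come from an argument in the style of Knaster and Tarski
  (\<open>greatest_post_fixed_point\<close>): among all \<open>y \<le> S u y\<close>, an increasing sequence is chosen whose
  integrals approach the supremum, and the limit of its images under \<open>S u\<close> is the largest fixed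
  point; the reversed order gives the smallest one. The limit exists because ordered nonnegative
  subsolutions converge strongly in \<open>H10 \<Omega>\<close> (\<open>monotone_subsolutions_convergent\<close>): testing the
  inequality for the larger of two subsolutions with their difference bounds the gradient of the
  difference by an increment of \<open>\<integral>\<bar>\<nabla>z\<bar>\<^sup>2 - 2 \<langle>u, z\<rangle>\<close>, a quantity that is monotone and bounded
  along the sequence.

  The construction shows more, namely that \<open>max_solution\<close> dominates every nonnegative subsolution
  \<open>y \<le> \<Theta> y\<close> (\<open>subsolution_le_max_solution\<close>). Since \<open>\<Theta>\<close> is concave and \<open>f\<close> is convex, the pairs
  \<open>(u, y)\<close> of data and such subsolutions form a convex set, and so \<open>max_solution\<close> is concave in
  \<open>u\<close> (\<open>max_solution_concave\<close>). Difference quotients of a concave function decrease in the step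
  size and thus converge to their supremum. To stay outside one null set, only countably many step
  sizes are compared: those of the given sequence and those of one fixed null sequence.

  The Sobolev space theory behind this consists of the uniqueness of weak gradients
  (\<open>fundamental_lemma_calculus_of_variations\<close>, by explicit bump functions and polynomial
  approximation), the Poincare inequality, completeness, and the stability of \<open>H10 \<Omega>\<close> under
  positive parts (\<open>H10_abs\<close>, \<open>E_pos_part\<close>). Obstacle problems are solved by minimising the energy
  (\<open>energy_minimizer_exists\<close>).
\<close>

section \<open>Continuously differentiable functions\<close>

lemma partial_deriv_eq:
  assumes "(\<phi> has_derivative \<phi>') (at x)"
  shows "partial_deriv i \<phi> x = \<phi>' (axis i 1)"
  unfolding partial_deriv_def using frechet_derivative_at[OF assms] by simp

lemma Ck_imp_continuous: "Ck k \<phi> \<Longrightarrow> continuous_on UNIV \<phi>"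
  by (cases k) (auto intro!: continuous_at_imp_continuous_on differentiable_imp_continuous_within)

lemma Ck_SucD: "Ck (Suc k) \<phi> \<Longrightarrow> Ck k \<phi>"
proof (induction k arbitrary: \<phi>)
  case 0
  then show ?case using Ck_imp_continuous by (metis Ck.simps(1))
next
  case (Suc k)
  then show ?case by auto
qed

lemma Ck_const: "Ck k (\<lambda>x. c)"
proof (induction k arbitrary: c)
  case (Suc k)
  have "partial_deriv i (\<lambda>x. c) = (\<lambda>x. 0)" for i :: 'a
    by (rule ext) (subst partial_deriv_eq[of _ "\<lambda>_. 0"], auto)
  then show ?case using Suc[of 0] by simp
qed simp

lemma Ck_component: "Ck k (\<lambda>x::real^'n::finite. x $ i)"
proof (cases k)
  case (Suc m)
  have "((\<lambda>x::real^'n. x $ i) has_derivative (\<lambda>h. h $ i)) (at x)" for x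
    by (auto intro!: bounded_linear_imp_has_derivative bounded_linear_intros)
  then have "partial_deriv j (\<lambda>x::real^'n. x $ i) = (\<lambda>x. axis j 1 $ i)" for j
    by (intro ext partial_deriv_eq)
  moreover have "(\<lambda>x::real^'n. x $ i) differentiable (at x)" for x
    by (auto intro!: bounded_linear_imp_differentiable bounded_linear_intros)
  ultimately show ?thesis unfolding Suc by (simp add: Ck_const)
qed (auto intro!: continuous_intros)

lemma partial_deriv_add:
  assumes "\<phi> differentiable (at x)" "\<psi> differentiable (at x)"
  shows "partial_deriv i (\<lambda>x. \<phi> x + \<psi> x) x = partial_deriv i \<phi> x + partial_deriv i \<psi> x"
  using assms unfolding frechet_derivative_works
  by (subst partial_deriv_eq[OF has_derivative_add]) (auto simp: partial_deriv_def)

lemma partial_deriv_mult: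
  assumes "\<phi> differentiable (at x)" "\<psi> differentiable (at x)"
  shows "partial_deriv i (\<lambda>x. \<phi> x * \<psi> x) x = \<phi> x * partial_deriv i \<psi> x + partial_deriv i \<phi> x * \<psi> x"
  using assms unfolding frechet_derivative_works
  by (subst partial_deriv_eq[OF has_derivative_mult]) (auto simp: partial_deriv_def)

lemma has_derivative_compose_real:
  fixes g :: "real \<Rightarrow> real"
  assumes "\<phi> differentiable (at x)" "(g has_real_derivative d) (at (\<phi> x))"
  shows "((\<lambda>x. g (\<phi> x)) has_derivative (\<lambda>h. d * frechet_derivative \<phi> (at x) h)) (at x)"
  using assms has_derivative_compose[of \<phi> _ x UNIV g "\<lambda>h. d * h"]
  unfolding frechet_derivative_works has_field_derivative_def by auto

lemma partial_deriv_compose: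
  fixes g :: "real \<Rightarrow> real"
  assumes "\<phi> differentiable (at x)" "(g has_real_derivative d) (at (\<phi> x))"
  shows "partial_deriv i (\<lambda>x. g (\<phi> x)) x = d * partial_deriv i \<phi> x"
  using partial_deriv_eq[OF has_derivative_compose_real[OF assms]] by (simp add: partial_deriv_def)

lemma Ck_add: "Ck k \<phi> \<Longrightarrow> Ck k \<psi> \<Longrightarrow> Ck k (\<lambda>x. \<phi> x + \<psi> x)"
proof (induction k arbitrary: \<phi> \<psi>)
  case (Suc k)
  have "partial_deriv i (\<lambda>x. \<phi> x + \<psi> x) = (\<lambda>x. partial_deriv i \<phi> x + partial_deriv i \<psi> x)" for i
    using Suc.prems by (intro ext partial_deriv_add) auto
  then show ?case using Suc by (auto intro: derivative_intros)
qed (auto intro: continuous_intros)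

lemma Ck_mult: "Ck k \<phi> \<Longrightarrow> Ck k \<psi> \<Longrightarrow> Ck k (\<lambda>x. \<phi> x * \<psi> x)"
proof (induction k arbitrary: \<phi> \<psi>)
  case (Suc k)
  have "partial_deriv i (\<lambda>x. \<phi> x * \<psi> x) =
      (\<lambda>x. \<phi> x * partial_deriv i \<psi> x + partial_deriv i \<phi> x * \<psi> x)" for i
    using Suc.prems by (intro ext partial_deriv_mult) auto
  moreover have "Ck k \<phi>" "Ck k \<psi>"
    using Suc.prems Ck_SucD by blast+
  ultimately show ?case
    using Suc by (auto intro: derivative_intros Ck_add)
qed (auto intro: continuous_intros)

lemma Ck_prod: "finite I \<Longrightarrow> (\<And>i. i \<in> I \<Longrightarrow> Ck k (\<phi> i)) \<Longrightarrow> Ck k (\<lambda>x. \<Prod>i\<in>I. \<phi> i x)"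
  by (induction I rule: finite_induct) (auto intro: Ck_const Ck_mult)

text \<open>
  The chain rule turns \<open>g\<close> into its derivative, so the induction on the order has to range over a
  class \<open>C\<close> that is closed under differentiation.
\<close>

lemma Ck_compose:
  fixes C :: "(real \<Rightarrow> real) set"
  assumes C: "\<And>g. g \<in> C \<Longrightarrow> \<exists>g'\<in>C. \<forall>t. (g has_real_derivative g' t) (at t)"
  shows "g \<in> C \<Longrightarrow> Ck k \<phi> \<Longrightarrow> Ck k (\<lambda>x. g (\<phi> x))"
proof (induction k arbitrary: g)
  case 0
  have "continuous_on UNIV g"
    using C[OF \<open>g \<in> C\<close>] by (meson DERIV_isCont continuous_at_imp_continuous_on)
  then show ?case using 0 continuous_on_compose2[of UNIV g UNIV \<phi>] by auto
next
  case (Suc k)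
  obtain g' where g': "g' \<in> C" "\<And>t. (g has_real_derivative g' t) (at t)"
    using C[OF \<open>g \<in> C\<close>] by auto
  have "partial_deriv i (\<lambda>x. g (\<phi> x)) = (\<lambda>x. g' (\<phi> x) * partial_deriv i \<phi> x)" for i
    using Suc.prems g' by (intro ext partial_deriv_compose) auto
  moreover have "Ck k (\<lambda>x. g' (\<phi> x))"
    using Suc g' Ck_SucD by blast
  moreover have "(\<lambda>x. g (\<phi> x)) differentiable (at x)" for x
    using has_derivative_compose_real[of \<phi> x g "g' (\<phi> x)"] g'(2) Suc.prems(2)
    by (auto intro: differentiableI)
  ultimately show ?case
    using Suc.prems(2) by (auto intro: Ck_mult)
qed

text \<open>
  The functions \<open>p (1/t) exp (- 1/t)\<close> on the positive half-line, extended by \<open>0\<close>. The polynomial makes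
  the class closed under differentiation, which gives smoothness at the origin as well.
\<close>

definition flat_exp :: "real poly \<Rightarrow> real \<Rightarrow> real" where
  "flat_exp p t = (if t \<le> 0 then 0 else poly p (1 / t) * exp (- 1 / t))"

lemma poly_div_exp_tendsto_0: "((\<lambda>s. poly p s / exp s) \<longlongrightarrow> (0::real)) at_top"
proof -
  have "((\<lambda>s. \<Sum>i\<le>degree p. coeff p i * (s ^ i / exp s)) \<longlongrightarrow> (\<Sum>i\<le>degree p. coeff p i * 0)) at_top"
    by (intro tendsto_intros tendsto_power_div_exp_0)
  then show ?thesis by (simp add: poly_altdef sum_divide_distrib)
qed

lemma flat_exp_tendsto_0: "(flat_exp p \<longlongrightarrow> 0) (at 0)"
proof -
  have "((\<lambda>t. poly p (1 / t) * exp (- 1 / t)) \<longlongrightarrow> 0) (at_right (0::real))"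
    using poly_div_exp_tendsto_0[of p] unfolding filterlim_at_top_to_right
    by (simp add: exp_minus field_simps)
  then have "(flat_exp p \<longlongrightarrow> 0) (at_right 0)"
    by (rule Lim_transform_eventually)
       (auto simp: flat_exp_def eventually_at_filter)
  moreover have "(flat_exp p \<longlongrightarrow> 0) (at_left 0)"
    by (rule Lim_transform_eventually[OF tendsto_const])
       (auto simp: flat_exp_def eventually_at_filter)
  ultimately show ?thesis by (simp add: filterlim_split_at)
qed

lemma flat_exp_has_derivative:
  "(flat_exp p has_real_derivative flat_exp ([:0, 0, 1:] * (p - pderiv p)) t) (at t)"
proof -
  consider "t < 0" | "t = 0" | "t > 0" by linarith
  then show ?thesis
  proof cases
    case 1
    have "((\<lambda>t. 0) has_real_derivative 0) (at t)" by simp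
    then have "(flat_exp p has_real_derivative 0) (at t)"
      by (rule DERIV_cong_ev[THEN iffD1, rotated -1])
         (use 1 in \<open>auto simp: flat_exp_def intro!: eventually_mono[OF eventually_nhds_in_open[of "{..<0}"]]\<close>)
    then show ?thesis using 1 by (simp add: flat_exp_def)
  next
    case 2
    have "((\<lambda>h. (flat_exp p (0 + h) - flat_exp p 0) / h) \<longlongrightarrow> 0) (at 0)"
      by (rule Lim_transform_eventually[OF flat_exp_tendsto_0[of "[:0, 1:] * p"]])
         (auto simp: flat_exp_def eventually_at_filter)
    then show ?thesis unfolding 2 DERIV_def by (simp add: flat_exp_def)
  next
    case 3
    have "((\<lambda>t. poly p (1 / t) * exp (- 1 / t)) has_real_derivative
        flat_exp ([:0, 0, 1:] * (p - pderiv p)) t) (at t)"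
      using 3 by (auto intro!: derivative_eq_intros DERIV_chain2[OF poly_DERIV] 
          simp: flat_exp_def field_simps power2_eq_square)
    then show ?thesis
      by (rule DERIV_cong_ev[THEN iffD1, rotated -1])
         (use 3 in \<open>auto simp: flat_exp_def intro!: eventually_mono[OF eventually_nhds_in_open[of "{0<..}"]]\<close>)
  qed
qed

lemma Ck_flat_exp: "Ck k \<phi> \<Longrightarrow> Ck k (\<lambda>x. flat_exp p (\<phi> x))"
  by (rule Ck_compose[of "range flat_exp"]) (auto intro: flat_exp_has_derivative)

lemma sqrt_smoothing_has_derivative:
  fixes e :: real
  assumes "e > 0"
  shows "((\<lambda>t. sqrt (t\<^sup>2 + e\<^sup>2) - e) has_real_derivative t / sqrt (t\<^sup>2 + e\<^sup>2)) (at t)"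
proof -
  have "t\<^sup>2 + e\<^sup>2 > 0" using assms by (simp add: add_nonneg_pos)
  then show ?thesis by (auto intro!: derivative_eq_intros simp: field_simps)
qed

text \<open>
  A smooth substitute for the absolute value. Subtracting \<open>e\<close> makes it vanish at \<open>0\<close>, so that it maps
  test functions to test functions.
\<close>

lemma Ck_sqrt_smoothing:
  fixes e :: real
  assumes "e > 0" and "Ck k \<phi>"
  shows "Ck k (\<lambda>x. sqrt ((\<phi> x)\<^sup>2 + e\<^sup>2) - e)"
proof -
  \<comment> \<open>A class that contains the square root and is closed under differentiation.\<close>
  define G where "G p a t = poly p t * (t\<^sup>2 + e\<^sup>2) powr a" for p a t
  have pos: "t\<^sup>2 + e\<^sup>2 > 0" for t using \<open>e > 0\<close> by (simp add: add_nonneg_pos)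
  have "(G p a has_real_derivative
      G (pderiv p * [:e\<^sup>2, 0, 1:] + [:0, 2 * a:] * p) (a - 1) t) (at t)" for p a t
  proof -
    have "(t\<^sup>2 + e\<^sup>2) powr a = (t\<^sup>2 + e\<^sup>2) * (t\<^sup>2 + e\<^sup>2) powr (a - 1)"
      using pos[of t] by (simp add: powr_diff)
    then have "poly (pderiv p) t * (t\<^sup>2 + e\<^sup>2) powr a + a * (2 * t) * (t\<^sup>2 + e\<^sup>2) powr (a - 1) * poly p t =
        G (pderiv p * [:e\<^sup>2, 0, 1:] + [:0, 2 * a:] * p) (a - 1) t"
      unfolding G_def by (simp add: algebra_simps power2_eq_square)
    moreover have "(G p a has_real_derivative poly (pderiv p) t * (t\<^sup>2 + e\<^sup>2) powr a +
        a * (2 * t) * (t\<^sup>2 + e\<^sup>2) powr (a - 1) * poly p t) (at t)"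
      unfolding G_def using pos[of t]
      by (auto intro!: derivative_eq_intros simp: field_simps powr_diff)
    ultimately show ?thesis by simp
  qed
  then have "\<exists>g'\<in>{G p a | p a. True}. \<forall>t. (g has_real_derivative g' t) (at t)"
    if "g \<in> {G p a | p a. True}" for g
  proof -
    obtain p a where "g = G p a" using \<open>g \<in> {G p a | p a. True}\<close> by auto
    then show ?thesis
      using \<open>\<And>p a t. (G p a has_real_derivative
        G (pderiv p * [:e\<^sup>2, 0, 1:] + [:0, 2 * a:] * p) (a - 1) t) (at t)\<close>[of p a]
      by (intro bexI[of _ "G (pderiv p * [:e\<^sup>2, 0, 1:] + [:0, 2 * a:] * p) (a - 1)"]) auto
  qed
  then have "Ck k (\<lambda>x. G p a (\<phi> x))" for p a
    by (rule Ck_compose[of "{G p a | p a. True}", OF _ _ \<open>Ck k \<phi>\<close>]) auto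
  moreover have "G 1 (1 / 2) t = sqrt (t\<^sup>2 + e\<^sup>2)" for t
    unfolding G_def using pos[of t] by (simp add: powr_half_sqrt)
  ultimately have "Ck k (\<lambda>x. sqrt ((\<phi> x)\<^sup>2 + e\<^sup>2))"
    by (simp flip: \<open>\<And>t. G 1 (1 / 2) t = sqrt (t\<^sup>2 + e\<^sup>2)\<close>)
  from Ck_add[OF this Ck_const[of k "-e"]] show ?thesis by simp
qed

section \<open>Test functions\<close>

text \<open>Any compact set outside of which the function vanishes may replace its closed support.\<close>

lemma test_functionsI:
  assumes "\<And>k. Ck k \<psi>" "compact K" "K \<subseteq> \<Omega>" "\<And>x. x \<notin> K \<Longrightarrow> \<psi> x = 0"
  shows "\<psi> \<in> test_functions \<Omega>"
proof -
  have "closure {x. \<psi> x \<noteq> 0} \<subseteq> K"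
    using assms by (intro closure_minimal compact_imp_closed) auto
  moreover from this have "compact (closure {x. \<psi> x \<noteq> 0})"
    using compact_Int_closed[OF assms(2) closed_closure, of "{x. \<psi> x \<noteq> 0}"] by (simp add: Int_absorb1)
  ultimately show ?thesis
    using assms unfolding test_functions_def by auto
qed

lemma test_functionsE:
  assumes "\<phi> \<in> test_functions \<Omega>"
  obtains K where "compact K" "K \<subseteq> \<Omega>" "\<And>x. x \<notin> K \<Longrightarrow> \<phi> x = 0"
proof (rule that[of "closure {x. \<phi> x \<noteq> 0}"])
  show "\<phi> x = 0" if "x \<notin> closure {x. \<phi> x \<noteq> 0}" for x
    using that closure_subset[of "{x. \<phi> x \<noteq> 0}"] by auto
qed (use assms in \<open>auto simp: test_functions_def\<close>)

lemma test_functions_Ck: "\<phi> \<in> test_functions \<Omega> \<Longrightarrow> Ck k \<phi>"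
  by (simp add: test_functions_def)

lemma test_functions_differentiable: "\<phi> \<in> test_functions \<Omega> \<Longrightarrow> \<phi> differentiable (at x)"
  using test_functions_Ck[of \<phi> \<Omega> "Suc 0"] by simp

lemma test_functions_continuous: "\<phi> \<in> test_functions \<Omega> \<Longrightarrow> continuous_on UNIV \<phi>"
  using test_functions_Ck[of \<phi> \<Omega> 0] by simp

lemma test_functions_mono: "\<phi> \<in> test_functions \<Omega> \<Longrightarrow> \<Omega> \<subseteq> \<Omega>' \<Longrightarrow> \<phi> \<in> test_functions \<Omega>'"
  unfolding test_functions_def by auto

lemma test_functions_outside: "\<phi> \<in> test_functions \<Omega> \<Longrightarrow> x \<notin> \<Omega> \<Longrightarrow> \<phi> x = 0"
  by (metis subsetD test_functionsE)

lemma test_functions_0: "(\<lambda>x. 0) \<in> test_functions \<Omega>"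
  by (rule test_functionsI[of _ "{}"]) (auto intro: Ck_const)

lemma test_functions_add:
  assumes "\<phi> \<in> test_functions \<Omega>" "\<psi> \<in> test_functions \<Omega>"
  shows "(\<lambda>x. \<phi> x + \<psi> x) \<in> test_functions \<Omega>"
proof -
  obtain K where K: "compact K" "K \<subseteq> \<Omega>" "\<And>x. x \<notin> K \<Longrightarrow> \<phi> x = 0"
    using test_functionsE[OF assms(1)] by blast
  obtain L where L: "compact L" "L \<subseteq> \<Omega>" "\<And>x. x \<notin> L \<Longrightarrow> \<psi> x = 0"
    using test_functionsE[OF assms(2)] by blast
  show ?thesis
    by (rule test_functionsI[of _ "K \<union> L"])
       (use K L assms in \<open>auto intro: Ck_add test_functions_Ck\<close>)
qed

lemma test_functions_mult:
  assumes "\<phi> \<in> test_functions \<Omega>" "\<And>k. Ck k \<psi>"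
  shows "(\<lambda>x. \<psi> x * \<phi> x) \<in> test_functions \<Omega>"
proof -
  obtain K where K: "compact K" "K \<subseteq> \<Omega>" "\<And>x. x \<notin> K \<Longrightarrow> \<phi> x = 0"
    using test_functionsE[OF assms(1)] by blast
  show ?thesis
    by (rule test_functionsI[of _ K]) (use K assms in \<open>auto intro: Ck_mult test_functions_Ck\<close>)
qed

lemma test_functions_partial_deriv:
  assumes "\<phi> \<in> test_functions \<Omega>"
  shows "partial_deriv i \<phi> \<in> test_functions \<Omega>"
proof -
  obtain K where K: "compact K" "K \<subseteq> \<Omega>" "\<And>x. x \<notin> K \<Longrightarrow> \<phi> x = 0"
    using test_functionsE[OF assms] by blast
  have "partial_deriv i \<phi> x = 0" if "x \<notin> K" for x
  proof -
    have "((\<lambda>_. 0) has_derivative (\<lambda>_. 0)) (at x)" by simp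
    then have "(\<phi> has_derivative (\<lambda>_. 0)) (at x)"
      by (rule has_derivative_transform_within_open[of _ _ _ _ "-K"])
         (use K that in \<open>auto simp: compact_imp_closed open_Compl\<close>)
    from partial_deriv_eq[OF this] show ?thesis by simp
  qed
  moreover have "Ck k (partial_deriv i \<phi>)" for k
    using test_functions_Ck[OF assms, of "Suc k"] by simp
  ultimately show ?thesis
    using K by (intro test_functionsI[of _ K]) auto
qed

lemma test_functions_bounded:
  assumes "\<phi> \<in> test_functions \<Omega>"
  obtains B where "B > 0" "\<And>x. \<bar>\<phi> x\<bar> \<le> B"
proof -
  obtain K where K: "compact K" "K \<subseteq> \<Omega>" "\<And>x. x \<notin> K \<Longrightarrow> \<phi> x = 0"
    using test_functionsE[OF assms] by blast
  have "bounded (\<phi> ` K)"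
    using K test_functions_continuous[OF assms] 
    by (intro compact_imp_bounded compact_continuous_image) (auto intro: continuous_on_subset)
  then obtain B where B: "B > 0" "\<And>x. x \<in> K \<Longrightarrow> \<bar>\<phi> x\<bar> \<le> B"
    unfolding bounded_pos by auto
  then have "\<bar>\<phi> x\<bar> \<le> B" for x using K(3)[of x] by (cases "x \<in> K") auto
  then show thesis using that B by blast
qed

lemma test_functions_borel: "\<phi> \<in> test_functions \<Omega> \<Longrightarrow> \<phi> \<in> borel_measurable borel"
  by (intro borel_measurable_continuous_onI test_functions_continuous)

text \<open>
  The integral of a difference quotient vanishes by translation invariance of the measure, and the
  difference quotients converge boundedly to the partial derivative.
\<close>

lemma integral_partial_deriv_eq_0:
  fixes \<phi> :: "real^'n::finite \<Rightarrow> real"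
  assumes \<phi>: "\<phi> \<in> test_functions UNIV"
  shows "(\<integral>x. partial_deriv i \<phi> x \<partial>lborel) = 0"
proof -
  define e :: "real^'n" where "e = axis i 1"
  define h where "h n = 1 / real (Suc n)" for n
  have h: "0 < h n" "h n \<le> 1" for n by (auto simp: h_def)
  have h0: "h \<longlonglongrightarrow> 0"
    unfolding h_def using LIMSEQ_inverse_real_of_nat by (simp add: inverse_eq_divide)
  define q where "q n x = (\<phi> (x + h n *\<^sub>R e) - \<phi> x) / h n" for n x
  note d\<phi> = test_functions_partial_deriv[OF \<phi>, of i]
  obtain B where B: "B > 0" "\<And>x. \<bar>partial_deriv i \<phi> x\<bar> \<le> B"
    using test_functions_bounded[OF d\<phi>] by blast
  obtain K where K: "compact K" "K \<subseteq> UNIV" "\<And>x. x \<notin> K \<Longrightarrow> \<phi> x = 0"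
    using test_functionsE[OF \<phi>] by blast
  obtain R where R: "R > 0" "\<And>x. x \<in> K \<Longrightarrow> norm x \<le> R"
    using compact_imp_bounded[OF K(1)] unfolding bounded_pos by auto
  have der: "((\<lambda>s. \<phi> (x + s *\<^sub>R e)) has_real_derivative partial_deriv i \<phi> (x + t *\<^sub>R e)) (at t)" for x t
  proof -
    have "(\<phi> has_derivative frechet_derivative \<phi> (at (x + t *\<^sub>R e))) (at (x + t *\<^sub>R e))"
      using test_functions_differentiable[OF \<phi>] frechet_derivative_works by blast
    moreover have "((\<lambda>s. x + s *\<^sub>R e) has_derivative (\<lambda>s. s *\<^sub>R e)) (at t)"
      by (auto intro!: derivative_eq_intros)
    ultimately have "((\<lambda>s. \<phi> (x + s *\<^sub>R e)) has_derivative
        (\<lambda>s. frechet_derivative \<phi> (at (x + t *\<^sub>R e)) (s *\<^sub>R e))) (at t)"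
      using has_derivative_compose[of "\<lambda>s. x + s *\<^sub>R e" "\<lambda>s. s *\<^sub>R e" t UNIV \<phi>] by simp
    moreover have "frechet_derivative \<phi> (at y) (s *\<^sub>R e) = partial_deriv i \<phi> y * s" for y s
      using linear_cmul[OF linear_frechet_derivative[OF test_functions_differentiable[OF \<phi>, of y]], of s e]
      by (simp add: partial_deriv_def e_def)
    ultimately show ?thesis unfolding has_field_derivative_def by simp
  qed
  have q_lim: "(\<lambda>n. q n x) \<longlonglongrightarrow> partial_deriv i \<phi> x" for x
  proof -
    have "((\<lambda>t. (\<phi> (x + t *\<^sub>R e) - \<phi> x) / t) \<longlongrightarrow> partial_deriv i \<phi> x) (at 0)"
      using der[of x 0] unfolding DERIV_def by simp
    moreover have "filterlim h (at 0) sequentially"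
      using h0 h(1) by (intro filterlim_atI) (auto intro!: always_eventually, metis less_irrefl)
    ultimately show ?thesis
      unfolding q_def by (rule filterlim_compose)
  qed
  \<comment> \<open>The steps are at most \<open>1\<close>, so all quotients vanish outside the ball of radius \<open>R + 1\<close>.\<close>
  have q_bound: "norm (q n x) \<le> B * indicator (cball 0 (R + 1)) x" for n x
  proof (cases "x \<in> cball 0 (R + 1)")
    case True
    obtain z where "\<phi> (x + h n *\<^sub>R e) - \<phi> (x + 0 *\<^sub>R e) = (h n - 0) * partial_deriv i \<phi> (x + z *\<^sub>R e)"
      using MVT2[OF h(1)[of n], of "\<lambda>s. \<phi> (x + s *\<^sub>R e)" "\<lambda>s. partial_deriv i \<phi> (x + s *\<^sub>R e)"] der by blast
    then show ?thesis using True h(1)[of n] B(2) by (simp add: q_def)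
  next
    case False
    have "norm (h n *\<^sub>R e) \<le> 1" using h[of n] by (simp add: e_def)
    then have "norm (x + h n *\<^sub>R e) > R" 
      using False norm_diff_ineq[of x "h n *\<^sub>R e"] by simp
    moreover have "\<phi> y = 0" if "norm y > R" for y
      using K(3) R(2)[of y] that by (meson not_le)
    ultimately have "\<phi> (x + h n *\<^sub>R e) = 0" "\<phi> x = 0"
      using False by auto
    then show ?thesis using False by (simp add: q_def)
  qed
  have int: "integrable lborel \<phi>"
  proof -
    obtain C where C: "C > 0" "\<And>x. \<bar>\<phi> x\<bar> \<le> C" using test_functions_bounded[OF \<phi>] by blast
    show ?thesis
      by (rule integrableI_bounded_set[where A = K and B = C])
        (use K test_functions_borel[OF \<phi>] emeasure_bounded_finite[OF compact_imp_bounded[OF K(1)]] C(2) in \<open>auto simp: compact_imp_closed\<close>)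
  qed
  have "(\<integral>x. q n x \<partial>lborel) = 0" for n
  proof -
    have "has_bochner_integral lborel \<phi> (integral\<^sup>L lborel \<phi>)"
      using int by (simp add: has_bochner_integral_iff)
    then have "has_bochner_integral lborel (\<lambda>x. \<phi> (h n *\<^sub>R e + x)) (integral\<^sup>L lborel \<phi>)"
      using test_functions_borel[OF \<phi>]
        integrable_distr_eq[of "(+) (h n *\<^sub>R e)" lborel borel \<phi>]
        integral_distr[of "(+) (h n *\<^sub>R e)" lborel borel \<phi>]
      by (simp add: has_bochner_integral_iff lborel_distr_plus)
    then have "integral\<^sup>L lborel (\<lambda>x. \<phi> (x + h n *\<^sub>R e)) = integral\<^sup>L lborel \<phi>"
      "integrable lborel (\<lambda>x. \<phi> (x + h n *\<^sub>R e))"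
      by (simp_all add: has_bochner_integral_iff add.commute)
    then show ?thesis using int by (simp add: q_def)
  qed
  moreover have "(\<lambda>n. \<integral>x. q n x \<partial>lborel) \<longlonglongrightarrow> (\<integral>x. partial_deriv i \<phi> x \<partial>lborel)"
  proof (rule integral_dominated_convergence[where w = "\<lambda>x. B * indicator (cball 0 (R + 1)) x"])
    show "integrable lborel (\<lambda>x::real^'n. B * indicator (cball 0 (R + 1)) x)"
      using emeasure_bounded_finite[of "cball (0::real^'n) (R + 1)"]
      by (intro integrable_mult_right integrable_real_indicator) auto
    show "q n \<in> borel_measurable lborel" for n
      unfolding q_def using test_functions_borel[OF \<phi>] by measurable
    show "partial_deriv i \<phi> \<in> borel_measurable lborel"
      using test_functions_borel[OF d\<phi>] by simp
    show "AE x in lborel. (\<lambda>n. q n x) \<longlonglongrightarrow> partial_deriv i \<phi> x"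
      by (intro always_eventually allI q_lim)
    show "AE x in lborel. norm (q n x) \<le> B * indicator (cball 0 (R + 1)) x" for n
      by (intro always_eventually allI q_bound)
  qed
  ultimately show ?thesis by (simp add: LIMSEQ_const_iff)
qed

lemma integral_lebesgue_on_eq_lborel:
  fixes g :: "'a::euclidean_space \<Rightarrow> real"
  assumes "\<Omega> \<in> sets lebesgue" "g \<in> borel_measurable borel" "\<And>x. x \<notin> \<Omega> \<Longrightarrow> g x = 0"
  shows "(\<integral>x. g x \<partial>lebesgue_on \<Omega>) = (\<integral>x. g x \<partial>lborel)"
proof -
  have "(\<integral>x. g x \<partial>lebesgue_on \<Omega>) = (\<integral>x. (if x \<in> \<Omega> then g x else 0) \<partial>lebesgue)"
    using Lebesgue_Measure.integral_restrict_UNIV[OF assms(1), of g] by simp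
  also have "\<dots> = (\<integral>x. g x \<partial>lebesgue)"
    using assms(3) by (intro Bochner_Integration.integral_cong) auto
  also have "\<dots> = (\<integral>x. g x \<partial>lborel)"
    using assms(2) by (intro integral_completion) simp
  finally show ?thesis .
qed

lemma integral_by_parts_test:
  fixes \<phi> \<psi> :: "real^'n::finite \<Rightarrow> real"
  assumes "open \<Omega>" "\<phi> \<in> test_functions \<Omega>" "\<And>k. Ck k \<psi>"
  shows "(\<integral>x. (\<psi> x * partial_deriv i \<phi> x + partial_deriv i \<psi> x * \<phi> x) \<partial>lebesgue_on \<Omega>) = 0"
proof -
  have t: "(\<lambda>x. \<psi> x * \<phi> x) \<in> test_functions \<Omega>"
    using assms by (intro test_functions_mult)
  have eq: "partial_deriv i (\<lambda>x. \<psi> x * \<phi> x) x = \<psi> x * partial_deriv i \<phi> x + partial_deriv i \<psi> x * \<phi> x" for x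
    using assms(3)[of "Suc 0"] by (intro partial_deriv_mult test_functions_differentiable[OF assms(2)]) auto
  have "(\<integral>x. partial_deriv i (\<lambda>x. \<psi> x * \<phi> x) x \<partial>lebesgue_on \<Omega>) = 0"
    using test_functions_partial_deriv[OF t] assms(1)
    by (subst integral_lebesgue_on_eq_lborel)
       (auto intro: test_functions_borel test_functions_outside 
         integral_partial_deriv_eq_0 test_functions_mono[OF t])
  then show ?thesis by (simp add: eq)
qed

section \<open>Square integrable functions\<close>

text \<open>The defining property of \<open>L2 \<Omega>\<close>, for an arbitrary measure.\<close>

definition square_integrable :: "'a measure \<Rightarrow> ('a \<Rightarrow> real) \<Rightarrow> bool" where
  "square_integrable M v \<longleftrightarrow> v \<in> borel_measurable M \<and> integrable M (\<lambda>x. (v x)\<^sup>2)"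

definition sq_norm :: "'a measure \<Rightarrow> ('a \<Rightarrow> real) \<Rightarrow> real" where
  "sq_norm M v = (\<integral>x. (v x)\<^sup>2 \<partial>M)"

lemma L2_iff: "v \<in> L2 \<Omega> \<longleftrightarrow> square_integrable (lebesgue_on \<Omega>) v"
  by (simp add: L2_def square_integrable_def)

lemma square_integrable_measurable [measurable_dest]: "square_integrable M v \<Longrightarrow> v \<in> borel_measurable M"
  and square_integrable_sq: "square_integrable M v \<Longrightarrow> integrable M (\<lambda>x. (v x)\<^sup>2)"
  by (simp_all add: square_integrable_def)

lemma square_integrable_bound:
  assumes "square_integrable M v" "w \<in> borel_measurable M" "AE x in M. \<bar>w x\<bar> \<le> \<bar>v x\<bar>"
  shows "square_integrable M w"
proof -
  have "AE x in M. norm ((w x)\<^sup>2) \<le> norm ((v x)\<^sup>2)"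
    using assms(3) by eventually_elim (simp add: abs_le_square_iff)
  then show ?thesis
    using Bochner_Integration.integrable_bound[OF square_integrable_sq[OF assms(1)], of "\<lambda>x. (w x)\<^sup>2"] assms(2)
    by (simp add: square_integrable_def)
qed

lemma square_integrable_mult:
  assumes "square_integrable M v" "square_integrable M w"
  shows "integrable M (\<lambda>x. v x * w x)"
proof (rule Bochner_Integration.integrable_bound)
  show "integrable M (\<lambda>x. (v x)\<^sup>2 + (w x)\<^sup>2)"
    using assms by (simp add: square_integrable_sq)
  have "\<bar>a * b\<bar> \<le> a\<^sup>2 + b\<^sup>2" for a b :: real
  proof -
    have "2 * \<bar>a * b\<bar> \<le> a\<^sup>2 + b\<^sup>2"
      using sum_squares_bound[of "\<bar>a\<bar>" "\<bar>b\<bar>"] by (simp add: abs_mult mult.assoc)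
    then show ?thesis by linarith
  qed
  then show "AE x in M. norm (v x * w x) \<le> norm ((v x)\<^sup>2 + (w x)\<^sup>2)"
    by (intro always_eventually allI) simp
qed (use assms in measurable)

lemma square_integrable_cmult:
  assumes "square_integrable M v" shows "square_integrable M (\<lambda>x. c * v x)"
  using assms unfolding square_integrable_def
  by (auto simp: power_mult_distrib intro!: borel_measurable_times)

lemma square_integrable_add:
  assumes "square_integrable M v" "square_integrable M w"
  shows "square_integrable M (\<lambda>x. v x + w x)"
proof -
  have "integrable M (\<lambda>x. (v x)\<^sup>2 + (w x)\<^sup>2 + 2 * (v x * w x))"
    using assms square_integrable_mult[OF assms] by (simp add: square_integrable_sq)
  then show ?thesis
    using assms unfolding square_integrable_def
    by (auto simp: power2_sum mult.assoc intro!: borel_measurable_add)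
qed

lemma square_integrable_diff:
  assumes "square_integrable M v" "square_integrable M w"
  shows "square_integrable M (\<lambda>x. v x - w x)"
  using square_integrable_add[OF assms(1) square_integrable_cmult[OF assms(2), of "-1"]] by simp

lemma square_integrable_zero: "square_integrable M (\<lambda>x. 0)"
  by (simp add: square_integrable_def)

lemma square_integrable_bounded_mult:
  assumes "square_integrable M v" "\<rho> \<in> borel_measurable M" "\<And>x. \<bar>\<rho> x\<bar> \<le> 1"
  shows "square_integrable M (\<lambda>x. \<rho> x * v x)"
  by (rule square_integrable_bound[OF assms(1)])
     (use assms in \<open>auto simp: abs_mult intro!: mult_left_le_one_le\<close>)

lemma square_integrable_bounded:
  assumes "finite_measure M" "v \<in> borel_measurable M" "\<And>x. \<bar>v x\<bar> \<le> B"
  shows "square_integrable M v"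
  unfolding square_integrable_def
proof
  show "integrable M (\<lambda>x. (v x)\<^sup>2)"
    using assms(2,3) abs_le_square_iff[of "v _" B] order_trans[OF assms(3) abs_ge_self]
    by (intro finite_measure.integrable_const_bound[OF assms(1), of _ "B\<^sup>2"]) auto
qed (use assms in auto)

lemma square_integrable_integrable:
  assumes "finite_measure M" "square_integrable M v"
  shows "integrable M v"
  using square_integrable_mult[OF square_integrable_bounded[OF assms(1), of "\<lambda>x. 1" 1] assms(2)] by simp

lemma sq_norm_nonneg: "0 \<le> sq_norm M v"
  by (simp add: sq_norm_def)

lemma sq_norm_minus_commute: "sq_norm M (\<lambda>x. v x - w x) = sq_norm M (\<lambda>x. w x - v x)"
  by (simp add: sq_norm_def power2_commute)

lemma sq_norm_cmult: "sq_norm M (\<lambda>x. c * v x) = c\<^sup>2 * sq_norm M v"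
  by (simp add: sq_norm_def power_mult_distrib)

lemma sq_norm_eq_0_iff:
  assumes "square_integrable M v"
  shows "sq_norm M v = 0 \<longleftrightarrow> (AE x in M. v x = 0)"
  unfolding sq_norm_def using assms square_integrable_sq
  by (subst integral_nonneg_eq_0_iff_AE) auto

lemma sq_norm_mono:
  assumes "square_integrable M v" "square_integrable M w" "AE x in M. \<bar>w x\<bar> \<le> \<bar>v x\<bar>"
  shows "sq_norm M w \<le> sq_norm M v"
  unfolding sq_norm_def using assms(3)
  by (intro integral_mono_AE square_integrable_sq assms) (auto simp: abs_le_square_iff)

lemma sq_norm_add:
  assumes "square_integrable M v" "square_integrable M w"
  shows "sq_norm M (\<lambda>x. v x + w x) = sq_norm M v + 2 * (\<integral>x. v x * w x \<partial>M) + sq_norm M w"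
proof -
  have "sq_norm M (\<lambda>x. v x + w x) = (\<integral>x. (v x)\<^sup>2 + (2 * (v x * w x) + (w x)\<^sup>2) \<partial>M)"
    unfolding sq_norm_def by (intro Bochner_Integration.integral_cong) (auto simp: power2_sum)
  then show ?thesis
    using assms square_integrable_mult[OF assms] by (simp add: square_integrable_sq sq_norm_def)
qed

lemma sq_norm_add_le:
  assumes "square_integrable M v" "square_integrable M w"
  shows "sq_norm M (\<lambda>x. v x + w x) \<le> 2 * sq_norm M v + 2 * sq_norm M w"
proof -
  have "sq_norm M (\<lambda>x. v x + w x) \<le> (\<integral>x. 2 * (v x)\<^sup>2 + 2 * (w x)\<^sup>2 \<partial>M)"
    unfolding sq_norm_def
  proof (rule integral_mono)
    show "(v x + w x)\<^sup>2 \<le> 2 * (v x)\<^sup>2 + 2 * (w x)\<^sup>2" for x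
      using sum_squares_bound[of "v x" "w x"] by (simp add: power2_sum)
  qed (use assms square_integrable_add[OF assms] in \<open>auto simp: square_integrable_sq\<close>)
  also have "\<dots> = 2 * sq_norm M v + 2 * sq_norm M w"
    using assms by (simp add: square_integrable_sq sq_norm_def)
  finally show ?thesis .
qed

lemma sq_norm_diff_triangle:
  assumes "square_integrable M u" "square_integrable M v" "square_integrable M w"
  shows "sq_norm M (\<lambda>x. u x - w x) \<le> 2 * sq_norm M (\<lambda>x. u x - v x) + 2 * sq_norm M (\<lambda>x. v x - w x)"
  using sq_norm_add_le[OF square_integrable_diff[OF assms(1,2)] square_integrable_diff[OF assms(2,3)]] by simp

lemma Cauchy_Schwarz_integral:
  assumes v: "square_integrable M v" and w: "square_integrable M w"
  shows "(\<integral>x. v x * w x \<partial>M)\<^sup>2 \<le> sq_norm M v * sq_norm M w"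
proof (cases "sq_norm M w = 0")
  case True
  then have "AE x in M. v x * w x = 0"
    using sq_norm_eq_0_iff[OF w] by auto
  then have "(\<integral>x. v x * w x \<partial>M) = 0" by (rule integral_eq_zero_AE)
  then show ?thesis by (simp add: True)
next
  case False
  define B where "B = (\<integral>x. v x * w x \<partial>M)"
  have pos: "sq_norm M w > 0" using False sq_norm_nonneg[of M w] by simp
  \<comment> \<open>This \<open>t\<close> minimises the norm on the line \<open>v + t w\<close>.\<close>
  define t where "t = - B / sq_norm M w"
  have "0 \<le> sq_norm M (\<lambda>x. v x + t * w x)" by (rule sq_norm_nonneg)
  also have "\<dots> = sq_norm M v + 2 * (t * B) + t\<^sup>2 * sq_norm M w"
    unfolding sq_norm_add[OF v square_integrable_cmult[OF w]] sq_norm_cmult B_def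
    by (simp add: mult.left_commute)
  also have "\<dots> = sq_norm M v - B\<^sup>2 / sq_norm M w"
    using pos by (simp add: t_def power2_eq_square field_simps)
  finally show ?thesis using pos by (simp add: B_def field_simps)
qed

lemma Cauchy_Schwarz_integral_abs:
  assumes v: "square_integrable M v" and w: "square_integrable M w"
  shows "\<bar>\<integral>x. v x * w x \<partial>M\<bar> \<le> sqrt (sq_norm M v) * sqrt (sq_norm M w)"
  using real_sqrt_le_mono[OF Cauchy_Schwarz_integral[OF assms]] by (simp add: real_sqrt_mult)

definition tendsto_L2 :: "'a measure \<Rightarrow> (nat \<Rightarrow> 'a \<Rightarrow> real) \<Rightarrow> ('a \<Rightarrow> real) \<Rightarrow> bool" where
  "tendsto_L2 M s v \<longleftrightarrow> (\<lambda>n. sq_norm M (\<lambda>x. s n x - v x)) \<longlonglongrightarrow> 0"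

lemma tendsto_L2_const: "tendsto_L2 M (\<lambda>n. v) v"
  by (simp add: tendsto_L2_def sq_norm_def)

lemma tendsto_L2_inner:
  assumes "tendsto_L2 M s v" "\<And>n. square_integrable M (s n)" "square_integrable M v" "square_integrable M w"
  shows "(\<lambda>n. \<integral>x. s n x * w x \<partial>M) \<longlonglongrightarrow> (\<integral>x. v x * w x \<partial>M)"
proof -
  have "(\<lambda>n. \<integral>x. (s n x - v x) * w x \<partial>M) \<longlonglongrightarrow> 0"
  proof (rule Lim_null_comparison)
    show "\<forall>\<^sub>F n in sequentially. norm (\<integral>x. (s n x - v x) * w x \<partial>M) \<le>
        sqrt (sq_norm M (\<lambda>x. s n x - v x)) * sqrt (sq_norm M w)"
      using Cauchy_Schwarz_integral_abs[OF square_integrable_diff[OF assms(2,3)] assms(4)]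
      by (intro always_eventually allI) simp
    have "(\<lambda>n. sqrt (sq_norm M (\<lambda>x. s n x - v x)) * sqrt (sq_norm M w)) \<longlonglongrightarrow> sqrt 0 * sqrt (sq_norm M w)"
      using assms(1) unfolding tendsto_L2_def by (intro tendsto_intros)
    then show "(\<lambda>n. sqrt (sq_norm M (\<lambda>x. s n x - v x)) * sqrt (sq_norm M w)) \<longlonglongrightarrow> 0" by simp
  qed
  moreover have "(\<integral>x. (s n x - v x) * w x \<partial>M) = (\<integral>x. s n x * w x \<partial>M) - (\<integral>x. v x * w x \<partial>M)" for n
    unfolding left_diff_distrib using assms
    by (intro Bochner_Integration.integral_diff square_integrable_mult) auto
  ultimately show ?thesis by (simp add: LIM_zero_iff)
qed

lemma tendsto_L2_AE_subseq:
  assumes "tendsto_L2 M s v" "\<And>n. square_integrable M (s n)" "square_integrable M v"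
  obtains r where "strict_mono r" "AE x in M. (\<lambda>n. s (r n) x) \<longlonglongrightarrow> v x"
proof -
  have "integrable M (\<lambda>x. (s n x - v x)\<^sup>2)" for n
    using assms by (intro square_integrable_sq square_integrable_diff)
  moreover have "(\<lambda>n. \<integral>x. norm ((s n x - v x)\<^sup>2) \<partial>M) \<longlonglongrightarrow> 0"
    using assms(1) by (simp add: tendsto_L2_def sq_norm_def)
  ultimately obtain r :: "nat \<Rightarrow> nat"
    where r: "strict_mono r" "AE x in M. (\<lambda>n. (s (r n) x - v x)\<^sup>2) \<longlonglongrightarrow> 0"
    using tendsto_L1_AE_subseq[of M "\<lambda>n x. (s n x - v x)\<^sup>2"] by auto
  from r(2) have "AE x in M. (\<lambda>n. s (r n) x) \<longlonglongrightarrow> v x"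
    by eventually_elim (simp add: LIM_zero_iff)
  with r(1) that show thesis by blast
qed

lemma tendsto_L2_dominated:
  assumes "\<And>n. square_integrable M (s n)" "v \<in> borel_measurable M" "square_integrable M g"
    and "AE x in M. (\<lambda>n. s n x) \<longlonglongrightarrow> v x" and "\<And>n. AE x in M. \<bar>s n x\<bar> \<le> \<bar>g x\<bar>"
  shows "square_integrable M v" "tendsto_L2 M s v"
proof -
  have bd: "AE x in M. \<forall>n. \<bar>s n x\<bar> \<le> \<bar>g x\<bar>" using assms(5) by (simp add: AE_all_countable)
  then have bv: "AE x in M. \<bar>v x\<bar> \<le> \<bar>g x\<bar>"
    using assms(4)
  proof eventually_elim
    case (elim x)
    then show ?case by (intro LIMSEQ_le_const2[OF tendsto_rabs[OF elim(2)]]) auto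
  qed
  show v: "square_integrable M v"
    by (rule square_integrable_bound[OF assms(3,2) bv])
  have "(\<lambda>n. \<integral>x. (s n x - v x)\<^sup>2 \<partial>M) \<longlonglongrightarrow> (\<integral>x. 0 \<partial>M)"
  proof (rule integral_dominated_convergence[where w = "\<lambda>x. 4 * (g x)\<^sup>2"])
    show "AE x in M. norm ((s n x - v x)\<^sup>2) \<le> 4 * (g x)\<^sup>2" for n
      using bd bv
    proof eventually_elim
      case (elim x)
      have "\<bar>s n x - v x\<bar> \<le> \<bar>2 * g x\<bar>" using elim(2) spec[OF elim(1), of n] by simp
      then show ?case unfolding abs_le_square_iff by (simp add: power_mult_distrib)
    qed
    show "AE x in M. (\<lambda>n. (s n x - v x)\<^sup>2) \<longlonglongrightarrow> 0"
      using assms(4)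
    proof eventually_elim
      case (elim x)
      then have "(\<lambda>n. (s n x - v x)\<^sup>2) \<longlonglongrightarrow> (v x - v x)\<^sup>2" by (intro tendsto_intros)
      then show ?case by simp
    qed
  qed (use assms v in \<open>auto simp: square_integrable_sq intro: square_integrable_measurable\<close>)
  then show "tendsto_L2 M s v" by (simp add: tendsto_L2_def sq_norm_def)
qed

text \<open>
  On a finite measure space a Cauchy sequence in mean square is one in the mean, so a subsequence
  converges almost everywhere. By Fatou's lemma its pointwise limit is also the limit in mean square.
\<close>

lemma Cauchy_L2_convergent:
  assumes fin: "finite_measure M" and s: "\<And>n. square_integrable M (s n)"
    and C: "\<And>e. e > 0 \<Longrightarrow> \<exists>N. \<forall>i\<ge>N. \<forall>j\<ge>N. sq_norm M (\<lambda>x. s i x - s j x) < e"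
  shows "\<exists>v. square_integrable M v \<and> tendsto_L2 M s v"
proof -
  \<comment> \<open>The summand \<open>1\<close> only keeps \<open>m\<close> positive when the measure is zero.\<close>
  define m where "m = sqrt (sq_norm M (\<lambda>x. 1)) + 1"
  have m: "m > 0" unfolding m_def using sq_norm_nonneg[of M "\<lambda>x. 1"] by (simp add: add_nonneg_pos)
  have L1: "(\<integral>x. norm (s i x - s j x) \<partial>M) \<le> m * sqrt (sq_norm M (\<lambda>x. s i x - s j x))" for i j
  proof -
    have d: "square_integrable M (\<lambda>x. \<bar>s i x - s j x\<bar>)"
      by (rule square_integrable_bound[OF square_integrable_diff[OF s[of i] s[of j]]])
         (use s in \<open>auto intro: square_integrable_measurable\<close>)
    have 1: "square_integrable M (\<lambda>x. 1)" by (rule square_integrable_bounded[OF fin, of _ 1]) auto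
    have "(\<integral>x. norm (s i x - s j x) \<partial>M) \<le> sqrt (sq_norm M (\<lambda>x. 1)) * sqrt (sq_norm M (\<lambda>x. s i x - s j x))"
      using Cauchy_Schwarz_integral_abs[OF 1 d] by (simp add: sq_norm_def)
    also have "\<dots> \<le> m * sqrt (sq_norm M (\<lambda>x. s i x - s j x))"
      unfolding m_def by (intro mult_right_mono) (auto simp: sq_norm_nonneg)
    finally show ?thesis .
  qed
  have int: "integrable M (s n)" for n by (rule square_integrable_integrable[OF fin s])
  have "\<exists>N. \<forall>i\<ge>N. \<forall>j\<ge>N. LINT x|M. norm (s i x - s j x) < e" if "e > 0" for e
  proof -
    obtain N where N: "\<And>i j. i \<ge> N \<Longrightarrow> j \<ge> N \<Longrightarrow> sq_norm M (\<lambda>x. s i x - s j x) < (e / m)\<^sup>2"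
      using C[of "(e / m)\<^sup>2"] \<open>e > 0\<close> m by auto
    have "LINT x|M. norm (s i x - s j x) < e" if "i \<ge> N" "j \<ge> N" for i j
    proof -
      have "sqrt (sq_norm M (\<lambda>x. s i x - s j x)) < e / m"
        using real_sqrt_less_mono[OF N[OF that]] \<open>e > 0\<close> m by simp
      then have "m * sqrt (sq_norm M (\<lambda>x. s i x - s j x)) < e" using m by (simp add: field_simps)
      with L1[of i j] show ?thesis by simp
    qed
    then show ?thesis by blast
  qed
  then obtain r where r: "strict_mono r" "AE x in M. Cauchy (\<lambda>i. s (r i) x)"
    using cauchy_L1_AE_cauchy_subseq[of M s] int by blast
  define v where "v x = lim (\<lambda>i. s (r i) x)" for x
  have meas [measurable]: "s n \<in> borel_measurable M" for n using s by (rule square_integrable_measurable)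
  have v_meas [measurable]: "v \<in> borel_measurable M" unfolding v_def by measurable
  have lim: "AE x in M. (\<lambda>i. s (r i) x) \<longlonglongrightarrow> v x"
    using r(2) by eventually_elim (simp add: v_def Cauchy_convergent_iff convergent_LIMSEQ_iff)
  have fatou: "integrable M (\<lambda>x. (s n x - v x)\<^sup>2) \<and> sq_norm M (\<lambda>x. s n x - v x) \<le> e"
    if e: "\<And>j. j \<ge> n \<Longrightarrow> sq_norm M (\<lambda>x. s n x - s j x) \<le> e" for n e
  proof -
    have "0 \<le> e" using e[of n] order_trans[OF sq_norm_nonneg] by blast
    have "(\<integral>\<^sup>+x. ennreal ((s n x - v x)\<^sup>2) \<partial>M) \<le> (\<integral>\<^sup>+x. liminf (\<lambda>i. ennreal ((s n x - s (r i) x)\<^sup>2)) \<partial>M)"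
    proof (rule nn_integral_mono_AE)
      show "AE x in M. ennreal ((s n x - v x)\<^sup>2) \<le> liminf (\<lambda>i. ennreal ((s n x - s (r i) x)\<^sup>2))"
        using lim
      proof eventually_elim
        case (elim x)
        then have "(\<lambda>i. ennreal ((s n x - s (r i) x)\<^sup>2)) \<longlonglongrightarrow> ennreal ((s n x - v x)\<^sup>2)"
          by (intro tendsto_intros)
        from lim_imp_Liminf[OF _ this] show ?case by simp
      qed
    qed
    also have "\<dots> \<le> liminf (\<lambda>i. \<integral>\<^sup>+x. ennreal ((s n x - s (r i) x)\<^sup>2) \<partial>M)"
      by (rule nn_integral_liminf) measurable
    also have "\<dots> \<le> ennreal e"
    proof (rule Liminf_le)
      show "\<forall>\<^sub>F i in sequentially. (\<integral>\<^sup>+x. ennreal ((s n x - s (r i) x)\<^sup>2) \<partial>M) \<le> ennreal e"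
        using eventually_ge_at_top[of n]
      proof eventually_elim
        case (elim i)
        then have "n \<le> r i" using seq_suble[OF r(1), of i] by linarith
        then show ?case
          using e[of "r i"] square_integrable_sq[OF square_integrable_diff[OF s[of n] s[of "r i"]]]
          by (subst nn_integral_eq_integral) (auto simp: sq_norm_def ennreal_leI)
      qed
    qed simp
    finally have le: "(\<integral>\<^sup>+x. ennreal ((s n x - v x)\<^sup>2) \<partial>M) \<le> ennreal e" .
    then have int: "integrable M (\<lambda>x. (s n x - v x)\<^sup>2)"
      by (intro integrableI_bounded) (auto simp: le_less_trans)
    with le \<open>0 \<le> e\<close> show ?thesis
      by (simp add: nn_integral_eq_integral sq_norm_def)
  qed
  have close: "\<exists>N. \<forall>n\<ge>N. integrable M (\<lambda>x. (s n x - v x)\<^sup>2) \<and> sq_norm M (\<lambda>x. s n x - v x) < e" if "e > 0" for e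
  proof -
    obtain N where N: "\<And>i j. i \<ge> N \<Longrightarrow> j \<ge> N \<Longrightarrow> sq_norm M (\<lambda>x. s i x - s j x) < e / 2"
      using C[of "e / 2"] \<open>e > 0\<close> by auto
    have "integrable M (\<lambda>x. (s n x - v x)\<^sup>2) \<and> sq_norm M (\<lambda>x. s n x - v x) < e" if "n \<ge> N" for n
      using fatou[of n "e / 2"] N[of n] that \<open>e > 0\<close> by (force simp: less_imp_le)
    then show ?thesis by blast
  qed
  obtain N where "integrable M (\<lambda>x. (s N x - v x)\<^sup>2)" using close[of 1] by auto
  then have "square_integrable M (\<lambda>x. s N x - v x)" by (simp add: square_integrable_def)
  from square_integrable_diff[OF s[of N] this] have v: "square_integrable M v" by simp
  have "tendsto_L2 M s v"
    unfolding tendsto_L2_def LIMSEQ_iff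
    using close by (simp add: abs_of_nonneg[OF sq_norm_nonneg]) meson
  with v show ?thesis by blast
qed

section \<open>Weak gradients are unique\<close>

lemma Ck_bounded_linear:
  assumes "bounded_linear g" shows "Ck k g"
proof (cases k)
  case 0
  then show ?thesis using assms by (simp add: linear_continuous_on)
next
  case (Suc m)
  have "partial_deriv i g = (\<lambda>x. g (axis i 1))" for i
    using bounded_linear_imp_has_derivative[OF assms] by (intro ext partial_deriv_eq)
  then show ?thesis
    unfolding Suc using bounded_linear_imp_differentiable[OF assms] by (simp add: Ck_const)
qed

text \<open>Polynomials serve as smooth approximations of continuous functions.\<close>

lemma Ck_real_polynomial_function:
  "real_polynomial_function p \<Longrightarrow> Ck k p"
  by (induction p rule: real_polynomial_function.induct)
     (auto intro: Ck_bounded_linear Ck_const Ck_add Ck_mult)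

text \<open>
  Since \<open>flat_exp 1 (n t)\<close> tends to \<open>1\<close> for \<open>t > 0\<close>, these smooth functions increase to the indicator
  of the open box as \<open>n\<close> grows.
\<close>

definition box_bump :: "real^'n::finite \<Rightarrow> real^'n \<Rightarrow> nat \<Rightarrow> real^'n \<Rightarrow> real" where
  "box_bump a b n x =
     (\<Prod>i\<in>UNIV. flat_exp 1 (real (Suc n) * (x $ i - a $ i)) * flat_exp 1 (real (Suc n) * (b $ i - x $ i)))"

lemma flat_exp_1: "flat_exp 1 t = (if t \<le> 0 then 0 else exp (- 1 / t))"
  by (simp add: flat_exp_def)

lemma flat_exp_1_bounds: "0 \<le> flat_exp 1 t" "flat_exp 1 t \<le> 1"
  by (auto simp: flat_exp_1)

lemma flat_exp_1_scaled_limit: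
  "(\<lambda>n. flat_exp 1 (real (Suc n) * t)) \<longlonglongrightarrow> (if t > 0 then 1 else 0)"
proof (cases "t > 0")
  case True
  have "(\<lambda>n. exp (- (1 / t) * inverse (real (Suc n)))) \<longlonglongrightarrow> exp (- (1 / t) * 0)"
    by (intro tendsto_intros LIMSEQ_inverse_real_of_nat)
  moreover have "flat_exp 1 (real (Suc n) * t) = exp (- (1 / t) * inverse (real (Suc n)))" for n
  proof -
    have "real (Suc n) * t > 0" using True by simp
    then show ?thesis by (simp add: flat_exp_1 field_simps del: of_nat_Suc)
  qed
  ultimately show ?thesis using True by simp
next
  case False
  then have "flat_exp 1 (real (Suc n) * t) = 0" for n
    by (simp add: flat_exp_1 mult_nonneg_nonpos)
  then show ?thesis using False by simp
qed

lemma box_bump_limit: "(\<lambda>n. box_bump a b n x) \<longlonglongrightarrow> indicator (box a b) x"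
proof -
  have "(\<lambda>n. box_bump a b n x) \<longlonglongrightarrow>
      (\<Prod>i\<in>UNIV. (if x $ i - a $ i > 0 then 1 else 0) * (if b $ i - x $ i > 0 then 1 else 0))"
    unfolding box_bump_def by (intro tendsto_intros flat_exp_1_scaled_limit)
  also have "(\<Prod>i\<in>UNIV. (if x $ i - a $ i > 0 then 1 else 0) * (if b $ i - x $ i > 0 then 1 else 0))
      = (indicator (box a b) x :: real)"
  proof (cases "x \<in> box a b")
    case True
    then show ?thesis by (simp add: mem_box_cart)
  next
    case False
    then obtain i where "\<not> (a $ i < x $ i \<and> x $ i < b $ i)" by (auto simp: mem_box_cart)
    then have "(\<Prod>i\<in>UNIV. (if x $ i - a $ i > 0 then 1 else 0) * (if b $ i - x $ i > 0 then 1 else (0::real))) = 0"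
      by (intro prod_zero) (auto intro!: bexI[of _ i])
    with False show ?thesis by simp
  qed
  finally show ?thesis .
qed

lemma box_bump_bounds: "0 \<le> box_bump a b n x" "box_bump a b n x \<le> 1"
  unfolding box_bump_def using flat_exp_1_bounds
  by (auto intro!: prod_nonneg prod_le_1 mult_le_one)

lemma box_bump_outside:
  assumes "x \<notin> box a b" shows "box_bump a b n x = 0"
proof -
  obtain i where i: "x $ i \<le> a $ i \<or> b $ i \<le> x $ i" using assms by (auto simp: mem_box_cart not_less)
  then have "real (Suc n) * (x $ i - a $ i) \<le> 0 \<or> real (Suc n) * (b $ i - x $ i) \<le> 0"
    by (auto intro: mult_nonneg_nonpos)
  then show ?thesis
    unfolding box_bump_def by (intro prod_zero) (auto intro!: bexI[of _ i] simp: flat_exp_1)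
qed

lemma Ck_box_bump: "Ck k (box_bump a b n)"
proof -
  have affine: "Ck k (\<lambda>x. real (Suc n) * (c * (x $ i) + d))" for c d i
    by (intro Ck_mult Ck_add Ck_const Ck_component)
  have "Ck k (\<lambda>x. flat_exp 1 (real (Suc n) * (x $ i - a $ i)))" for i
    using Ck_flat_exp[OF affine[of 1 i "- a $ i"]] by simp
  moreover have "Ck k (\<lambda>x. flat_exp 1 (real (Suc n) * (b $ i - x $ i)))" for i
    using Ck_flat_exp[OF affine[of "-1" i "b $ i"]] by simp
  ultimately show ?thesis
    unfolding box_bump_def[abs_def] by (intro Ck_prod Ck_mult) auto
qed

lemma box_bump_test_function:
  assumes "cbox a b \<subseteq> \<Omega>" shows "box_bump a b n \<in> test_functions \<Omega>"
  by (rule test_functionsI[of _ "cbox a b"])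
     (use assms box_subset_cbox[of a b] in \<open>auto intro!: Ck_box_bump box_bump_outside\<close>)

locale bounded_domain =
  fixes \<Omega> :: "(real^'n::finite) set"
  assumes bounded_domain: "bounded \<Omega>" and open_domain: "open \<Omega>"
begin

abbreviation M where "M \<equiv> lebesgue_on \<Omega>"
abbreviation D where "D \<equiv> weak_gradient \<Omega>"
abbreviation has_gradient where "has_gradient \<equiv> is_weak_gradient \<Omega>"
abbreviation V where "V \<equiv> H10 \<Omega>"
abbreviation test where "test \<equiv> test_functions \<Omega>"

abbreviation below :: "(real^'n \<Rightarrow> real) \<Rightarrow> (real^'n \<Rightarrow> ereal) \<Rightarrow> bool" where
  "below v \<psi> \<equiv> ae_le \<Omega> (\<lambda>x. ereal (v x)) \<psi>"

lemma domain_sets: "\<Omega> \<in> sets lebesgue"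
  using open_domain by simp

lemma finite_measure_M: "finite_measure M"
  using bounded_set_imp_lmeasurable[OF bounded_domain domain_sets] by (rule finite_measure_lebesgue_on)

lemma borel_measurable_M: "g \<in> borel_measurable borel \<Longrightarrow> g \<in> borel_measurable M"
  by (intro measurable_restrict_space1 measurable_completion) simp

lemma AE_M_iff: "(AE x in M. P x) \<longleftrightarrow> (AE x in lebesgue. x \<in> \<Omega> \<longrightarrow> P x)"
  using domain_sets by (simp add: AE_restrict_space_iff)

lemma test_function_L2:
  assumes "\<phi> \<in> test_functions UNIV" shows "square_integrable M \<phi>"
proof -
  obtain B where "B > 0" "\<And>x. \<bar>\<phi> x\<bar> \<le> B" using test_functions_bounded[OF assms] by blast
  then show ?thesis
    using borel_measurable_M[OF test_functions_borel[OF assms]] finite_measure_M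
    by (intro square_integrable_bounded)
qed

lemma test_function_L2': "\<phi> \<in> test \<Longrightarrow> square_integrable M \<phi>"
  using test_function_L2 test_functions_mono by blast

lemma test_function_partial_deriv_L2: "\<phi> \<in> test \<Longrightarrow> square_integrable M (partial_deriv i \<phi>)"
  by (intro test_function_L2' test_functions_partial_deriv)

text \<open>Cutting off a smooth function with bumps gives admissible test functions; pass to the limit.\<close>

lemma integral_smooth_box_eq_0:
  assumes g: "square_integrable M g" and *: "\<forall>\<phi>\<in>test. (\<integral>x. g x * \<phi> x \<partial>M) = 0"
    and ab: "cbox a b \<subseteq> \<Omega>" and p: "\<And>k. Ck k p"
  shows "(\<integral>x. g x * (p x * indicator (box a b) x) \<partial>M) = 0"
proof -
  have "continuous_on UNIV p" using p[of 0] by simp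
  then have pm: "p \<in> borel_measurable M"
    by (intro borel_measurable_M borel_measurable_continuous_onI)
  have "bounded (p ` cbox a b)"
    using \<open>continuous_on UNIV p\<close>
    by (intro compact_imp_bounded compact_continuous_image) (auto intro: continuous_on_subset)
  then obtain C where C: "C > 0" "\<And>x. x \<in> cbox a b \<Longrightarrow> \<bar>p x\<bar> \<le> C"
    unfolding bounded_pos by auto
  have bump: "box_bump a b n \<in> borel_measurable M" for n
    by (rule borel_measurable_M[OF test_functions_borel[OF box_bump_test_function[OF ab]]])
  have ind: "(indicator (box a b) :: _ \<Rightarrow> real) \<in> borel_measurable M"
    by (intro borel_measurable_M borel_measurable_indicator) simp
  have "(\<lambda>n. \<integral>x. g x * (p x * box_bump a b n x) \<partial>M) \<longlonglongrightarrow> (\<integral>x. g x * (p x * indicator (box a b) x) \<partial>M)"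
  proof (rule integral_dominated_convergence[where w = "\<lambda>x. C * \<bar>g x\<bar>"])
    show "AE x in M. (\<lambda>n. g x * (p x * box_bump a b n x)) \<longlonglongrightarrow> g x * (p x * indicator (box a b) x)"
      by (intro always_eventually allI tendsto_intros box_bump_limit)
    show "AE x in M. norm (g x * (p x * box_bump a b n x)) \<le> C * \<bar>g x\<bar>" for n
    proof (intro always_eventually allI)
      fix x
      show "norm (g x * (p x * box_bump a b n x)) \<le> C * \<bar>g x\<bar>"
      proof (cases "x \<in> box a b")
        case True
        then have "\<bar>p x\<bar> * box_bump a b n x \<le> C * 1"
          using C(2)[of x] C(1) box_subset_cbox[of a b] box_bump_bounds[of a b n x]
          by (intro mult_mono) auto
        then have "\<bar>g x\<bar> * (\<bar>p x\<bar> * box_bump a b n x) \<le> \<bar>g x\<bar> * C"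
          by (intro mult_left_mono) auto
        then show ?thesis
          using box_bump_bounds(1)[of a b n x] by (simp add: abs_mult mult.commute)
      qed (use C(1) in \<open>simp add: box_bump_outside\<close>)
    qed
    show "integrable M (\<lambda>x. C * \<bar>g x\<bar>)"
      using square_integrable_integrable[OF finite_measure_M g] by simp
  qed (use g pm bump ind in measurable)
  moreover have "(\<integral>x. g x * (p x * box_bump a b n x) \<partial>M) = 0" for n
    using bspec[OF * test_functions_mult[OF box_bump_test_function[OF ab] p]] .
  ultimately show ?thesis by (simp add: LIMSEQ_const_iff)
qed

text \<open>
  Ideally one would test with \<open>sgn g\<close>, which produces the integral of \<open>\<bar>g\<bar>\<close>. This function is an almost
  everywhere limit of continuous functions, and these are uniformly close to polynomials on the box.
\<close>

lemma AE_box_eq_0: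
  assumes g: "square_integrable M g" and *: "\<forall>\<phi>\<in>test. (\<integral>x. g x * \<phi> x \<partial>M) = 0"
    and ab: "cbox a b \<subseteq> \<Omega>"
  shows "AE x in M. x \<in> box a b \<longrightarrow> g x = 0"
proof -
  have gm [measurable]: "g \<in> borel_measurable M" using g by (rule square_integrable_measurable)
  have gi: "integrable M g" using square_integrable_integrable[OF finite_measure_M g] .
  have ind [measurable]: "(indicator (box a b) :: _ \<Rightarrow> real) \<in> borel_measurable M"
    by (intro borel_measurable_M borel_measurable_indicator) simp
  have "(\<lambda>x. if x \<in> \<Omega> then sgn (g x) else 0) \<in> borel_measurable lebesgue"
    using domain_sets gm by (intro borel_measurable_if_I) auto
  then obtain N q where N: "negligible N" and q: "\<And>n. continuous_on UNIV (q n)"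
    and lim: "\<And>x. x \<notin> N \<Longrightarrow> (\<lambda>n. q n x) \<longlonglongrightarrow> (if x \<in> \<Omega> then sgn (g x) else (0::real))"
    using lebesgue_measurable_imp_measurable_on_real[of "\<lambda>x. if x \<in> \<Omega> then sgn (g x) else 0" UNIV]
    unfolding measurable_on_def by simp metis
  \<comment> \<open>Clipping keeps the limit, which has values in \<open>[-1, 1]\<close>, and provides a common bound.\<close>
  define c where "c n x = max (-1) (min 1 (q n x))" for n x
  have c: "continuous_on UNIV (c n)" for n unfolding c_def by (intro continuous_intros q)
  have "\<exists>p. real_polynomial_function p \<and> (\<forall>x\<in>cbox a b. \<bar>c n x - p x\<bar> < 1 / real (Suc n))" for n
  proof -
    have "continuous_on (cbox a b) (c n)" using c continuous_on_subset by blast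
    then obtain p where "real_polynomial_function p" "\<And>x. x \<in> cbox a b \<Longrightarrow> \<bar>c n x - p x\<bar> < 1 / real (Suc n)"
      by (rule Stone_Weierstrass_real_polynomial_function[OF compact_cbox, of _ _ _ "1 / real (Suc n)"]) auto
    then show ?thesis by blast
  qed
  then obtain p where p: "\<And>n. real_polynomial_function (p n)"
    and pc: "\<And>n x. x \<in> cbox a b \<Longrightarrow> \<bar>c n x - p n x\<bar> < 1 / real (Suc n)" by metis
  have pm [measurable]: "p n \<in> borel_measurable M" for n
    using Ck_real_polynomial_function[OF p, of 0]
    by (intro borel_measurable_M borel_measurable_continuous_onI) auto
  have p_lim: "AE x in M. (\<lambda>n. g x * (p n x * indicator (box a b) x)) \<longlonglongrightarrow> g x * (sgn (g x) * indicator (box a b) x)"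
  proof -
    have "AE x in lebesgue. x \<notin> N" using N by (simp add: negligible_iff_null_sets AE_not_in)
    then have "AE x in M. x \<notin> N" unfolding AE_M_iff by eventually_elim simp
    moreover have "AE x in M. x \<in> \<Omega>" using AE_space[of M] by simp
    ultimately show ?thesis
    proof eventually_elim
      case (elim x)
      show ?case
      proof (cases "x \<in> box a b")
        case True
        have "(\<lambda>n. c n x) \<longlonglongrightarrow> max (-1) (min 1 (sgn (g x)))"
          unfolding c_def using lim[OF elim(1)] elim(2) by (intro tendsto_intros) simp
        moreover have "max (-1) (min 1 (sgn (g x))) = sgn (g x)" by (simp add: sgn_if)
        moreover have "(\<lambda>n. p n x - c n x) \<longlonglongrightarrow> 0"
        proof (rule Lim_null_comparison)
          show "\<forall>\<^sub>F n in sequentially. norm (p n x - c n x) \<le> inverse (real (Suc n))"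
            using pc[of x] True box_subset_cbox[of a b]
            by (intro always_eventually allI) (auto simp: abs_minus_commute less_imp_le inverse_eq_divide)
        qed (rule LIMSEQ_inverse_real_of_nat)
        ultimately have "(\<lambda>n. (p n x - c n x) + c n x) \<longlonglongrightarrow> 0 + sgn (g x)"
          by (intro tendsto_add) auto
        then show ?thesis by (intro tendsto_intros) simp
      qed simp
    qed
  qed
  have p_bd: "AE x in M. norm (g x * (p n x * indicator (box a b) x)) \<le> 2 * \<bar>g x\<bar>" for n
  proof (intro always_eventually allI)
    fix x
    have "\<bar>p n x\<bar> \<le> 2" if "x \<in> box a b"
    proof -
      have "\<bar>c n x - p n x\<bar> < 1 / real (Suc n)" using pc that box_subset_cbox[of a b] by blast
      also have "\<dots> \<le> 1" by simp
      finally have "\<bar>c n x - p n x\<bar> < 1" .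
      moreover have "\<bar>c n x\<bar> \<le> 1" by (simp add: c_def)
      ultimately show ?thesis by linarith
    qed
    then show "norm (g x * (p n x * indicator (box a b) x)) \<le> 2 * \<bar>g x\<bar>"
      by (auto simp: indicator_def abs_mult mult.commute intro: mult_left_mono)
  qed
  have "(\<lambda>n. \<integral>x. g x * (p n x * indicator (box a b) x) \<partial>M) \<longlonglongrightarrow> (\<integral>x. g x * (sgn (g x) * indicator (box a b) x) \<partial>M)"
    by (rule integral_dominated_convergence[where w = "\<lambda>x. 2 * \<bar>g x\<bar>"]) (use p_lim p_bd gi in auto)
  moreover have "(\<integral>x. g x * (p n x * indicator (box a b) x) \<partial>M) = 0" for n
    by (rule integral_smooth_box_eq_0[OF g * ab Ck_real_polynomial_function[OF p]])
  ultimately have "(\<integral>x. g x * (sgn (g x) * indicator (box a b) x) \<partial>M) = 0"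
    by (simp add: LIMSEQ_const_iff)
  moreover have "g x * (sgn (g x) * indicator (box a b) x) = \<bar>g x\<bar> * indicator (box a b) x" for x
    by (simp add: sgn_if indicator_def)
  ultimately have "(\<integral>x. \<bar>g x\<bar> * indicator (box a b) x \<partial>M) = 0" by simp
  moreover have "integrable M (\<lambda>x. \<bar>g x\<bar> * indicator (box a b) x)"
    by (rule Bochner_Integration.integrable_bound[OF gi])
       (measurable, auto simp: indicator_def intro!: always_eventually)
  ultimately have "AE x in M. \<bar>g x\<bar> * indicator (box a b) x = 0"
    using integral_nonneg_eq_0_iff_AE[of M "\<lambda>x. \<bar>g x\<bar> * indicator (box a b) x"] by simp
  then show ?thesis by eventually_elim (auto simp: indicator_def)
qed

lemma fundamental_lemma_calculus_of_variations:
  assumes g: "square_integrable M g" and *: "\<forall>\<phi>\<in>test. (\<integral>x. g x * \<phi> x \<partial>M) = 0"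
  shows "AE x in M. g x = 0"
proof -
  obtain \<D> where \<D>: "countable \<D>" "\<D> \<subseteq> Pow \<Omega>" "\<And>X. X \<in> \<D> \<Longrightarrow> \<exists>a b. X = cbox a b" "\<Union>\<D> = \<Omega>"
    using open_countable_Union_open_cbox[OF open_domain] by metis
  have "AE x in M. x \<in> X \<longrightarrow> g x = 0" if "X \<in> \<D>" for X
  proof -
    obtain a b where X: "X = cbox a b" using \<D>(3) \<open>X \<in> \<D>\<close> by meson
    have "cbox a b \<subseteq> \<Omega>" using that X \<D>(2) by blast
    have "AE x in lebesgue. x \<notin> cbox a b - box a b"
      using null_sets_cbox_Diff_box[of a b] by (intro AE_not_in) (simp add: null_sets_completionI)
    then have "AE x in M. x \<notin> cbox a b - box a b" unfolding AE_M_iff by eventually_elim simp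
    with AE_box_eq_0[OF g * \<open>cbox a b \<subseteq> \<Omega>\<close>] show ?thesis
      unfolding X by eventually_elim auto
  qed
  then have "\<forall>X\<in>\<D>. AE x in M. x \<in> X \<longrightarrow> g x = 0" by (rule ballI)
  then have "AE x in M. \<forall>X\<in>\<D>. x \<in> X \<longrightarrow> g x = 0"
    by (simp only: AE_ball_countable[OF \<D>(1)])
  moreover have "AE x in M. x \<in> \<Omega>" using AE_space[of M] by simp
  ultimately show ?thesis
  proof eventually_elim
    case (elim x)
    then obtain X where "X \<in> \<D>" "x \<in> X" using \<D>(4) by blast
    with elim(1) show ?case by blast
  qed
qed

section \<open>The spaces of weakly differentiable functions\<close>

lemma is_weak_gradientD:
  assumes "has_gradient v G"
  shows "square_integrable M (\<lambda>x. G x $ i)"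
    and "\<phi> \<in> test \<Longrightarrow> (\<integral>x. v x * partial_deriv i \<phi> x \<partial>M) = - (\<integral>x. G x $ i * \<phi> x \<partial>M)"
  using assms unfolding is_weak_gradient_def L2_iff by simp_all

lemma is_weak_gradientI:
  assumes "\<And>i. square_integrable M (\<lambda>x. G x $ i)"
    and "\<And>i \<phi>. \<phi> \<in> test \<Longrightarrow> (\<integral>x. v x * partial_deriv i \<phi> x \<partial>M) = - (\<integral>x. G x $ i * \<phi> x \<partial>M)"
  shows "has_gradient v G"
  using assms unfolding is_weak_gradient_def L2_iff by blast

lemma weak_gradient_unique:
  assumes "has_gradient v G" "has_gradient v H"
  shows "AE x in M. G x = H x"
proof -
  have "AE x in M. G x $ i - H x $ i = 0" for i
  proof (rule fundamental_lemma_calculus_of_variations)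
    note G = is_weak_gradientD[OF assms(1), where i = i] and H = is_weak_gradientD[OF assms(2), where i = i]
    show "square_integrable M (\<lambda>x. G x $ i - H x $ i)"
      using G(1) H(1) by (rule square_integrable_diff)
    show "\<forall>\<phi>\<in>test. (\<integral>x. (G x $ i - H x $ i) * \<phi> x \<partial>M) = 0"
    proof
      fix \<phi> assume \<phi>: "\<phi> \<in> test"
      have "(\<integral>x. (G x $ i - H x $ i) * \<phi> x \<partial>M) = (\<integral>x. G x $ i * \<phi> x \<partial>M) - (\<integral>x. H x $ i * \<phi> x \<partial>M)"
        unfolding left_diff_distrib using G(1) H(1) test_function_L2'[OF \<phi>]
        by (intro Bochner_Integration.integral_diff square_integrable_mult)
      then show "(\<integral>x. (G x $ i - H x $ i) * \<phi> x \<partial>M) = 0"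
        using G(2)[OF \<phi>] H(2)[OF \<phi>] by simp
    qed
  qed
  then have "AE x in M. \<forall>i\<in>UNIV. G x $ i - H x $ i = 0" by (intro AE_finite_allI) auto
  then show ?thesis by eventually_elim (simp add: vec_eq_iff)
qed

lemma H1_L2: "v \<in> H1 \<Omega> \<Longrightarrow> square_integrable M v"
  by (simp add: H1_def L2_iff)

lemma H1_weak_gradient: "v \<in> H1 \<Omega> \<Longrightarrow> has_gradient v (D v)"
  unfolding H1_def weak_gradient_def
  using someI_ex[of "has_gradient v"] by blast

lemma H1I: "square_integrable M v \<Longrightarrow> has_gradient v G \<Longrightarrow> v \<in> H1 \<Omega>"
  by (auto simp: H1_def L2_iff)

lemma D_L2: "v \<in> H1 \<Omega> \<Longrightarrow> square_integrable M (\<lambda>x. D v x $ i)"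
  using H1_weak_gradient is_weak_gradientD by blast

lemma is_weak_gradient_add:
  assumes v: "square_integrable M v" "has_gradient v G"
    and w: "square_integrable M w" "has_gradient w H"
  shows "has_gradient (\<lambda>x. v x + w x) (\<lambda>x. G x + H x)"
proof (rule is_weak_gradientI)
  fix i
  note G = is_weak_gradientD[OF v(2), where i = i] and H = is_weak_gradientD[OF w(2), where i = i]
  show "square_integrable M (\<lambda>x. (G x + H x) $ i)"
    using G(1) H(1) square_integrable_add by simp
  fix \<phi> assume \<phi>: "\<phi> \<in> test"
  note \<phi>L = test_function_L2'[OF \<phi>] test_function_partial_deriv_L2[OF \<phi>, of i]
  have "(\<integral>x. (v x + w x) * partial_deriv i \<phi> x \<partial>M) =
      (\<integral>x. v x * partial_deriv i \<phi> x \<partial>M) + (\<integral>x. w x * partial_deriv i \<phi> x \<partial>M)"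
    unfolding distrib_right using v(1) w(1) \<phi>L
    by (intro Bochner_Integration.integral_add square_integrable_mult)
  moreover have "(\<integral>x. (G x + H x) $ i * \<phi> x \<partial>M) = (\<integral>x. G x $ i * \<phi> x \<partial>M) + (\<integral>x. H x $ i * \<phi> x \<partial>M)"
    unfolding vector_add_component distrib_right using G(1) H(1) \<phi>L
    by (intro Bochner_Integration.integral_add square_integrable_mult)
  ultimately show "(\<integral>x. (v x + w x) * partial_deriv i \<phi> x \<partial>M) = - (\<integral>x. (G x + H x) $ i * \<phi> x \<partial>M)"
    using G(2)[OF \<phi>] H(2)[OF \<phi>] by simp
qed

lemma is_weak_gradient_cmult:
  assumes "has_gradient v G"
  shows "has_gradient (\<lambda>x. c * v x) (\<lambda>x. c *\<^sub>R G x)"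
  using is_weak_gradientD[OF assms]
  by (intro is_weak_gradientI) (auto simp: mult.assoc square_integrable_cmult)

lemma H1_add: "v \<in> H1 \<Omega> \<Longrightarrow> w \<in> H1 \<Omega> \<Longrightarrow> (\<lambda>x. v x + w x) \<in> H1 \<Omega>"
  by (rule H1I[OF square_integrable_add is_weak_gradient_add]) (auto intro: H1_L2 H1_weak_gradient)

lemma H1_cmult: "v \<in> H1 \<Omega> \<Longrightarrow> (\<lambda>x. c * v x) \<in> H1 \<Omega>"
  by (rule H1I[OF square_integrable_cmult is_weak_gradient_cmult]) (auto intro: H1_L2 H1_weak_gradient)

lemma H1_diff: "v \<in> H1 \<Omega> \<Longrightarrow> w \<in> H1 \<Omega> \<Longrightarrow> (\<lambda>x. v x - w x) \<in> H1 \<Omega>"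
  using H1_add[of v "\<lambda>x. -1 * w x"] H1_cmult[of w "-1"] by simp

lemma D_eq_AE:
  assumes "v \<in> H1 \<Omega>" "has_gradient v G" shows "AE x in M. D v x = G x"
  using weak_gradient_unique[OF H1_weak_gradient[OF assms(1)] assms(2)] .

text \<open>The Dirichlet form.\<close>

definition E :: "(real^'n \<Rightarrow> real) \<Rightarrow> (real^'n \<Rightarrow> real) \<Rightarrow> real" where
  "E v w = (\<integral>x. D v x \<bullet> D w x \<partial>M)"

abbreviation grad_dist :: "(real^'n \<Rightarrow> real) \<Rightarrow> (real^'n \<Rightarrow> real) \<Rightarrow> real" where
  "grad_dist v w \<equiv> E (\<lambda>x. v x - w x) (\<lambda>x. v x - w x)"

lemma Laplacian_eq: "- Laplacian \<Omega> v w = E v w"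
  by (simp add: Laplacian_def E_def)

lemma integrable_inner_L2:
  assumes "\<And>i. square_integrable M (\<lambda>x. G x $ i)" "\<And>i. square_integrable M (\<lambda>x. H x $ i)"
  shows "integrable M (\<lambda>x. G x \<bullet> (H x :: real^'n))"
  unfolding inner_vec_def using assms by (auto intro!: Bochner_Integration.integrable_sum square_integrable_mult)

lemma E_commute: "E v w = E w v"
  by (simp add: E_def inner_commute)

lemma inner_measurable:
  assumes "\<And>i. square_integrable M (\<lambda>x. G x $ i)" "\<And>i. square_integrable M (\<lambda>x. H x $ i)"
  shows "(\<lambda>x. G x \<bullet> (H x :: real^'n)) \<in> borel_measurable M"
  using integrable_inner_L2[OF assms] by simp

lemma E_eq:
  assumes "v \<in> H1 \<Omega>" "w \<in> H1 \<Omega>" "has_gradient v G" "has_gradient w H"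
  shows "E v w = (\<integral>x. G x \<bullet> H x \<partial>M)"
  unfolding E_def
proof (rule integral_cong_AE)
  show "AE x in M. D v x \<bullet> D w x = G x \<bullet> H x"
    using D_eq_AE[OF assms(1,3)] D_eq_AE[OF assms(2,4)] by eventually_elim simp
qed (intro inner_measurable D_L2 assms is_weak_gradientD(1)[OF assms(3)] is_weak_gradientD(1)[OF assms(4)])+

lemma E_add_left:
  assumes "v1 \<in> H1 \<Omega>" "v2 \<in> H1 \<Omega>" "w \<in> H1 \<Omega>"
  shows "E (\<lambda>x. v1 x + v2 x) w = E v1 w + E v2 w"
proof -
  have "E (\<lambda>x. v1 x + v2 x) w = (\<integral>x. (D v1 x + D v2 x) \<bullet> D w x \<partial>M)"
    using assms by (intro E_eq H1_add is_weak_gradient_add H1_L2 H1_weak_gradient)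
  also have "\<dots> = E v1 w + E v2 w"
    unfolding E_def inner_add_left using assms
    by (intro Bochner_Integration.integral_add integrable_inner_L2 D_L2)
  finally show ?thesis .
qed

lemma E_cmult_left:
  assumes "v \<in> H1 \<Omega>" "w \<in> H1 \<Omega>"
  shows "E (\<lambda>x. c * v x) w = c * E v w"
proof -
  have "E (\<lambda>x. c * v x) w = (\<integral>x. (c *\<^sub>R D v x) \<bullet> D w x \<partial>M)"
    using assms by (intro E_eq H1_cmult is_weak_gradient_cmult H1_weak_gradient)
  then show ?thesis by (simp add: E_def)
qed

lemma E_diff_left:
  assumes "v1 \<in> H1 \<Omega>" "v2 \<in> H1 \<Omega>" "w \<in> H1 \<Omega>"
  shows "E (\<lambda>x. v1 x - v2 x) w = E v1 w - E v2 w"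
  using E_add_left[OF assms(1) H1_cmult[OF assms(2), of "-1"] assms(3)] E_cmult_left[OF assms(2,3), of "-1"]
  by simp

lemma E_add_right: "v \<in> H1 \<Omega> \<Longrightarrow> w1 \<in> H1 \<Omega> \<Longrightarrow> w2 \<in> H1 \<Omega> \<Longrightarrow> E v (\<lambda>x. w1 x + w2 x) = E v w1 + E v w2"
  by (simp add: E_add_left E_commute[of v])

lemma E_cmult_right: "v \<in> H1 \<Omega> \<Longrightarrow> w \<in> H1 \<Omega> \<Longrightarrow> E v (\<lambda>x. c * w x) = c * E v w"
  by (simp add: E_cmult_left E_commute[of v])

lemma E_diff_right: "v \<in> H1 \<Omega> \<Longrightarrow> w1 \<in> H1 \<Omega> \<Longrightarrow> w2 \<in> H1 \<Omega> \<Longrightarrow> E v (\<lambda>x. w1 x - w2 x) = E v w1 - E v w2"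
  by (simp add: E_diff_left E_commute[of v])

lemma E_nonneg: "0 \<le> E v v"
  by (simp add: E_def)

lemma E_self_eq:
  assumes "v \<in> H1 \<Omega>" "has_gradient v G"
  shows "E v v = (\<Sum>i\<in>UNIV. sq_norm M (\<lambda>x. G x $ i))"
  unfolding E_eq[OF assms(1,1,2,2)] inner_vec_def sq_norm_def inner_real_def power2_eq_square
  by (intro Bochner_Integration.integral_sum square_integrable_mult is_weak_gradientD(1)[OF assms(2)])

lemma E_diff_self:
  assumes "v \<in> H1 \<Omega>" "w \<in> H1 \<Omega>"
  shows "grad_dist v w = E v v - 2 * E v w + E w w"
  using assms by (simp add: E_diff_left E_diff_right H1_diff E_commute[of w v])

lemma E_add_self:
  assumes "v \<in> H1 \<Omega>" "w \<in> H1 \<Omega>"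
  shows "E (\<lambda>x. v x + w x) (\<lambda>x. v x + w x) = E v v + 2 * E v w + E w w"
  using assms by (simp add: E_add_left E_add_right H1_add E_commute[of w v])

lemma E_add_le:
  assumes "v \<in> H1 \<Omega>" "w \<in> H1 \<Omega>"
  shows "E (\<lambda>x. v x + w x) (\<lambda>x. v x + w x) \<le> 2 * E v v + 2 * E w w"
  using E_nonneg[of "\<lambda>x. v x - w x"] unfolding E_add_self[OF assms] E_diff_self[OF assms] by simp

lemma E_minus_commute:
  assumes "v \<in> H1 \<Omega>" "w \<in> H1 \<Omega>"
  shows "grad_dist v w = grad_dist w v"
  using assms by (simp add: E_diff_self E_commute[of w v])

lemma E_Cauchy_Schwarz:
  assumes H1: "y \<in> H1 \<Omega>" "v \<in> H1 \<Omega>"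
  shows "(E y v)\<^sup>2 \<le> E y y * E v v"
proof (cases "E v v = 0")
  case True
  have "integrable M (\<lambda>x. D v x \<bullet> D v x)" by (intro integrable_inner_L2 D_L2 H1)
  then have "AE x in M. D v x = 0"
    using True integral_nonneg_eq_0_iff_AE[of M "\<lambda>x. D v x \<bullet> D v x"] by (simp add: E_def)
  then have "AE x in M. D y x \<bullet> D v x = 0" by eventually_elim simp
  then have "E y v = 0" unfolding E_def by (rule integral_eq_zero_AE)
  then show ?thesis using True by simp
next
  case False
  then have pos: "E v v > 0" using E_nonneg[of v] by simp
  \<comment> \<open>This \<open>t\<close> minimises the form on the line \<open>y - t v\<close>.\<close>
  define t where "t = E y v / E v v"
  have "0 \<le> E (\<lambda>x. y x - t * v x) (\<lambda>x. y x - t * v x)" by (rule E_nonneg)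
  also have "\<dots> = E y y - 2 * (t * E y v) + t * (t * E v v)"
    using H1 H1_cmult[OF H1(2), of t] by (simp add: E_diff_self E_cmult_left E_cmult_right)
  also have "\<dots> = E y y - (E y v)\<^sup>2 / E v v"
    using pos by (simp add: t_def power2_eq_square field_simps)
  finally show ?thesis using pos by (simp add: field_simps)
qed

text \<open>The square of \<open>H1_norm\<close>, for which the triangle inequality with a factor is elementary.\<close>

definition H1_sq :: "(real^'n \<Rightarrow> real) \<Rightarrow> real" where
  "H1_sq v = sq_norm M v + E v v"

abbreviation tendsto_H1 :: "(nat \<Rightarrow> real^'n \<Rightarrow> real) \<Rightarrow> (real^'n \<Rightarrow> real) \<Rightarrow> bool" where
  "tendsto_H1 s v \<equiv> (\<lambda>k. H1_sq (\<lambda>x. v x - s k x)) \<longlonglongrightarrow> 0"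

lemma H1_norm_eq: "H1_norm \<Omega> v = sqrt (H1_sq v)"
  by (simp add: H1_norm_def H1_sq_def sq_norm_def E_def power2_norm_eq_inner)

lemma H1_sq_nonneg: "0 \<le> H1_sq v"
  by (simp add: H1_sq_def sq_norm_nonneg E_nonneg)

lemma H1_sq_add_le:
  assumes "v \<in> H1 \<Omega>" "w \<in> H1 \<Omega>"
  shows "H1_sq (\<lambda>x. v x + w x) \<le> 2 * H1_sq v + 2 * H1_sq w"
  using sq_norm_add_le[of M v w] E_add_le[of v w] assms by (simp add: H1_sq_def H1_L2)

lemma H1_sq_diff_triangle:
  assumes "u \<in> H1 \<Omega>" "v \<in> H1 \<Omega>" "w \<in> H1 \<Omega>"
  shows "H1_sq (\<lambda>x. u x - w x) \<le> 2 * H1_sq (\<lambda>x. u x - v x) + 2 * H1_sq (\<lambda>x. v x - w x)"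
  using H1_sq_add_le[OF H1_diff[OF assms(1,2)] H1_diff[OF assms(2,3)]] by simp

lemma tendsto_H1_norm_iff:
  "(\<lambda>k. H1_norm \<Omega> (s k)) \<longlonglongrightarrow> 0 \<longleftrightarrow> (\<lambda>k. H1_sq (s k)) \<longlonglongrightarrow> 0"
proof
  assume "(\<lambda>k. H1_norm \<Omega> (s k)) \<longlonglongrightarrow> 0"
  then have "(\<lambda>k. (H1_norm \<Omega> (s k))\<^sup>2) \<longlonglongrightarrow> 0\<^sup>2" by (rule tendsto_power)
  then show "(\<lambda>k. H1_sq (s k)) \<longlonglongrightarrow> 0" by (simp add: H1_norm_eq H1_sq_nonneg)
next
  assume "(\<lambda>k. H1_sq (s k)) \<longlonglongrightarrow> 0"
  then have "(\<lambda>k. sqrt (H1_sq (s k))) \<longlonglongrightarrow> sqrt 0" by (rule tendsto_real_sqrt)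
  then show "(\<lambda>k. H1_norm \<Omega> (s k)) \<longlonglongrightarrow> 0" by (simp add: H1_norm_eq)
qed

lemma test_function_weak_gradient:
  assumes "\<phi> \<in> test"
  shows "has_gradient \<phi> (\<lambda>x. \<chi> i. partial_deriv i \<phi> x)"
proof (rule is_weak_gradientI)
  fix i
  show "square_integrable M (\<lambda>x. (\<chi> i. partial_deriv i \<phi> x) $ i)"
    using test_function_partial_deriv_L2[OF assms] by simp
  fix \<psi> assume \<psi>: "\<psi> \<in> test"
  have "0 = (\<integral>x. (\<phi> x * partial_deriv i \<psi> x + partial_deriv i \<phi> x * \<psi> x) \<partial>M)"
    using integral_by_parts_test[OF open_domain \<psi> test_functions_Ck[OF assms]] by simp
  also have "\<dots> = (\<integral>x. \<phi> x * partial_deriv i \<psi> x \<partial>M) + (\<integral>x. partial_deriv i \<phi> x * \<psi> x \<partial>M)"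
    using assms \<psi> by (intro Bochner_Integration.integral_add square_integrable_mult
        test_function_L2' test_function_partial_deriv_L2)
  finally show "(\<integral>x. \<phi> x * partial_deriv i \<psi> x \<partial>M) = - (\<integral>x. (\<chi> i. partial_deriv i \<phi> x) $ i * \<psi> x \<partial>M)"
    by simp
qed

lemma test_function_H1: "\<phi> \<in> test \<Longrightarrow> \<phi> \<in> H1 \<Omega>"
  using H1I test_function_L2' test_function_weak_gradient by blast

lemma H10_H1: "v \<in> V \<Longrightarrow> v \<in> H1 \<Omega>"
  by (simp add: H10_def)

lemma H10_L2: "v \<in> V \<Longrightarrow> square_integrable M v"
  using H1_L2 H10_H1 by blast

lemma H10I:
  assumes "v \<in> H1 \<Omega>" "\<And>k. \<phi> k \<in> test" "tendsto_H1 \<phi> v"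
  shows "v \<in> V"
  unfolding H10_def using assms tendsto_H1_norm_iff[of "\<lambda>k x. v x - \<phi> k x"] by auto

lemma H10_approx:
  assumes "v \<in> V"
  obtains \<phi> where "\<And>k. \<phi> k \<in> test" "tendsto_H1 \<phi> v"
proof -
  obtain \<phi> where "\<forall>k::nat. \<phi> k \<in> test" "(\<lambda>k. H1_norm \<Omega> (\<lambda>x. v x - \<phi> k x)) \<longlonglongrightarrow> 0"
    using assms unfolding H10_def by blast
  then show thesis using that tendsto_H1_norm_iff[of "\<lambda>k x. v x - \<phi> k x"] by blast
qed

lemma H10_approx_less:
  assumes "v \<in> V" "e > 0"
  obtains \<phi> where "\<phi> \<in> test" "H1_sq (\<lambda>x. v x - \<phi> x) < e"
proof -
  obtain \<phi> where \<phi>: "\<And>k. \<phi> k \<in> test" "tendsto_H1 \<phi> v"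
    using H10_approx[OF assms(1)] by blast
  have "\<forall>\<^sub>F k in sequentially. H1_sq (\<lambda>x. v x - \<phi> k x) < e"
    using order_tendstoD(2)[OF \<phi>(2) assms(2)] .
  then show thesis using \<phi>(1) that by (meson eventually_happens' sequentially_bot)
qed

lemma test_function_H10: "\<phi> \<in> test \<Longrightarrow> \<phi> \<in> V"
proof (rule H10I[of _ "\<lambda>k. \<phi>"])
  assume "\<phi> \<in> test"
  then have "H1_sq (\<lambda>x. \<phi> x - \<phi> x) = 0"
    using E_diff_self[of \<phi> \<phi>] test_function_H1 by (simp add: H1_sq_def sq_norm_def)
  then show "(\<lambda>k. H1_sq (\<lambda>x. \<phi> x - \<phi> x)) \<longlonglongrightarrow> 0" by simp
qed (auto intro: test_function_H1)

lemma H10_zero: "(\<lambda>x. 0) \<in> V"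
  by (intro test_function_H10 test_functions_0)

text \<open>A diagonal sequence of test functions.\<close>

lemma H10_sequentially_closed:
  assumes v: "v \<in> H1 \<Omega>" and s: "\<And>k. s k \<in> V" and lim: "tendsto_H1 s v"
  shows "v \<in> V"
proof -
  have "\<exists>\<phi>\<in>test. H1_sq (\<lambda>x. s k x - \<phi> x) < inverse (real (Suc k))" for k
    using H10_approx_less[OF s, of "inverse (real (Suc k))" k] by force
  then obtain \<phi> where \<phi>: "\<And>k. \<phi> k \<in> test"
    "\<And>k. H1_sq (\<lambda>x. s k x - \<phi> k x) < inverse (real (Suc k))" by metis
  show ?thesis
  proof (rule H10I[OF v \<phi>(1)], rule tendsto_sandwich)
    show "\<forall>\<^sub>F k in sequentially. 0 \<le> H1_sq (\<lambda>x. v x - \<phi> k x)" by (simp add: H1_sq_nonneg)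
    show "\<forall>\<^sub>F k in sequentially. H1_sq (\<lambda>x. v x - \<phi> k x) \<le>
        2 * H1_sq (\<lambda>x. v x - s k x) + 2 * inverse (real (Suc k))"
    proof (intro always_eventually allI)
      fix k
      have "H1_sq (\<lambda>x. v x - \<phi> k x) \<le> 2 * H1_sq (\<lambda>x. v x - s k x) + 2 * H1_sq (\<lambda>x. s k x - \<phi> k x)"
        using v s \<phi> by (intro H1_sq_diff_triangle) (auto intro: H10_H1 test_function_H1)
      then show "H1_sq (\<lambda>x. v x - \<phi> k x) \<le> 2 * H1_sq (\<lambda>x. v x - s k x) + 2 * inverse (real (Suc k))"
        using \<phi>(2)[of k] by linarith
    qed
    have "(\<lambda>k. 2 * H1_sq (\<lambda>x. v x - s k x) + 2 * inverse (real (Suc k))) \<longlonglongrightarrow> 2 * 0 + 2 * 0"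
      by (intro tendsto_intros lim LIMSEQ_inverse_real_of_nat)
    then show "(\<lambda>k. 2 * H1_sq (\<lambda>x. v x - s k x) + 2 * inverse (real (Suc k))) \<longlonglongrightarrow> 0" by simp
  qed simp
qed

lemma H10_add:
  assumes v: "v \<in> V" and w: "w \<in> V" shows "(\<lambda>x. v x + w x) \<in> V"
proof -
  obtain \<phi> where \<phi>: "\<And>k. \<phi> k \<in> test" "tendsto_H1 \<phi> v"
    using H10_approx[OF v] by blast
  obtain \<psi> where \<psi>: "\<And>k. \<psi> k \<in> test" "tendsto_H1 \<psi> w"
    using H10_approx[OF w] by blast
  show ?thesis
  proof (rule H10I[OF H1_add[OF H10_H1[OF v] H10_H1[OF w]] test_functions_add[OF \<phi>(1) \<psi>(1)]],
      rule tendsto_sandwich)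
    show "\<forall>\<^sub>F k in sequentially. 0 \<le> H1_sq (\<lambda>x. v x + w x - (\<phi> k x + \<psi> k x))" by (simp add: H1_sq_nonneg)
    show "\<forall>\<^sub>F k in sequentially. H1_sq (\<lambda>x. v x + w x - (\<phi> k x + \<psi> k x)) \<le>
        2 * H1_sq (\<lambda>x. v x - \<phi> k x) + 2 * H1_sq (\<lambda>x. w x - \<psi> k x)"
    proof (intro always_eventually allI)
      fix k
      have "H1_sq (\<lambda>x. (v x - \<phi> k x) + (w x - \<psi> k x)) \<le> 2 * H1_sq (\<lambda>x. v x - \<phi> k x) + 2 * H1_sq (\<lambda>x. w x - \<psi> k x)"
        using v w \<phi> \<psi> by (intro H1_sq_add_le H1_diff) (auto intro: H10_H1 test_function_H1)
      then show "H1_sq (\<lambda>x. v x + w x - (\<phi> k x + \<psi> k x)) \<le>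
        2 * H1_sq (\<lambda>x. v x - \<phi> k x) + 2 * H1_sq (\<lambda>x. w x - \<psi> k x)" by (simp add: algebra_simps)
    qed
    have "(\<lambda>k. 2 * H1_sq (\<lambda>x. v x - \<phi> k x) + 2 * H1_sq (\<lambda>x. w x - \<psi> k x)) \<longlonglongrightarrow> 2 * 0 + 2 * 0"
      by (intro tendsto_intros \<phi> \<psi>)
    then show "(\<lambda>k. 2 * H1_sq (\<lambda>x. v x - \<phi> k x) + 2 * H1_sq (\<lambda>x. w x - \<psi> k x)) \<longlonglongrightarrow> 0" by simp
  qed simp
qed

lemma H10_cmult:
  assumes v: "v \<in> V" shows "(\<lambda>x. c * v x) \<in> V"
proof -
  obtain \<phi> where \<phi>: "\<And>k. \<phi> k \<in> test" "tendsto_H1 \<phi> v"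
    using H10_approx[OF v] by blast
  have "H1_sq (\<lambda>x. c * v x - c * \<phi> k x) = c\<^sup>2 * H1_sq (\<lambda>x. v x - \<phi> k x)" for k
  proof -
    have d: "(\<lambda>x. v x - \<phi> k x) \<in> H1 \<Omega>" using v \<phi> by (intro H1_diff H10_H1 test_function_H1)
    have "H1_sq (\<lambda>x. c * (v x - \<phi> k x)) = c\<^sup>2 * H1_sq (\<lambda>x. v x - \<phi> k x)"
      using d H1_cmult[OF d, of c] 
      unfolding H1_sq_def sq_norm_cmult E_cmult_left[OF d H1_cmult[OF d]] E_cmult_right[OF d d]
      by (simp add: power2_eq_square algebra_simps)
    then show ?thesis by (simp add: algebra_simps)
  qed
  moreover have "(\<lambda>k. c\<^sup>2 * H1_sq (\<lambda>x. v x - \<phi> k x)) \<longlonglongrightarrow> 0" using \<phi>(2) by (rule tendsto_mult_right_zero)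
  ultimately show ?thesis
    by (intro H10I[OF H1_cmult[OF H10_H1[OF v]], of "\<lambda>k x. c * \<phi> k x"] test_functions_mult \<phi>(1) Ck_const) simp
qed

lemma H10_diff: "v \<in> V \<Longrightarrow> w \<in> V \<Longrightarrow> (\<lambda>x. v x - w x) \<in> V"
  using H10_add[of v "\<lambda>x. -1 * w x"] H10_cmult[of w "-1"] by simp

text \<open>
  The criterion by which limits are recognised as members of \<open>H10 \<Omega>\<close>: mean square convergence of
  the functions together with that of some choice of weak gradients.
\<close>

lemma H10_closed:
  assumes s: "\<And>k. s k \<in> V" and Gs: "\<And>k. has_gradient (s k) (G k)"
    and v: "square_integrable M v" and H: "\<And>i. square_integrable M (\<lambda>x. H x $ i)"
    and sv: "tendsto_L2 M s v" and GH: "\<And>i. tendsto_L2 M (\<lambda>k x. G k x $ i) (\<lambda>x. H x $ i)"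
  shows "has_gradient v H" "v \<in> V" "tendsto_H1 s v"
proof -
  show wg: "has_gradient v H"
  proof (rule is_weak_gradientI[OF H])
    fix i \<phi> assume \<phi>: "\<phi> \<in> test"
    have "(\<lambda>k. \<integral>x. s k x * partial_deriv i \<phi> x \<partial>M) \<longlonglongrightarrow> (\<integral>x. v x * partial_deriv i \<phi> x \<partial>M)"
      by (intro tendsto_L2_inner[OF sv] H10_L2 s v test_function_partial_deriv_L2 \<phi>)
    moreover have "(\<lambda>k. - (\<integral>x. G k x $ i * \<phi> x \<partial>M)) \<longlonglongrightarrow> - (\<integral>x. H x $ i * \<phi> x \<partial>M)"
      by (intro tendsto_minus tendsto_L2_inner[OF GH] H is_weak_gradientD(1)[OF Gs] test_function_L2' \<phi>)
    ultimately show "(\<integral>x. v x * partial_deriv i \<phi> x \<partial>M) = - (\<integral>x. H x $ i * \<phi> x \<partial>M)"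
      using LIMSEQ_unique is_weak_gradientD(2)[OF Gs \<phi>] by force
  qed
  have v1: "v \<in> H1 \<Omega>" by (rule H1I[OF v wg])
  have "H1_sq (\<lambda>x. v x - s k x) =
      sq_norm M (\<lambda>x. s k x - v x) + (\<Sum>i\<in>UNIV. sq_norm M (\<lambda>x. G k x $ i - H x $ i))" for k
  proof -
    have "has_gradient (\<lambda>x. v x + (-1) * s k x) (\<lambda>x. H x + (-1) *\<^sub>R G k x)"
      by (intro is_weak_gradient_add is_weak_gradient_cmult square_integrable_cmult v wg Gs H10_L2 s)
    then have wd: "has_gradient (\<lambda>x. v x - s k x) (\<lambda>x. H x - G k x)" by simp
    have "(\<lambda>x. v x - s k x) \<in> H1 \<Omega>" by (intro H1_diff v1 H10_H1 s)
    from E_self_eq[OF this wd] show ?thesis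
      by (simp add: H1_sq_def sq_norm_minus_commute[of M v] sq_norm_minus_commute[of M "\<lambda>x. H x $ _"])
  qed
  moreover have "(\<lambda>k. sq_norm M (\<lambda>x. s k x - v x) + (\<Sum>i\<in>UNIV. sq_norm M (\<lambda>x. G k x $ i - H x $ i))) \<longlonglongrightarrow> 0 + (\<Sum>i\<in>(UNIV::'n set). 0)"
    using sv GH unfolding tendsto_L2_def by (intro tendsto_intros)
  ultimately show lim: "tendsto_H1 s v" by simp
  show "v \<in> V" by (rule H10_sequentially_closed[OF v1 s lim])
qed

section \<open>The Poincare inequality and completeness\<close>

text \<open>
  The integral of the \<open>i\<close>-th partial derivative of \<open>x\<^sub>i \<phi>\<^sup>2\<close> vanishes, which expresses the norm of
  \<open>\<phi>\<close> by an integral of \<open>x\<^sub>i \<phi> \<partial>\<^sub>i\<phi>\<close>; the coordinate \<open>x\<^sub>i\<close> is bounded on the domain.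
\<close>

lemma Poincare_test_function:
  assumes R: "\<And>x. x \<in> \<Omega> \<Longrightarrow> norm x \<le> R" "R > 0" and \<phi>: "\<phi> \<in> test"
  shows "sq_norm M \<phi> \<le> 4 * R\<^sup>2 * sq_norm M (partial_deriv i \<phi>)"
proof -
  note L = test_function_L2'[OF \<phi>] test_function_partial_deriv_L2[OF \<phi>, of i]
  have Ck: "Ck k (\<lambda>x. x $ i * \<phi> x)" for k
    by (intro Ck_mult Ck_component test_functions_Ck[OF \<phi>])
  have xL: "square_integrable M (\<lambda>x. x $ i * \<phi> x)"
    by (intro test_function_L2' test_functions_mult \<phi> Ck_component)
  have "partial_deriv i (\<lambda>x. x $ i * \<phi> x) x = x $ i * partial_deriv i \<phi> x + \<phi> x" for x
  proof -
    have d: "((\<lambda>x::real^'n. x $ i) has_derivative (\<lambda>h. h $ i)) (at x)"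
      by (auto intro!: bounded_linear_imp_has_derivative bounded_linear_intros)
    have "partial_deriv i (\<lambda>x::real^'n. x $ i) x = 1" using partial_deriv_eq[OF d, of i] by simp
    moreover have "(\<lambda>x::real^'n. x $ i) differentiable (at x)" using d by (rule differentiableI)
    ultimately show ?thesis using test_functions_differentiable[OF \<phi>] by (simp add: partial_deriv_mult)
  qed
  with integral_by_parts_test[OF open_domain \<phi> Ck, of i]
  have "0 = (\<integral>x. 2 * ((x $ i * \<phi> x) * partial_deriv i \<phi> x) + (\<phi> x)\<^sup>2 \<partial>M)"
    by (simp add: algebra_simps power2_eq_square)
  also have "\<dots> = 2 * (\<integral>x. (x $ i * \<phi> x) * partial_deriv i \<phi> x \<partial>M) + sq_norm M \<phi>"
    using square_integrable_mult[OF xL L(2)] square_integrable_sq[OF L(1)] by (simp add: sq_norm_def)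
  finally have "sq_norm M \<phi> \<le> 2 * \<bar>\<integral>x. (x $ i * \<phi> x) * partial_deriv i \<phi> x \<partial>M\<bar>" by linarith
  also have "\<dots> \<le> 2 * (sqrt (sq_norm M (\<lambda>x. x $ i * \<phi> x)) * sqrt (sq_norm M (partial_deriv i \<phi>)))"
    using Cauchy_Schwarz_integral_abs[OF xL L(2)] by simp
  also have "sqrt (sq_norm M (\<lambda>x. x $ i * \<phi> x)) \<le> sqrt (sq_norm M (\<lambda>x. R * \<phi> x))"
  proof (intro real_sqrt_le_mono sq_norm_mono square_integrable_cmult L(1) xL)
    have "AE x in M. x \<in> \<Omega>" using AE_space[of M] by simp
    then show "AE x in M. \<bar>x $ i * \<phi> x\<bar> \<le> \<bar>R * \<phi> x\<bar>"
    proof eventually_elim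
      case (elim x)
      then show ?case
        using R component_le_norm_cart[of x i] unfolding abs_mult
        by (intro mult_right_mono) (auto intro: order_trans)
    qed
  qed
  also have "\<dots> = R * sqrt (sq_norm M \<phi>)"
    using R(2) by (simp add: sq_norm_cmult real_sqrt_mult)
  finally have *: "sq_norm M \<phi> \<le> 2 * (R * sqrt (sq_norm M \<phi>) * sqrt (sq_norm M (partial_deriv i \<phi>)))"
    by (simp add: mult_right_mono sq_norm_nonneg)
  define a b where "a = sqrt (sq_norm M \<phi>)" and "b = sqrt (sq_norm M (partial_deriv i \<phi>))"
  have ab: "0 \<le> a" "0 \<le> b" "sq_norm M \<phi> = a\<^sup>2" "sq_norm M (partial_deriv i \<phi>) = b\<^sup>2"
    by (simp_all add: a_def b_def sq_norm_nonneg)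
  have "a * a \<le> (2 * R * b) * a" using * ab(3) unfolding a_def[symmetric] b_def[symmetric]
    by (simp add: power2_eq_square algebra_simps)
  then have "a \<le> 2 * R * b" using ab R(2) by (cases "a = 0") (auto simp: mult_le_cancel_right)
  then have "a\<^sup>2 \<le> (2 * R * b)\<^sup>2" using ab by (intro power_mono)
  then show ?thesis by (simp add: ab power_mult_distrib)
qed

lemma Poincare:
  obtains C where "C > 0" "\<And>v. v \<in> V \<Longrightarrow> sq_norm M v \<le> C * E v v"
proof -
  obtain R where R: "R > 0" "\<And>x. x \<in> \<Omega> \<Longrightarrow> norm x \<le> R"
    using bounded_domain unfolding bounded_pos by auto
  define C where "C = 4 * R\<^sup>2"
  have C: "C > 0" using R by (simp add: C_def)
  have test: "sq_norm M \<phi> \<le> C * E \<phi> \<phi>" if \<phi>: "\<phi> \<in> test" for \<phi>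
  proof -
    have "sq_norm M (partial_deriv i \<phi>) \<le> E \<phi> \<phi>" for i
      unfolding E_self_eq[OF test_function_H1[OF \<phi>] test_function_weak_gradient[OF \<phi>]]
      using member_le_sum[of i UNIV "\<lambda>i. sq_norm M (partial_deriv i \<phi>)"] by (simp add: sq_norm_nonneg)
    then show ?thesis
      using Poincare_test_function[OF R(2) R(1) \<phi>] C unfolding C_def
      by (meson mult_left_mono order_trans less_imp_le)
  qed
  have "sq_norm M v \<le> 4 * C * E v v" if v: "v \<in> V" for v
  proof -
    obtain \<phi> where \<phi>: "\<And>k. \<phi> k \<in> test" "tendsto_H1 \<phi> v"
      using H10_approx[OF v] by blast
    have "sq_norm M v \<le> (2 + 4 * C) * H1_sq (\<lambda>x. v x - \<phi> k x) + 4 * C * E v v" for k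
    proof -
      have H1: "v \<in> H1 \<Omega>" "\<phi> k \<in> H1 \<Omega>" using v \<phi> by (auto intro: H10_H1 test_function_H1)
      let ?d = "\<lambda>x. v x - \<phi> k x"
      have d: "?d \<in> H1 \<Omega>" using H1 by (rule H1_diff)
      have le: "sq_norm M ?d \<le> H1_sq ?d" "E ?d ?d \<le> H1_sq ?d"
        by (simp_all add: H1_sq_def sq_norm_nonneg E_nonneg)
      have "sq_norm M v \<le> 2 * sq_norm M ?d + 2 * sq_norm M (\<phi> k)"
        using sq_norm_add_le[OF H1_L2[OF d] H1_L2[OF H1(2)]] by simp
      also have "E (\<phi> k) (\<phi> k) \<le> 2 * E v v + 2 * E ?d ?d"
      proof -
        have "E (\<lambda>x. v x + (-1) * ?d x) (\<lambda>x. v x + (-1) * ?d x) \<le> 2 * E v v + 2 * E (\<lambda>x. (-1) * ?d x) (\<lambda>x. (-1) * ?d x)"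
          by (rule E_add_le[OF H1(1) H1_cmult[OF d]])
        then show ?thesis using E_minus_commute[OF H1] by simp
      qed
      then have "C * E (\<phi> k) (\<phi> k) \<le> C * (2 * E v v + 2 * H1_sq ?d)"
        using C le(2) by (intro mult_left_mono) auto
      with test[OF \<phi>(1)[of k]] have "2 * sq_norm M ?d + 2 * sq_norm M (\<phi> k) \<le> 2 * H1_sq ?d + 2 * (C * (2 * E v v + 2 * H1_sq ?d))"
        using le(1) by linarith
      finally show ?thesis by (simp add: algebra_simps)
    qed
    moreover have "(\<lambda>k. (2 + 4 * C) * H1_sq (\<lambda>x. v x - \<phi> k x) + 4 * C * E v v) \<longlonglongrightarrow> (2 + 4 * C) * 0 + 4 * C * E v v"
      by (intro tendsto_intros \<phi>(2))
    ultimately show ?thesis by (simp add: LIMSEQ_le_const)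
  qed
  then show thesis using that[of "4 * C"] C by simp
qed

text \<open>By the Poincare inequality the gradients alone control the whole norm.\<close>

lemma H10_complete:
  assumes s: "\<And>k. s k \<in> V"
    and C: "\<And>e. e > 0 \<Longrightarrow> \<exists>N. \<forall>i\<ge>N. \<forall>j\<ge>N. grad_dist (s i) (s j) < e"
  shows "\<exists>v\<in>V. tendsto_H1 s v"
proof -
  obtain P where P: "P > 0" "\<And>v. v \<in> V \<Longrightarrow> sq_norm M v \<le> P * E v v" using Poincare by blast
  have "\<exists>N. \<forall>i\<ge>N. \<forall>j\<ge>N. sq_norm M (\<lambda>x. s i x - s j x) < e" if "e > 0" for e
  proof -
    obtain N where N: "\<And>i j. i \<ge> N \<Longrightarrow> j \<ge> N \<Longrightarrow> grad_dist (s i) (s j) < e / P"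
      using C[of "e / P"] P(1) \<open>e > 0\<close> by auto
    have "sq_norm M (\<lambda>x. s i x - s j x) < e" if "i \<ge> N" "j \<ge> N" for i j
      using P(2)[OF H10_diff[OF s[of i] s[of j]]] N[OF that] P(1) by (simp add: field_simps)
    then show ?thesis by blast
  qed
  then obtain v where v: "square_integrable M v" "tendsto_L2 M s v"
    using Cauchy_L2_convergent[of M s, OF finite_measure_M H10_L2[OF s]] by meson
  have "\<exists>g. square_integrable M g \<and> tendsto_L2 M (\<lambda>k x. D (s k) x $ i) g" for i
  proof -
    have "\<exists>N. \<forall>k\<ge>N. \<forall>j\<ge>N. sq_norm M (\<lambda>x. D (s k) x $ i - D (s j) x $ i) < e" if "e > 0" for e
    proof -
      obtain N where N: "\<And>i j. i \<ge> N \<Longrightarrow> j \<ge> N \<Longrightarrow> grad_dist (s i) (s j) < e"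
        using C[OF \<open>e > 0\<close>] by auto
      have "sq_norm M (\<lambda>x. D (s k) x $ i - D (s j) x $ i) < e" if "k \<ge> N" "j \<ge> N" for k j
      proof -
        have "has_gradient (\<lambda>x. s k x + (-1) * s j x) (\<lambda>x. D (s k) x + (-1) *\<^sub>R D (s j) x)"
          by (intro is_weak_gradient_add is_weak_gradient_cmult square_integrable_cmult H10_L2 s H1_weak_gradient H10_H1)
        then have wg: "has_gradient (\<lambda>x. s k x - s j x) (\<lambda>x. D (s k) x - D (s j) x)" by simp
        have "sq_norm M (\<lambda>x. (D (s k) x - D (s j) x) $ i) \<le> grad_dist (s k) (s j)"
          unfolding E_self_eq[OF H10_H1[OF H10_diff[OF s s]] wg]
          by (intro member_le_sum) (auto simp: sq_norm_nonneg)
        with N[OF that] show ?thesis by simp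
      qed
      then show ?thesis by blast
    qed
    then show ?thesis
      by (intro Cauchy_L2_convergent finite_measure_M D_L2 H10_H1 s)
  qed
  then obtain g where g: "\<And>i. square_integrable M (g i)" "\<And>i. tendsto_L2 M (\<lambda>k x. D (s k) x $ i) (g i)"
    by metis
  have "v \<in> V" "tendsto_H1 s v"
    using H10_closed[of s "\<lambda>k. D (s k)" v "\<lambda>x. \<chi> i. g i x", OF s H1_weak_gradient[OF H10_H1[OF s]] v(1) _ v(2)] g
    by simp_all
  then show ?thesis by blast
qed

section \<open>Truncation in the Sobolev space\<close>

text \<open>
  The limit passage for chain rules: the outer derivatives \<open>\<rho> k\<close> converge only pointwise and
  boundedly, the gradients \<open>G k\<close> of the inner functions in mean square.
\<close>

lemma H10_chain_limit:
  assumes s: "\<And>k. s k \<in> V" and wg: "\<And>k. has_gradient (s k) (\<lambda>x. \<rho> k x *\<^sub>R G k x)"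
    and w: "square_integrable M w" "tendsto_L2 M s w"
    and G: "\<And>k i. square_integrable M (\<lambda>x. G k x $ i)" "\<And>i. square_integrable M (\<lambda>x. H x $ i)"
      "\<And>i. tendsto_L2 M (\<lambda>k x. G k x $ i) (\<lambda>x. H x $ i)"
    and \<rho>: "\<And>k. \<rho> k \<in> borel_measurable M" "\<rho>' \<in> borel_measurable M" "\<And>k x. \<bar>\<rho> k x\<bar> \<le> 1"
      "AE x in M. (\<lambda>k. \<rho> k x) \<longlonglongrightarrow> \<rho>' x"
  shows "has_gradient w (\<lambda>x. \<rho>' x *\<^sub>R H x)" "w \<in> V"
proof -
  have lim: "square_integrable M (\<lambda>x. \<rho>' x * H x $ i) \<and> tendsto_L2 M (\<lambda>k x. \<rho> k x * G k x $ i) (\<lambda>x. \<rho>' x * H x $ i)" for i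
  proof -
    have \<rho>H: "square_integrable M (\<lambda>x. \<rho> k x * H x $ i)" for k
      by (rule square_integrable_bounded_mult[OF G(2) \<rho>(1,3)])
    have m: "(\<lambda>x. \<rho>' x * H x $ i) \<in> borel_measurable M"
      using \<rho>(2) G(2)[of i] by measurable
    have pw: "AE x in M. (\<lambda>k. \<rho> k x * H x $ i) \<longlonglongrightarrow> \<rho>' x * H x $ i"
      using \<rho>(4) by eventually_elim (intro tendsto_intros)
    have bd: "AE x in M. \<bar>\<rho> k x * H x $ i\<bar> \<le> \<bar>H x $ i\<bar>" for k
      using \<rho>(3)[of k] by (intro always_eventually allI) (simp add: abs_mult mult_left_le_one_le)
    have dom: "square_integrable M (\<lambda>x. \<rho>' x * H x $ i)"
      "tendsto_L2 M (\<lambda>k x. \<rho> k x * H x $ i) (\<lambda>x. \<rho>' x * H x $ i)"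
      by (rule tendsto_L2_dominated[OF \<rho>H m G(2)[of i] pw bd])+
    have "tendsto_L2 M (\<lambda>k x. \<rho> k x * G k x $ i) (\<lambda>x. \<rho>' x * H x $ i)"
      unfolding tendsto_L2_def
    proof (rule tendsto_sandwich)
      show "\<forall>\<^sub>F k in sequentially. 0 \<le> sq_norm M (\<lambda>x. \<rho> k x * G k x $ i - \<rho>' x * H x $ i)"
        by (simp add: sq_norm_nonneg)
      show "\<forall>\<^sub>F k in sequentially. sq_norm M (\<lambda>x. \<rho> k x * G k x $ i - \<rho>' x * H x $ i) \<le>
          2 * sq_norm M (\<lambda>x. G k x $ i - H x $ i) + 2 * sq_norm M (\<lambda>x. \<rho> k x * H x $ i - \<rho>' x * H x $ i)"
      proof (intro always_eventually allI)
        fix k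
        have d: "square_integrable M (\<lambda>x. G k x $ i - H x $ i)"
          by (intro square_integrable_diff G)
        have "sq_norm M (\<lambda>x. \<rho> k x * (G k x $ i - H x $ i)) \<le> sq_norm M (\<lambda>x. G k x $ i - H x $ i)"
          by (intro sq_norm_mono square_integrable_bounded_mult[OF d \<rho>(1,3)] d always_eventually allI)
             (simp add: abs_mult mult_left_le_one_le \<rho>(3))
        moreover have "sq_norm M (\<lambda>x. \<rho> k x * G k x $ i - \<rho>' x * H x $ i) \<le>
            2 * sq_norm M (\<lambda>x. \<rho> k x * G k x $ i - \<rho> k x * H x $ i) + 2 * sq_norm M (\<lambda>x. \<rho> k x * H x $ i - \<rho>' x * H x $ i)"
          by (intro sq_norm_diff_triangle \<rho>H dom(1) square_integrable_bounded_mult G \<rho>)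
        ultimately show "sq_norm M (\<lambda>x. \<rho> k x * G k x $ i - \<rho>' x * H x $ i) \<le>
          2 * sq_norm M (\<lambda>x. G k x $ i - H x $ i) + 2 * sq_norm M (\<lambda>x. \<rho> k x * H x $ i - \<rho>' x * H x $ i)"
          by (simp add: right_diff_distrib)
      qed
      have "(\<lambda>k. 2 * sq_norm M (\<lambda>x. G k x $ i - H x $ i) + 2 * sq_norm M (\<lambda>x. \<rho> k x * H x $ i - \<rho>' x * H x $ i)) \<longlonglongrightarrow> 2 * 0 + 2 * 0"
        using G(3)[of i] dom(2) unfolding tendsto_L2_def by (intro tendsto_intros)
      then show "(\<lambda>k. 2 * sq_norm M (\<lambda>x. G k x $ i - H x $ i) + 2 * sq_norm M (\<lambda>x. \<rho> k x * H x $ i - \<rho>' x * H x $ i)) \<longlonglongrightarrow> 0"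
        by simp
    qed simp
    with dom(1) show ?thesis by simp
  qed
  show "has_gradient w (\<lambda>x. \<rho>' x *\<^sub>R H x)" "w \<in> V"
    using H10_closed[OF s wg w(1) _ w(2), of "\<lambda>x. \<rho>' x *\<^sub>R H x"] lim by simp_all
qed

lemma tendsto_H1_sq_imp_L2:
  assumes v: "v \<in> H1 \<Omega>" and s: "\<And>k. s k \<in> H1 \<Omega>" and lim: "tendsto_H1 s v"
  shows "tendsto_L2 M s v" "has_gradient v G \<Longrightarrow> (\<And>k. has_gradient (s k) (Gs k)) \<Longrightarrow>
    tendsto_L2 M (\<lambda>k x. Gs k x $ i) (\<lambda>x. G x $ i)"
proof -
  show "tendsto_L2 M s v"
    unfolding tendsto_L2_def
    by (rule tendsto_sandwich[OF _ _ tendsto_const lim])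
       (auto simp: sq_norm_nonneg H1_sq_def E_nonneg sq_norm_minus_commute[of M v] intro!: always_eventually)
  assume G: "has_gradient v G" "\<And>k. has_gradient (s k) (Gs k)"
  have "sq_norm M (\<lambda>x. Gs k x $ i - G x $ i) \<le> H1_sq (\<lambda>x. v x - s k x)" for k
  proof -
    have "has_gradient (\<lambda>x. v x + (-1) * s k x) (\<lambda>x. G x + (-1) *\<^sub>R Gs k x)"
      by (intro is_weak_gradient_add is_weak_gradient_cmult square_integrable_cmult H1_L2 s v G)
    then have wd: "has_gradient (\<lambda>x. v x - s k x) (\<lambda>x. G x - Gs k x)" by simp
    have "sq_norm M (\<lambda>x. (G x - Gs k x) $ i) \<le> grad_dist v (s k)"
      unfolding E_self_eq[OF H1_diff[OF v s] wd] by (intro member_le_sum) (auto simp: sq_norm_nonneg)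
    then show ?thesis
      using sq_norm_nonneg[of M "\<lambda>x. v x - s k x"]
      by (simp add: H1_sq_def sq_norm_minus_commute[of M "\<lambda>x. G x $ i"])
  qed
  then show "tendsto_L2 M (\<lambda>k x. Gs k x $ i) (\<lambda>x. G x $ i)"
    unfolding tendsto_L2_def
    by (intro tendsto_sandwich[OF _ _ tendsto_const lim]) (auto simp: sq_norm_nonneg intro!: always_eventually)
qed

lemma sqrt_smoothing_Lipschitz: "\<bar>sqrt (a\<^sup>2 + e\<^sup>2) - sqrt (b\<^sup>2 + e\<^sup>2)\<bar> \<le> \<bar>a - b\<bar>" for a b e :: real
proof -
  have "sqrt (a\<^sup>2 + e\<^sup>2) \<le> sqrt (b\<^sup>2 + e\<^sup>2) + \<bar>a - b\<bar>" for a b :: real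
    using real_sqrt_sum_squares_triangle_ineq[of b "a - b" e 0] by simp
  from this[of a b] this[of b a] show ?thesis by linarith
qed

lemma sqrt_smoothing_slope: "\<bar>t / sqrt (t\<^sup>2 + e\<^sup>2)\<bar> \<le> 1" for t e :: real
proof -
  have le: "\<bar>t\<bar> \<le> sqrt (t\<^sup>2 + e\<^sup>2)" by (intro real_le_rsqrt) simp
  show ?thesis
  proof (cases "sqrt (t\<^sup>2 + e\<^sup>2) = 0")
    case False
    then have "sqrt (t\<^sup>2 + e\<^sup>2) > 0" using order_trans[OF abs_ge_zero le] by linarith
    then show ?thesis using le by (simp add: abs_divide del: real_sqrt_gt_0_iff)
  qed simp
qed

text \<open>The chain rule holds classically for test functions; approximate \<open>v\<close> by them.\<close>

lemma H10_smooth_abs: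
  assumes v: "v \<in> V" and e: "e > 0"
  shows "has_gradient (\<lambda>x. sqrt ((v x)\<^sup>2 + e\<^sup>2) - e) (\<lambda>x. (v x / sqrt ((v x)\<^sup>2 + e\<^sup>2)) *\<^sub>R D v x)"
    and "(\<lambda>x. sqrt ((v x)\<^sup>2 + e\<^sup>2) - e) \<in> V"
proof -
  define g where "g t = sqrt (t\<^sup>2 + e\<^sup>2) - e" for t
  obtain \<psi> where \<psi>: "\<And>k. \<psi> k \<in> test" "tendsto_H1 \<psi> v"
    using H10_approx[OF v] by blast
  note v1 = H10_H1[OF v]
  obtain r where r: "strict_mono r" "AE x in M. (\<lambda>n. \<psi> (r n) x) \<longlonglongrightarrow> v x"
    by (rule tendsto_L2_AE_subseq[OF tendsto_H1_sq_imp_L2(1)[OF v1 test_function_H1[OF \<psi>(1)] \<psi>(2)]])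
       (auto intro: test_function_L2' \<psi> H10_L2 v)
  define \<phi> where "\<phi> k = \<psi> (r k)" for k
  have \<phi>: "\<phi> k \<in> test" for k by (simp add: \<phi>_def \<psi>)
  have \<phi>lim: "tendsto_H1 \<phi> v"
    using LIMSEQ_subseq_LIMSEQ[OF \<psi>(2) r(1)] by (simp add: comp_def \<phi>_def)
  have gt: "(\<lambda>x. g (\<phi> k x)) \<in> test" for k
  proof -
    obtain K where K: "compact K" "K \<subseteq> \<Omega>" "\<And>x. x \<notin> K \<Longrightarrow> \<phi> k x = 0"
      using test_functionsE[OF \<phi>] by blast
    show ?thesis
      by (rule test_functionsI[of _ K]) (use K e Ck_sqrt_smoothing[OF e test_functions_Ck[OF \<phi>]] in \<open>auto simp: g_def\<close>)
  qed
  have gL: "square_integrable M (\<lambda>x. g (w x))" if "square_integrable M w" for w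
  proof (rule square_integrable_bound[OF that])
    show "(\<lambda>x. g (w x)) \<in> borel_measurable M" unfolding g_def using that by measurable
    show "AE x in M. \<bar>g (w x)\<bar> \<le> \<bar>w x\<bar>"
      using sqrt_smoothing_Lipschitz[of _ e 0] e by (intro always_eventually allI) (simp add: g_def)
  qed
  have wg: "has_gradient (\<lambda>x. g (\<phi> k x))
      (\<lambda>x. (\<phi> k x / sqrt ((\<phi> k x)\<^sup>2 + e\<^sup>2)) *\<^sub>R (\<chi> i. partial_deriv i (\<phi> k) x))" for k
  proof -
    have "partial_deriv i (\<lambda>x. g (\<phi> k x)) x = \<phi> k x / sqrt ((\<phi> k x)\<^sup>2 + e\<^sup>2) * partial_deriv i (\<phi> k) x" for i x
      unfolding g_def
      by (intro partial_deriv_compose[where g = "\<lambda>t. sqrt (t\<^sup>2 + e\<^sup>2) - e"]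
          test_functions_differentiable[OF \<phi>] sqrt_smoothing_has_derivative e)
    then have "(\<lambda>x. \<chi> i. partial_deriv i (\<lambda>x. g (\<phi> k x)) x) =
        (\<lambda>x. (\<phi> k x / sqrt ((\<phi> k x)\<^sup>2 + e\<^sup>2)) *\<^sub>R (\<chi> i. partial_deriv i (\<phi> k) x))"
      by (simp add: vec_eq_iff fun_eq_iff)
    then show ?thesis using test_function_weak_gradient[OF gt[of k]] by simp
  qed
  have \<phi>v: "tendsto_L2 M \<phi> v" by (rule tendsto_H1_sq_imp_L2(1)[OF v1 test_function_H1[OF \<phi>] \<phi>lim])
  have "tendsto_L2 M (\<lambda>k x. g (\<phi> k x)) (\<lambda>x. g (v x))"
    unfolding tendsto_L2_def
  proof (rule tendsto_sandwich[OF _ _ tendsto_const \<phi>v[unfolded tendsto_L2_def]])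
    show "\<forall>\<^sub>F k in sequentially. sq_norm M (\<lambda>x. g (\<phi> k x) - g (v x)) \<le> sq_norm M (\<lambda>x. \<phi> k x - v x)"
      using sqrt_smoothing_Lipschitz
      by (intro always_eventually allI sq_norm_mono square_integrable_diff gL test_function_L2' \<phi> H10_L2 v)
         (simp add: g_def)
  qed (simp add: sq_norm_nonneg)
  note limits = H10_chain_limit[OF test_function_H10[OF gt] wg gL[OF H10_L2[OF v]] this]
  have m: "(\<lambda>x. w x / sqrt ((w x)\<^sup>2 + e\<^sup>2)) \<in> borel_measurable M" if "square_integrable M w" for w
    using that by measurable
  have G: "tendsto_L2 M (\<lambda>k x. (\<chi> i. partial_deriv i (\<phi> k) x) $ i) (\<lambda>x. D v x $ i)" for i
    by (rule tendsto_H1_sq_imp_L2(2)[OF v1 test_function_H1[OF \<phi>] \<phi>lim H1_weak_gradient[OF v1] test_function_weak_gradient[OF \<phi>]])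
  have \<rho>: "AE x in M. (\<lambda>k. \<phi> k x / sqrt ((\<phi> k x)\<^sup>2 + e\<^sup>2)) \<longlonglongrightarrow> v x / sqrt ((v x)\<^sup>2 + e\<^sup>2)"
    using r(2)
  proof eventually_elim
    case (elim x)
    have "(v x)\<^sup>2 + e\<^sup>2 > 0" using e by (simp add: add_nonneg_pos)
    then show ?case using elim unfolding \<phi>_def by (intro tendsto_intros) auto
  qed
  have "has_gradient (\<lambda>x. g (v x)) (\<lambda>x. (v x / sqrt ((v x)\<^sup>2 + e\<^sup>2)) *\<^sub>R D v x)" "(\<lambda>x. g (v x)) \<in> V"
    using limits[OF is_weak_gradientD(1)[OF test_function_weak_gradient[OF \<phi>]] D_L2[OF v1] G
        m[OF test_function_L2'[OF \<phi>]] m[OF H10_L2[OF v]] sqrt_smoothing_slope \<rho>] by simp_all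
  then show "has_gradient (\<lambda>x. sqrt ((v x)\<^sup>2 + e\<^sup>2) - e) (\<lambda>x. (v x / sqrt ((v x)\<^sup>2 + e\<^sup>2)) *\<^sub>R D v x)"
    "(\<lambda>x. sqrt ((v x)\<^sup>2 + e\<^sup>2) - e) \<in> V" by (simp_all add: g_def)
qed

text \<open>
  Let the smoothing parameter of \<open>H10_smooth_abs\<close> tend to zero. The factor \<open>v / sqrt (v\<^sup>2 + e\<^sup>2)\<close>
  converges to \<open>sgn v\<close> everywhere, including the zeros of \<open>v\<close>.
\<close>

lemma H10_abs:
  assumes v: "v \<in> V"
  shows "has_gradient (\<lambda>x. \<bar>v x\<bar>) (\<lambda>x. sgn (v x) *\<^sub>R D v x)" and "(\<lambda>x. \<bar>v x\<bar>) \<in> V"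
proof -
  define e where "e k = inverse (real (Suc k))" for k
  have e: "e k > 0" for k by (simp add: e_def)
  have e0: "e \<longlonglongrightarrow> 0" unfolding e_def by (rule LIMSEQ_inverse_real_of_nat)
  note v1 = H10_H1[OF v] and vL = H10_L2[OF v]
  have vm [measurable]: "v \<in> borel_measurable M" using vL by (rule square_integrable_measurable)
  have s_lim: "(\<lambda>k. sqrt ((v x)\<^sup>2 + (e k)\<^sup>2) - e k) \<longlonglongrightarrow> \<bar>v x\<bar>" for x
  proof -
    have "(\<lambda>k. sqrt ((v x)\<^sup>2 + (e k)\<^sup>2) - e k) \<longlonglongrightarrow> sqrt ((v x)\<^sup>2 + 0\<^sup>2) - 0" by (intro tendsto_intros e0)
    then show ?thesis by simp
  qed
  have \<rho>_lim: "(\<lambda>k. v x / sqrt ((v x)\<^sup>2 + (e k)\<^sup>2)) \<longlonglongrightarrow> sgn (v x)" for x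
  proof (cases "v x = 0")
    case False
    then have "(\<lambda>k. v x / sqrt ((v x)\<^sup>2 + (e k)\<^sup>2)) \<longlonglongrightarrow> v x / sqrt ((v x)\<^sup>2 + 0\<^sup>2)" by (intro tendsto_intros e0) auto
    then show ?thesis by (simp add: sgn_div_norm field_simps)
  qed simp
  have bd: "\<bar>sqrt ((v x)\<^sup>2 + (e k)\<^sup>2) - e k\<bar> \<le> \<bar>v x\<bar>" for k x
    using sqrt_smoothing_Lipschitz[of "v x" "e k" 0] e[of k] by simp
  have L2: "square_integrable M (\<lambda>x. \<bar>v x\<bar>)"
    by (rule square_integrable_bound[OF vL]) auto
  have lim: "tendsto_L2 M (\<lambda>k x. sqrt ((v x)\<^sup>2 + (e k)\<^sup>2) - e k) (\<lambda>x. \<bar>v x\<bar>)"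
    by (rule tendsto_L2_dominated(2)[OF H10_L2[OF H10_smooth_abs(2)[OF v e]] _ vL])
       (use s_lim bd in \<open>auto intro!: always_eventually simp del: abs_le_iff\<close>)
  note * = H10_chain_limit[OF H10_smooth_abs(2)[OF v e] H10_smooth_abs(1)[OF v e] L2 lim D_L2[OF v1] D_L2[OF v1] tendsto_L2_const]
  show "has_gradient (\<lambda>x. \<bar>v x\<bar>) (\<lambda>x. sgn (v x) *\<^sub>R D v x)"
    by (rule *(1)) (auto simp: \<rho>_lim sqrt_smoothing_slope simp del: abs_divide)
  show "(\<lambda>x. \<bar>v x\<bar>) \<in> V"
    by (rule *(2)[of "\<lambda>x. sgn (v x)"]) (auto simp: \<rho>_lim sqrt_smoothing_slope simp del: abs_divide)
qed

lemma H10_pos_part: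
  assumes v: "v \<in> V"
  shows "has_gradient (\<lambda>x. max (v x) 0) (\<lambda>x. ((1 + sgn (v x)) / 2) *\<^sub>R D v x)"
    and "(\<lambda>x. max (v x) 0) \<in> V"
proof -
  have eq: "(\<lambda>x. max (v x) 0) = (\<lambda>x. (1/2) * (v x + \<bar>v x\<bar>))" by (auto simp: fun_eq_iff)
  show "(\<lambda>x. max (v x) 0) \<in> V"
    unfolding eq by (intro H10_cmult H10_add v H10_abs)
  have "has_gradient (\<lambda>x. (1/2) * (v x + \<bar>v x\<bar>)) (\<lambda>x. (1/2) *\<^sub>R (D v x + sgn (v x) *\<^sub>R D v x))"
    by (intro is_weak_gradient_cmult is_weak_gradient_add H10_L2 H10_abs v H1_weak_gradient H10_H1)
  moreover have "(1/2) *\<^sub>R (D v x + sgn (v x) *\<^sub>R D v x) = ((1 + sgn (v x)) / 2) *\<^sub>R D v x" for x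
    by (simp add: vec_eq_iff algebra_simps add_divide_distrib)
  ultimately show "has_gradient (\<lambda>x. max (v x) 0) (\<lambda>x. ((1 + sgn (v x)) / 2) *\<^sub>R D v x)"
    unfolding eq by simp
qed

text \<open>
  The gradient of the positive part is the gradient of \<open>v\<close> times \<open>0\<close>, \<open>1/2\<close> or \<open>1\<close>, and each of
  these factors is at least its own square.
\<close>

lemma E_pos_part:
  assumes v: "v \<in> V"
  shows "E (\<lambda>x. max (v x) 0) (\<lambda>x. max (v x) 0) \<le> E v (\<lambda>x. max (v x) 0)"
proof -
  let ?p = "\<lambda>x. max (v x) 0" and ?\<rho> = "\<lambda>x. (1 + sgn (v x)) / 2"
  note wg = H10_pos_part(1)[OF v] H1_weak_gradient[OF H10_H1[OF v]]
    and H1 = H10_H1[OF H10_pos_part(2)[OF v]] H10_H1[OF v]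
  have "E ?p ?p = (\<integral>x. (?\<rho> x *\<^sub>R D v x) \<bullet> (?\<rho> x *\<^sub>R D v x) \<partial>M)" by (rule E_eq[OF H1(1,1) wg(1,1)])
  also have "\<dots> \<le> (\<integral>x. D v x \<bullet> (?\<rho> x *\<^sub>R D v x) \<partial>M)"
  proof (rule integral_mono)
    show "(?\<rho> x *\<^sub>R D v x) \<bullet> (?\<rho> x *\<^sub>R D v x) \<le> D v x \<bullet> (?\<rho> x *\<^sub>R D v x)" for x
      by (auto simp: sgn_if)
  qed (intro integrable_inner_L2 is_weak_gradientD(1)[OF wg(1)] is_weak_gradientD(1)[OF wg(2)])+
  also have "\<dots> = E v ?p" by (rule E_eq[OF H1(2,1) wg(2,1), symmetric])
  finally show ?thesis .
qed

lemma H10_max: "v \<in> V \<Longrightarrow> w \<in> V \<Longrightarrow> (\<lambda>x. max (v x) (w x)) \<in> V"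
proof -
  assume "v \<in> V" "w \<in> V"
  then have "(\<lambda>x. w x + max (v x - w x) 0) \<in> V" by (intro H10_add H10_pos_part(2) H10_diff)
  moreover have "(\<lambda>x. w x + max (v x - w x) 0) = (\<lambda>x. max (v x) (w x))" by (auto simp: fun_eq_iff)
  ultimately show ?thesis by simp
qed

lemma H10_min: "v \<in> V \<Longrightarrow> w \<in> V \<Longrightarrow> (\<lambda>x. min (v x) (w x)) \<in> V"
proof -
  assume "v \<in> V" "w \<in> V"
  then have "(\<lambda>x. v x - max (v x - w x) 0) \<in> V" by (intro H10_diff H10_pos_part(2))
  moreover have "(\<lambda>x. v x - max (v x - w x) 0) = (\<lambda>x. min (v x) (w x))" by (auto simp: fun_eq_iff)
  ultimately show ?thesis by simp
qed

lemma E_eq_0_imp_AE: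
  assumes v: "v \<in> V" and "E v v \<le> 0" shows "AE x in M. v x = 0"
proof -
  obtain P where "P > 0" "\<And>v. v \<in> V \<Longrightarrow> sq_norm M v \<le> P * E v v" using Poincare by blast
  then have "sq_norm M v \<le> 0" using assms by (metis less_imp_le mult_nonneg_nonpos order_trans)
  then have "sq_norm M v = 0" using sq_norm_nonneg[of M v] by linarith
  then show ?thesis using sq_norm_eq_0_iff[OF H10_L2[OF v]] by simp
qed

end

section \<open>The obstacle problem\<close>

locale semilinear_domain = bounded_domain \<Omega> for \<Omega> :: "(real^'n::finite) set" +
  fixes f :: "real \<Rightarrow> real" and L :: real
  assumes f_mono: "mono f" and f_Lipschitz: "L-lipschitz_on UNIV f" and f_0: "f 0 = 0"
begin

lemma L_nonneg: "0 \<le> L"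
  using lipschitz_on_nonneg[OF f_Lipschitz] .

lemma f_diff_le: "\<bar>f s - f t\<bar> \<le> L * \<bar>s - t\<bar>"
  using lipschitz_onD[OF f_Lipschitz, of s t] by (simp add: dist_real_def)

lemma f_abs_le: "\<bar>f t\<bar> \<le> L * \<bar>t\<bar>"
  using f_diff_le[of t 0] f_0 by simp

lemma f_nonneg: "0 \<le> t \<Longrightarrow> 0 \<le> f t"
  using monoD[OF f_mono, of 0 t] f_0 by simp

lemma f_continuous: "continuous_on UNIV f"
  using lipschitz_on_continuous_on[OF f_Lipschitz] .

lemma f_L2:
  assumes "square_integrable M v" shows "square_integrable M (\<lambda>x. f (v x))"
proof (rule square_integrable_bound[OF square_integrable_cmult[OF assms, of L]])
  have "f \<in> borel_measurable borel" by (rule borel_measurable_continuous_onI[OF f_continuous])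
  then show "(\<lambda>x. f (v x)) \<in> borel_measurable M" using assms by measurable
  show "AE x in M. \<bar>f (v x)\<bar> \<le> \<bar>L * v x\<bar>"
    using f_abs_le L_nonneg by (intro always_eventually allI) (simp add: abs_mult)
qed

text \<open>
  A primitive of \<open>f\<close>. It is chosen abstractly since \<open>f\<close> is to be integrated over intervals on both
  sides of \<open>0\<close>.
\<close>

definition F :: "real \<Rightarrow> real" where
  "F = (SOME F. (\<forall>t. (F has_real_derivative f t) (at t)) \<and> F 0 = 0)"

lemma F_derivative: "(F has_real_derivative f t) (at t)" and F_0: "F 0 = 0"
proof -
  have "isCont f x" for x using f_continuous by (simp add: continuous_on_eq_continuous_at)
  then obtain G where G: "\<And>t. (G has_vector_derivative f t) (at t)"
    using einterval_antiderivative[of "-\<infinity>" "\<infinity>" f] by auto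
  have "\<exists>F. (\<forall>t. (F has_real_derivative f t) (at t)) \<and> F 0 = 0"
    using G by (intro exI[of _ "\<lambda>t. G t - G 0"])
      (auto intro!: derivative_eq_intros simp: has_real_derivative_iff_has_vector_derivative)
  from someI_ex[OF this] show "(F has_real_derivative f t) (at t)" and "F 0 = 0"
    by (auto simp: F_def)
qed

text \<open>Convexity of \<open>F\<close>, which comes from the monotonicity of \<open>f\<close>.\<close>

lemma F_gradient: "F s - F t \<le> f s * (s - t)"
proof -
  consider "s < t" | "s = t" | "t < s" by linarith
  then show ?thesis
  proof cases
    case 1
    obtain z where z: "s < z" "F t - F s = (t - s) * f z"
      using MVT2[OF 1, of F f] F_derivative by blast
    have "f s * (t - s) \<le> f z * (t - s)" using monoD[OF f_mono, of s z] z 1 by (intro mult_right_mono) auto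
    then show ?thesis using z by (simp add: algebra_simps)
  next
    case 3
    obtain z where z: "z < s" "F s - F t = (s - t) * f z"
      using MVT2[OF 3, of F f] F_derivative by blast
    have "f z * (s - t) \<le> f s * (s - t)" using monoD[OF f_mono, of z s] z 3 by (intro mult_right_mono) auto
    then show ?thesis using z by (simp add: algebra_simps)
  qed simp
qed

lemma F_nonneg: "0 \<le> F t"
  using F_gradient[of 0 t] F_0 f_0 by simp

lemma F_le: "F t \<le> L * t\<^sup>2"
proof -
  have "F t \<le> f t * t" using F_gradient[of t 0] F_0 by simp
  also have "\<dots> \<le> \<bar>f t\<bar> * \<bar>t\<bar>" by (metis abs_ge_self abs_mult)
  also have "\<dots> \<le> (L * \<bar>t\<bar>) * \<bar>t\<bar>" using f_abs_le by (intro mult_right_mono) auto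
  finally show ?thesis by (simp add: power2_eq_square mult.assoc)
qed

lemma F_integrable:
  assumes "square_integrable M v" shows "integrable M (\<lambda>x. F (v x))"
proof (rule Bochner_Integration.integrable_bound)
  show "integrable M (\<lambda>x. L * (v x)\<^sup>2)" using square_integrable_sq[OF assms] by simp
  have "continuous_on UNIV F"
    using F_derivative DERIV_isCont by (intro continuous_at_imp_continuous_on) blast
  then have "F \<in> borel_measurable borel" by (rule borel_measurable_continuous_onI)
  then show "(\<lambda>x. F (v x)) \<in> borel_measurable M" using assms by measurable
  show "AE x in M. norm (F (v x)) \<le> norm (L * (v x)\<^sup>2)"
    using F_nonneg F_le L_nonneg by (intro always_eventually allI) simp
qed

text \<open>
  The residual of the equation \<open>- \<Delta> y + f y = u\<close> at \<open>y\<close>, tested with \<open>w\<close>; it is the derivative of the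
  energy below.
\<close>

definition residual :: "((real^'n \<Rightarrow> real) \<Rightarrow> real) \<Rightarrow> (real^'n \<Rightarrow> real) \<Rightarrow> (real^'n \<Rightarrow> real) \<Rightarrow> real" where
  "residual u y w = E y w + (\<integral>x. f (y x) * w x \<partial>M) - u w"

definition energy :: "((real^'n \<Rightarrow> real) \<Rightarrow> real) \<Rightarrow> (real^'n \<Rightarrow> real) \<Rightarrow> real" where
  "energy u y = E y y / 2 + (\<integral>x. F (y x) \<partial>M) - u y"

lemma Hm1_add: "u \<in> Hm1 \<Omega> \<Longrightarrow> v \<in> V \<Longrightarrow> w \<in> V \<Longrightarrow> u (\<lambda>x. v x + w x) = u v + u w"
  unfolding Hm1_def by blast

lemma Hm1_cmult: "u \<in> Hm1 \<Omega> \<Longrightarrow> v \<in> V \<Longrightarrow> u (\<lambda>x. c * v x) = c * u v"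
  unfolding Hm1_def by blast

lemma Hm1_diff: "u \<in> Hm1 \<Omega> \<Longrightarrow> v \<in> V \<Longrightarrow> w \<in> V \<Longrightarrow> u (\<lambda>x. v x - w x) = u v - u w"
  using Hm1_add[of u v "\<lambda>x. -1 * w x"] Hm1_cmult[of u w "-1"] H10_cmult[of w "-1"] by simp

lemma Hm1_bound:
  assumes "u \<in> Hm1 \<Omega>"
  obtains C where "C \<ge> 0" "\<And>v. v \<in> V \<Longrightarrow> \<bar>u v\<bar> \<le> C * sqrt (H1_sq v)"
proof -
  obtain C where C: "\<And>v. v \<in> V \<Longrightarrow> \<bar>u v\<bar> \<le> C * H1_norm \<Omega> v"
    using assms unfolding Hm1_def by blast
  have "\<bar>u v\<bar> \<le> \<bar>C\<bar> * sqrt (H1_sq v)" if "v \<in> V" for v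
  proof -
    have "C * sqrt (H1_sq v) \<le> \<bar>C\<bar> * sqrt (H1_sq v)" by (intro mult_right_mono) (auto simp: H1_sq_nonneg)
    with C[OF that] show ?thesis unfolding H1_norm_eq by linarith
  qed
  then show thesis using that[of "\<bar>C\<bar>"] by simp
qed

lemma H1_sq_le_E:
  obtains P where "P > 0" "\<And>v. v \<in> V \<Longrightarrow> H1_sq v \<le> P * E v v"
proof -
  obtain P where P: "P > 0" "\<And>v. v \<in> V \<Longrightarrow> sq_norm M v \<le> P * E v v" using Poincare by blast
  have "H1_sq v \<le> (P + 1) * E v v" if "v \<in> V" for v
    using P(2)[OF that] by (simp add: H1_sq_def algebra_simps)
  then show thesis using that[of "P + 1"] P(1) by simp
qed

text \<open>
  The small coefficient lets the quadratic part of the energy absorb the linear one, so that the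
  energy is bounded below.
\<close>

lemma Hm1_bound_E:
  assumes "u \<in> Hm1 \<Omega>"
  obtains C where "\<And>v. v \<in> V \<Longrightarrow> \<bar>u v\<bar> \<le> C + E v v / 4"
proof -
  obtain C where C: "C \<ge> 0" "\<And>v. v \<in> V \<Longrightarrow> \<bar>u v\<bar> \<le> C * sqrt (H1_sq v)"
    using Hm1_bound[OF assms] by blast
  obtain P where P: "P > 0" "\<And>v. v \<in> V \<Longrightarrow> H1_sq v \<le> P * E v v" using H1_sq_le_E by blast
  have "\<bar>u v\<bar> \<le> C\<^sup>2 * P + E v v / 4" if v: "v \<in> V" for v
  proof -
    have "\<bar>u v\<bar> \<le> C * sqrt (P * E v v)"
      using C(2)[OF v] real_sqrt_le_mono[OF P(2)[OF v]] C(1) by (meson mult_left_mono order_trans)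
    also have "\<dots> = 2 * (C * sqrt P) * (sqrt (E v v) / 2)" by (simp add: real_sqrt_mult)
    also have "\<dots> \<le> (C * sqrt P)\<^sup>2 + (sqrt (E v v) / 2)\<^sup>2" by (rule sum_squares_bound)
    also have "\<dots> = C\<^sup>2 * P + E v v / 4"
      using P(1) E_nonneg[of v] by (simp add: power_mult_distrib power_divide)
    finally show ?thesis .
  qed
  then show thesis using that by blast
qed

lemma Hm1_tendsto:
  assumes u: "u \<in> Hm1 \<Omega>" and d: "\<And>n. d n \<in> V" and lim: "(\<lambda>n. H1_sq (d n)) \<longlonglongrightarrow> 0"
  shows "(\<lambda>n. u (d n)) \<longlonglongrightarrow> 0"
proof -
  obtain C where C: "C \<ge> 0" "\<And>v. v \<in> V \<Longrightarrow> \<bar>u v\<bar> \<le> C * sqrt (H1_sq v)"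
    using Hm1_bound[OF u] by blast
  have "(\<lambda>n. C * sqrt (H1_sq (d n))) \<longlonglongrightarrow> C * sqrt 0" by (intro tendsto_intros lim)
  then have "(\<lambda>n. C * sqrt (H1_sq (d n))) \<longlonglongrightarrow> 0" by simp
  then show ?thesis
    by (rule Lim_null_comparison[rotated]) (use C(2) d in simp)
qed

lemma residual_cmult:
  assumes "u \<in> Hm1 \<Omega>" "y \<in> V" "v \<in> V"
  shows "residual u y (\<lambda>x. c * v x) = c * residual u y v"
proof -
  have "(\<integral>x. f (y x) * (c * v x) \<partial>M) = c * (\<integral>x. f (y x) * v x \<partial>M)"
    by (subst mult.left_commute) simp
  then show ?thesis
    unfolding residual_def Hm1_cmult[OF assms(1,3)] E_cmult_right[OF H10_H1[OF assms(2)] H10_H1[OF assms(3)]]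
    by (simp only: right_diff_distrib distrib_left)
qed

lemma residual_tendsto:
  assumes u: "u \<in> Hm1 \<Omega>" and y: "y \<in> V" and d: "\<And>n. d n \<in> V" and lim: "(\<lambda>n. H1_sq (d n)) \<longlonglongrightarrow> 0"
  shows "(\<lambda>n. residual u y (d n)) \<longlonglongrightarrow> 0"
proof -
  have "(\<lambda>n. E y (d n)) \<longlonglongrightarrow> 0"
  proof (rule Hm1_tendsto[OF _ d lim])
    have "\<bar>E y v\<bar> \<le> sqrt (E y y) * H1_norm \<Omega> v" if v: "v \<in> V" for v
    proof -
      have "\<bar>E y v\<bar> \<le> sqrt (E y y) * sqrt (E v v)"
        using real_sqrt_le_mono[OF E_Cauchy_Schwarz[OF H10_H1[OF y] H10_H1[OF v]]] by (simp add: real_sqrt_mult)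
      also have "\<dots> \<le> sqrt (E y y) * H1_norm \<Omega> v"
        by (intro mult_left_mono) (auto simp: H1_norm_eq H1_sq_def sq_norm_nonneg E_nonneg)
      finally show ?thesis .
    qed
    then show "E y \<in> Hm1 \<Omega>"
      unfolding Hm1_def using y by (auto simp: E_add_right E_cmult_right H10_H1)
  qed
  moreover have "(\<lambda>n. \<integral>x. f (y x) * d n x \<partial>M) \<longlonglongrightarrow> 0"
  proof -
    have "tendsto_L2 M d (\<lambda>x. 0)"
      unfolding tendsto_L2_def
      by (rule tendsto_sandwich[OF _ _ tendsto_const lim])
         (auto simp: sq_norm_nonneg H1_sq_def E_nonneg intro!: always_eventually)
    from tendsto_L2_inner[OF this H10_L2[OF d] square_integrable_zero f_L2[OF H10_L2[OF y]]]
    show ?thesis by (simp add: mult.commute)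
  qed
  ultimately have "(\<lambda>n. E y (d n) + (\<integral>x. f (y x) * d n x \<partial>M) - u (d n)) \<longlonglongrightarrow> 0 + 0 - 0"
    by (intro tendsto_intros Hm1_tendsto[OF u d lim])
  then show ?thesis by (simp add: residual_def)
qed

text \<open>
  The gradient inequality for the uniformly convex energy. The quadratic term on the right is what
  makes minimising sequences converge.
\<close>

lemma energy_diff:
  assumes u: "u \<in> Hm1 \<Omega>" and v: "v \<in> V" and w: "w \<in> V"
  shows "energy u v - energy u w \<le> residual u v (\<lambda>x. v x - w x) - grad_dist v w / 2"
proof -
  have "(\<integral>x. F (v x) \<partial>M) - (\<integral>x. F (w x) \<partial>M) = (\<integral>x. F (v x) - F (w x) \<partial>M)"
    using v w by (simp add: F_integrable H10_L2)
  also have "\<dots> \<le> (\<integral>x. f (v x) * (v x - w x) \<partial>M)"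
    using v w by (intro integral_mono Bochner_Integration.integrable_diff F_integrable square_integrable_mult
        square_integrable_diff f_L2 H10_L2 F_gradient)
  finally have "(\<integral>x. F (v x) \<partial>M) - (\<integral>x. F (w x) \<partial>M) \<le> (\<integral>x. f (v x) * (v x - w x) \<partial>M)" .
  then show ?thesis
    unfolding energy_def residual_def Hm1_diff[OF u v w] E_diff_self[OF H10_H1[OF v] H10_H1[OF w]]
      E_diff_right[OF H10_H1[OF v] H10_H1[OF v] H10_H1[OF w]]
    by (simp add: diff_divide_distrib add_divide_distrib)
qed

text \<open>
  Obstacles are arbitrary functions with extended real values, compared almost everywhere; this
  covers \<open>\<Theta> y\<close> as well as the absent obstacle \<open>\<infinity>\<close>.
\<close>

definition obstacle_solution ::
  "((real^'n \<Rightarrow> real) \<Rightarrow> real) \<Rightarrow> (real^'n \<Rightarrow> ereal) \<Rightarrow> (real^'n \<Rightarrow> real) \<Rightarrow> bool" where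
  "obstacle_solution u \<psi> y \<longleftrightarrow> y \<in> V \<and> below y \<psi> \<and>
     (\<forall>v\<in>V. below v \<psi> \<longrightarrow> 0 \<le> residual u y (\<lambda>x. v x - y x))"

lemma obstacle_solution_H10: "obstacle_solution u \<psi> y \<Longrightarrow> y \<in> V"
  and obstacle_solution_le: "obstacle_solution u \<psi> y \<Longrightarrow> below y \<psi>"
  and obstacle_solution_residual: "obstacle_solution u \<psi> y \<Longrightarrow> v \<in> V \<Longrightarrow>
    below v \<psi> \<Longrightarrow> 0 \<le> residual u y (\<lambda>x. v x - y x)"
  by (simp_all add: obstacle_solution_def)

lemma ae_le_limit:
  assumes s: "\<And>k. s k \<in> V" and v: "v \<in> V" and lim: "tendsto_H1 s v"
  shows "(\<And>k. below (s k) \<psi>) \<Longrightarrow> below v \<psi>"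
    and "(\<And>k. ae_le \<Omega> \<psi> (\<lambda>x. ereal (s k x))) \<Longrightarrow> ae_le \<Omega> \<psi> (\<lambda>x. ereal (v x))"
proof -
  obtain r where r: "strict_mono r" "AE x in M. (\<lambda>n. s (r n) x) \<longlonglongrightarrow> v x"
    by (rule tendsto_L2_AE_subseq[OF tendsto_H1_sq_imp_L2(1)[OF H10_H1[OF v] H10_H1[OF s] lim]
        H10_L2[OF s] H10_L2[OF v]])
  from r(2) have conv: "AE x in M. (\<lambda>n. ereal (s (r n) x)) \<longlonglongrightarrow> ereal (v x)"
    by eventually_elim (simp add: tendsto_ereal)
  show "below v \<psi>" if "\<And>k. below (s k) \<psi>"
  proof -
    have "AE x in M. \<forall>n. ereal (s (r n) x) \<le> \<psi> x"
      using that unfolding ae_le_def by (simp add: AE_all_countable)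
    with conv show ?thesis unfolding ae_le_def
    proof eventually_elim
      case (elim x)
      show ?case by (rule LIMSEQ_le_const2[OF elim(1)]) (use elim(2) in simp)
    qed
  qed
  show "ae_le \<Omega> \<psi> (\<lambda>x. ereal (v x))" if "\<And>k. ae_le \<Omega> \<psi> (\<lambda>x. ereal (s k x))"
  proof -
    have "AE x in M. \<forall>n. \<psi> x \<le> ereal (s (r n) x)"
      using that unfolding ae_le_def by (simp add: AE_all_countable)
    with conv show ?thesis unfolding ae_le_def
    proof eventually_elim
      case (elim x)
      show ?case by (rule LIMSEQ_le_const[OF elim(1)]) (use elim(2) in simp)
    qed
  qed
qed

text \<open>By uniform convexity a minimising sequence of the energy is a Cauchy sequence.\<close>

lemma energy_minimizer_exists:
  assumes u: "u \<in> Hm1 \<Omega>" and K: "v0 \<in> V" "below v0 \<psi>"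
  shows "\<exists>z\<in>V. below z \<psi> \<and>
    (\<forall>v\<in>V. below v \<psi> \<longrightarrow> energy u z \<le> energy u v)"
proof -
  define A where "A = {v \<in> V. below v \<psi>}"
  have A: "v0 \<in> A" using K by (simp add: A_def)
  have A_H10: "v \<in> V" if "v \<in> A" for v using that by (simp add: A_def)
  obtain C where C: "\<And>v. v \<in> V \<Longrightarrow> \<bar>u v\<bar> \<le> C + E v v / 4" using Hm1_bound_E[OF u] by blast
  have lower: "- C \<le> energy u v" if "v \<in> V" for v
  proof -
    have "0 \<le> (\<integral>x. F (v x) \<partial>M)" using F_nonneg by simp
    then show ?thesis using C[OF that] E_nonneg[of v] by (simp add: energy_def) 
  qed
  define I where "I = Inf (energy u ` A)"
  have bdd: "bdd_below (energy u ` A)" using lower A_H10 by (intro bdd_belowI2[of _ "- C"]) blast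
  have I_le: "I \<le> energy u v" if "v \<in> A" for v
    unfolding I_def using bdd that by (intro cInf_lower) auto
  have "\<exists>v\<in>A. energy u v < I + inverse (real (Suc n))" for n
  proof -
    have "Inf (energy u ` A) < I + inverse (real (Suc n))" by (simp add: I_def)
    then show ?thesis using cInf_lessD[of "energy u ` A"] A by blast
  qed
  then obtain s where s: "\<And>n. s n \<in> A" "\<And>n. energy u (s n) < I + inverse (real (Suc n))" by metis
  have Cauchy: "grad_dist v w \<le> 4 * (energy u v + energy u w - 2 * I)"
    if v: "v \<in> A" and w: "w \<in> A" for v w
  proof -
    \<comment> \<open>At the midpoint, the gradient inequalities towards \<open>v\<close> and \<open>w\<close> have opposite residual terms.\<close>
    define m where "m x = (1/2) * (v x + w x)" for x
    note H = A_H10[OF v] A_H10[OF w]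
    have mH: "m \<in> V" unfolding m_def by (intro H10_cmult H10_add H)
    have "below m \<psi>"
    proof -
      have "AE x in M. ereal (v x) \<le> \<psi> x" "AE x in M. ereal (w x) \<le> \<psi> x"
        using v w by (auto simp: A_def ae_le_def)
      then show ?thesis unfolding ae_le_def
      proof eventually_elim
        case (elim x)
        have "ereal (m x) \<le> ereal (max (v x) (w x))" by (simp add: m_def max_def)
        also have "\<dots> \<le> \<psi> x" using elim by (simp add: max_def)
        finally show ?case .
      qed
    qed
    then have "m \<in> A" using mH by (simp add: A_def)
    define d where "d x = (1/2) * (v x - w x)" for x
    have dH: "d \<in> V" unfolding d_def by (intro H10_cmult H10_diff H)
    have md: "(\<lambda>x. m x - w x) = d" "(\<lambda>x. m x - v x) = (\<lambda>x. (-1) * d x)"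
      by (auto simp: fun_eq_iff m_def d_def field_simps)
    have dd: "E (\<lambda>x. (-1) * d x) (\<lambda>x. (-1) * d x) = E d d"
      using dH H10_cmult[OF dH, of "-1"] E_cmult_left[of d _ "-1"] E_cmult_right[of d d "-1"] by (simp add: H10_H1)
    have "energy u m - energy u v \<le> - residual u m d - E d d / 2"
      using energy_diff[OF u mH H(1)] residual_cmult[OF u mH dH, of "-1"] dd unfolding md by simp
    moreover have "energy u m - energy u w \<le> residual u m d - E d d / 2"
      using energy_diff[OF u mH H(2)] unfolding md .
    ultimately have "E d d \<le> energy u v + energy u w - 2 * energy u m" by linarith
    also have "\<dots> \<le> energy u v + energy u w - 2 * I" using I_le[OF \<open>m \<in> A\<close>] by simp
    finally have "E d d \<le> energy u v + energy u w - 2 * I" .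
    moreover have "E d d = grad_dist v w / 4"
    proof -
      have h: "(\<lambda>x. v x - w x) \<in> H1 \<Omega>" by (intro H10_H1 H10_diff H)
      show ?thesis unfolding d_def
        using E_cmult_left[OF h H1_cmult[OF h], of "1/2" "1/2"] E_cmult_right[OF h h, of "1/2"] by simp
    qed
    ultimately show ?thesis by simp
  qed
  have crit: "\<exists>N. \<forall>i\<ge>N. \<forall>j\<ge>N. grad_dist (s i) (s j) < e" if e: "e > 0" for e
  proof -
    have e8: "0 < e / 8" using e by simp
    obtain N where N: "inverse (real (Suc N)) < e / 8" using reals_Archimedean[OF e8] by blast
    have small: "energy u (s i) < I + e / 8" if "i \<ge> N" for i
    proof -
      have "inverse (real (Suc i)) \<le> inverse (real (Suc N))" using that by simp
      with N s(2)[of i] show ?thesis by linarith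
    qed
    have "p < e" if "p \<le> 4 * (a + b - 2 * I)" "a < I + e / 8" "b < I + e / 8" for p a b
      using that by (simp add: field_simps)
    then have "grad_dist (s i) (s j) < e" if "i \<ge> N" "j \<ge> N" for i j
      using Cauchy[OF s(1)[of i] s(1)[of j]] small[OF that(1)] small[OF that(2)] by blast
    then show ?thesis by blast
  qed
  have "\<exists>z\<in>V. tendsto_H1 s z"
    by (rule H10_complete[OF A_H10[OF s(1)]]) (rule crit)
  then obtain z where z: "z \<in> V" "tendsto_H1 s z"
    by (elim bexE)
  have z_le: "below z \<psi>"
    by (rule ae_le_limit(1)[OF A_H10[OF s(1)] z]) (use s(1) in \<open>simp add: A_def\<close>)
  have "energy u z \<le> I"
  proof (rule LIMSEQ_le_const)
    have "(\<lambda>k. I + inverse (real (Suc k)) + residual u z (\<lambda>x. z x - s k x)) \<longlonglongrightarrow> I + 0 + 0"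
      by (intro tendsto_intros LIMSEQ_inverse_real_of_nat residual_tendsto u z H10_diff A_H10 s)
    then show "(\<lambda>k. I + inverse (real (Suc k)) + residual u z (\<lambda>x. z x - s k x)) \<longlonglongrightarrow> I" by simp
    have "energy u z \<le> I + inverse (real (Suc k)) + residual u z (\<lambda>x. z x - s k x)" for k
      using energy_diff[OF u z(1) A_H10[OF s(1)[of k]]] s(2)[of k] E_nonneg[of "\<lambda>x. z x - s k x"] by linarith
    then show "\<exists>N. \<forall>k\<ge>N. energy u z \<le> I + inverse (real (Suc k)) + residual u z (\<lambda>x. z x - s k x)" by blast
  qed
  then have "energy u z \<le> energy u v" if "v \<in> V" "below v \<psi>" for v
    using I_le[of v] that by (simp add: A_def)
  then show ?thesis using z(1) z_le by (intro bexI[of _ z]) auto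
qed

text \<open>
  Compare the minimiser \<open>z\<close> with \<open>z + t (v - z)\<close>, divide by \<open>t\<close> and let \<open>t\<close> tend to zero; the
  Lipschitz continuity of \<open>f\<close> makes the remainder \<open>t Q\<close> linear in \<open>t\<close>.
\<close>

lemma obstacle_solution_exists:
  assumes u: "u \<in> Hm1 \<Omega>" and K: "v0 \<in> V" "below v0 \<psi>"
  shows "\<exists>z. obstacle_solution u \<psi> z"
proof -
  obtain z where z: "z \<in> V" "below z \<psi>"
    and "\<forall>v\<in>V. below v \<psi> \<longrightarrow> energy u z \<le> energy u v"
    using energy_minimizer_exists[OF assms] by (elim bexE conjE)
  then have min: "energy u z \<le> energy u v" if "v \<in> V" "below v \<psi>" for v
    using that by simp
  have "0 \<le> residual u z (\<lambda>x. v x - z x)" if v: "v \<in> V" "below v \<psi>" for v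
  proof -
    define d where "d x = v x - z x" for x
    have d: "d \<in> V" unfolding d_def by (intro H10_diff v z)
    define Q where "Q = E d d + L * sq_norm M d"
    have step: "0 \<le> residual u z d + t * Q" if t: "0 < t" "t \<le> 1" for t
    proof -
      define w where "w x = z x + t * d x" for x
      have w: "w \<in> V" unfolding w_def by (intro H10_add H10_cmult z d)
      have "below w \<psi>"
        using v(2) z(2) unfolding ae_le_def
      proof eventually_elim
        case (elim x)
        have "w x = (1 - t) * z x + t * v x" by (simp add: w_def d_def algebra_simps)
        also have "\<dots> \<le> max (z x) (v x)" using t by (intro convex_bound_le) auto
        finally have "ereal (w x) \<le> ereal (max (z x) (v x))" by (simp only: ereal_less_eq)
        also have "\<dots> \<le> \<psi> x" using elim by (simp add: max_def)
        finally show ?case .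
      qed
      from min[OF w this] have "0 \<le> energy u w - energy u z" by simp
      also have "\<dots> \<le> residual u w (\<lambda>x. t * d x)"
        using energy_diff[OF u w z(1)] E_nonneg[of "\<lambda>x. t * d x"] by (simp add: w_def)
      also have "\<dots> = t * residual u w d" by (rule residual_cmult[OF u w d])
      finally have "0 \<le> residual u w d" using t by (simp add: zero_le_mult_iff)
      also have "residual u w d \<le> residual u z d + t * Q"
      proof -
        have "E w d = E z d + t * E d d"
          unfolding w_def using z d H10_cmult[OF d, of t] by (simp add: E_add_left E_cmult_left H10_H1)
        moreover have "(\<integral>x. f (w x) * d x \<partial>M) \<le> (\<integral>x. f (z x) * d x + t * (L * (d x)\<^sup>2) \<partial>M)"
        proof (rule integral_mono)
          show "integrable M (\<lambda>x. f (w x) * d x)" by (intro square_integrable_mult f_L2 H10_L2 w d)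
          show "integrable M (\<lambda>x. f (z x) * d x + t * (L * (d x)\<^sup>2))"
            by (intro Bochner_Integration.integrable_add Bochner_Integration.integrable_mult_right
                square_integrable_mult square_integrable_sq f_L2 H10_L2 z d)
          fix x
          have "(f (w x) - f (z x)) * d x \<le> \<bar>f (w x) - f (z x)\<bar> * \<bar>d x\<bar>" by (metis abs_ge_self abs_mult)
          also have "\<dots> \<le> (L * \<bar>w x - z x\<bar>) * \<bar>d x\<bar>" by (intro mult_right_mono f_diff_le) simp
          also have "\<dots> = t * (L * (d x)\<^sup>2)" using t by (simp add: w_def abs_mult power2_eq_square)
          finally show "f (w x) * d x \<le> f (z x) * d x + t * (L * (d x)\<^sup>2)" by (simp add: algebra_simps)
        qed
        moreover have "(\<integral>x. f (z x) * d x + t * (L * (d x)\<^sup>2) \<partial>M) = (\<integral>x. f (z x) * d x \<partial>M) + t * (L * sq_norm M d)"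
          using square_integrable_mult[OF f_L2[OF H10_L2[OF z(1)]] H10_L2[OF d]] square_integrable_sq[OF H10_L2[OF d]]
          by (simp add: sq_norm_def)
        ultimately show ?thesis unfolding residual_def Q_def by (simp add: algebra_simps)
      qed
      finally show ?thesis .
    qed
    have "0 \<le> residual u z d"
    proof (rule LIMSEQ_le_const)
      have "(\<lambda>n. residual u z d + inverse (real (Suc n)) * Q) \<longlonglongrightarrow> residual u z d + 0 * Q"
        by (intro tendsto_intros LIMSEQ_inverse_real_of_nat)
      then show "(\<lambda>n. residual u z d + inverse (real (Suc n)) * Q) \<longlonglongrightarrow> residual u z d" by simp
      have "0 \<le> residual u z d + inverse (real (Suc n)) * Q" for n by (rule step) (simp_all add: inverse_eq_divide)
      then show "\<exists>N. \<forall>n\<ge>N. 0 \<le> residual u z d + inverse (real (Suc n)) * Q" by blast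
    qed
    then show ?thesis by (simp add: d_def[abs_def])
  qed
  with z show ?thesis unfolding obstacle_solution_def
    by (intro exI[of _ z] conjI ballI impI) assumption+
qed

section \<open>Subsolutions and comparison\<close>

definition subsolution :: "((real^'n \<Rightarrow> real) \<Rightarrow> real) \<Rightarrow> (real^'n \<Rightarrow> real) \<Rightarrow> bool" where
  "subsolution u y \<longleftrightarrow> y \<in> V \<and> (\<forall>w\<in>V. ae_le \<Omega> (\<lambda>_. 0) w \<longrightarrow> residual u y w \<le> 0)"

text \<open>Lowering a solution keeps it below the obstacle.\<close>

lemma obstacle_solution_subsolution:
  assumes u: "u \<in> Hm1 \<Omega>" and z: "obstacle_solution u \<psi> z"
  shows "subsolution u z"
  unfolding subsolution_def
proof (intro conjI ballI impI)
  show zH: "z \<in> V" using z by (simp add: obstacle_solution_def)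
  fix w assume w: "w \<in> V" "ae_le \<Omega> (\<lambda>_. 0) w"
  have "below z \<psi>" using z by (simp add: obstacle_solution_def)
  with w(2) have "ae_le \<Omega> (\<lambda>x. ereal (z x - w x)) \<psi>"
    unfolding ae_le_def
  proof eventually_elim
    case (elim x)
    have "ereal (z x - w x) \<le> ereal (z x)" using elim by simp
    also have "\<dots> \<le> \<psi> x" using elim by simp
    finally show ?case .
  qed
  then have "0 \<le> residual u z (\<lambda>x. z x - w x - z x)"
    by (rule obstacle_solution_residual[OF z H10_diff[OF zH w(1)]])
  also have "(\<lambda>x. z x - w x - z x) = (\<lambda>x. (-1) * w x)" by (simp add: fun_eq_iff)
  also have "residual u z \<dots> = - residual u z w" using residual_cmult[OF u zH w(1), of "-1"] by simp
  finally show "residual u z w \<le> 0" by simp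
qed

text \<open>
  Adding the positive part of \<open>y - z\<close> to \<open>z\<close> stays below the obstacle. Testing both inequalities with
  it, the monotonicity of \<open>f\<close> and \<open>E_pos_part\<close> force it to vanish.
\<close>

lemma subsolution_le_obstacle_solution:
  assumes u: "u \<in> Hm1 \<Omega>" and z: "obstacle_solution u \<psi> z"
    and y: "subsolution u y" "below y \<psi>"
  shows "ae_le \<Omega> y z"
proof -
  define p where "p x = max (y x - z x) 0" for x
  have yH: "y \<in> V" and zH: "z \<in> V"
    using y z by (simp_all add: subsolution_def obstacle_solution_def)
  note dH = H10_diff[OF yH zH]
  have pH: "p \<in> V" unfolding p_def by (rule H10_pos_part(2)[OF dH])
  have "residual u y p \<le> 0"
    using y(1) pH by (simp add: subsolution_def ae_le_def p_def)
  moreover have "0 \<le> residual u z p"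
  proof -
    have "below z \<psi>" using z by (simp add: obstacle_solution_def)
    with y(2) have "ae_le \<Omega> (\<lambda>x. ereal (z x + p x)) \<psi>"
      unfolding ae_le_def by eventually_elim (simp add: p_def max_def)
    then have "0 \<le> residual u z (\<lambda>x. z x + p x - z x)"
      by (rule obstacle_solution_residual[OF z H10_add[OF zH pH]])
    then show ?thesis by simp
  qed
  moreover have "residual u y p - residual u z p =
      E (\<lambda>x. y x - z x) p + (\<integral>x. (f (y x) - f (z x)) * p x \<partial>M)"
    unfolding residual_def left_diff_distrib
    using yH zH pH square_integrable_mult[OF f_L2[OF H10_L2[OF yH]] H10_L2[OF pH]]
      square_integrable_mult[OF f_L2[OF H10_L2[OF zH]] H10_L2[OF pH]]
    by (simp add: E_diff_left H10_H1)
  moreover have "0 \<le> (\<integral>x. (f (y x) - f (z x)) * p x \<partial>M)"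
  proof (rule Bochner_Integration.integral_nonneg)
    show "0 \<le> (f (y x) - f (z x)) * p x" for x
      using monoD[OF f_mono, of "z x" "y x"] by (simp add: p_def max_def)
  qed
  moreover have "E p p \<le> E (\<lambda>x. y x - z x) p"
    unfolding p_def[abs_def] by (rule E_pos_part[OF dH])
  ultimately have "E p p \<le> 0" by linarith
  from E_eq_0_imp_AE[OF pH this] show ?thesis
    unfolding ae_le_def by eventually_elim (simp add: p_def max_def split: if_splits)
qed

lemma Hm1_plus_Hm1: "u \<in> Hm1_plus \<Omega> \<Longrightarrow> u \<in> Hm1 \<Omega>"
  by (simp add: Hm1_plus_def)

lemma subsolution_zero:
  assumes "u \<in> Hm1_plus \<Omega>" shows "subsolution u (\<lambda>x. 0)"
  unfolding subsolution_def
proof (intro conjI ballI impI H10_zero)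
  fix w assume w: "w \<in> V" "ae_le \<Omega> (\<lambda>_. 0) w"
  have "E (\<lambda>x. 0) w = 0" using E_cmult_left[of w w 0] w by (simp add: H10_H1)
  moreover have "0 \<le> u w" using assms w by (simp add: Hm1_plus_def)
  ultimately show "residual u (\<lambda>x. 0) w \<le> 0" by (simp add: residual_def f_0)
qed

text \<open>
  Testing with \<open>z - y\<close> bounds \<open>E z z - E z y\<close> by \<open>u z - u y\<close>, because \<open>f z\<close> is nonnegative; expand
  the square on the left.
\<close>

lemma subsolution_gradient_estimate:
  assumes u: "u \<in> Hm1 \<Omega>" and z: "subsolution u z" "ae_le \<Omega> (\<lambda>_. 0) z"
    and y: "y \<in> V" "ae_le \<Omega> y z"
  shows "grad_dist z y \<le> (E y y - 2 * u y) - (E z z - 2 * u z)"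
proof -
  have zH: "z \<in> V" using z by (simp add: subsolution_def)
  have "residual u z (\<lambda>x. z x - y x) \<le> 0"
    using z(1) H10_diff[OF zH y(1)] y(2) unfolding subsolution_def ae_le_def by simp
  moreover have "0 \<le> (\<integral>x. f (z x) * (z x - y x) \<partial>M)"
  proof (rule integral_nonneg_AE)
    show "AE x in M. 0 \<le> f (z x) * (z x - y x)"
      using z(2) y(2) unfolding ae_le_def by eventually_elim (simp add: f_nonneg)
  qed
  ultimately have "E z z - E z y \<le> u z - u y"
    using u zH y by (simp add: residual_def Hm1_diff E_diff_right H10_H1)
  then show ?thesis using zH y by (simp add: E_diff_self H10_H1)
qed

lemma subsolution_energy_bounds:
  assumes u: "u \<in> Hm1_plus \<Omega>"
  shows "\<exists>C. \<forall>z. subsolution u z \<longrightarrow> ae_le \<Omega> (\<lambda>_. 0) z \<longrightarrow> - C \<le> E z z - 2 * u z \<and> E z z - 2 * u z \<le> 0"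
proof -
  obtain C where C: "\<And>v. v \<in> V \<Longrightarrow> \<bar>u v\<bar> \<le> C + E v v / 4"
    using Hm1_bound_E[OF Hm1_plus_Hm1[OF u]] by blast
  have "- (2 * C) \<le> E z z - 2 * u z \<and> E z z - 2 * u z \<le> 0" if z: "subsolution u z" "ae_le \<Omega> (\<lambda>_. 0) z" for z
  proof
    have zH: "z \<in> V" using z by (simp add: subsolution_def)
    show "- (2 * C) \<le> E z z - 2 * u z" using C[OF zH] E_nonneg[of z] by linarith
    have "residual u z z \<le> 0" using z zH by (simp add: subsolution_def)
    moreover have "0 \<le> (\<integral>x. f (z x) * z x \<partial>M)"
    proof (rule integral_nonneg_AE)
      show "AE x in M. 0 \<le> f (z x) * z x"
        using z(2) unfolding ae_le_def by eventually_elim (simp add: f_nonneg)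
    qed
    moreover have "0 \<le> u z" using u z zH by (simp add: Hm1_plus_def)
    ultimately show "E z z - 2 * u z \<le> 0" by (simp add: residual_def)
  qed
  then show ?thesis by (intro exI[of _ "2 * C"] allI impI)
qed

text \<open>
  The quantity \<open>E z z - 2 u z\<close> is monotone and bounded along ordered nonnegative subsolutions, hence a
  Cauchy sequence, and its increments dominate the gradients of the differences.
\<close>

lemma monotone_subsolutions_convergent:
  assumes u: "u \<in> Hm1_plus \<Omega>" and z: "\<And>n. subsolution u (z n)" "\<And>n. ae_le \<Omega> (\<lambda>_. 0) (z n)"
    and mono: "(\<forall>m n. m \<le> n \<longrightarrow> ae_le \<Omega> (z m) (z n)) \<or> (\<forall>m n. m \<le> n \<longrightarrow> ae_le \<Omega> (z n) (z m))"
  obtains y where "y \<in> V" "tendsto_H1 z y"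
proof -
  note um = Hm1_plus_Hm1[OF u]
  have zH: "z n \<in> V" for n using z(1) by (simp add: subsolution_def)
  define a where "a n = E (z n) (z n) - 2 * u (z n)" for n
  obtain C where C': "\<forall>z. subsolution u z \<longrightarrow> ae_le \<Omega> (\<lambda>_. 0) z \<longrightarrow> - C \<le> E z z - 2 * u z \<and> E z z - 2 * u z \<le> 0"
    using subsolution_energy_bounds[OF u] by (elim exE)
  have C: "- C \<le> a n \<and> a n \<le> 0" for n
    unfolding a_def by (rule C'[rule_format, OF z])
  have est: "grad_dist (z m) (z n) \<le> \<bar>a m - a n\<bar>" for m n
  proof -
    have *: "grad_dist (z i) (z j) \<le> \<bar>a i - a j\<bar>" if "ae_le \<Omega> (z j) (z i)" for i j
      using subsolution_gradient_estimate[OF um z(1,2) zH that] unfolding a_def by linarith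
    have "ae_le \<Omega> (z m) (z n) \<or> ae_le \<Omega> (z n) (z m)"
      using mono linear[of m n] by blast
    then show ?thesis
      using *[of n m] *[of m n] E_minus_commute[OF H10_H1[OF zH[of m]] H10_H1[OF zH[of n]]]
      by (auto simp: abs_minus_commute)
  qed
  have "convergent a"
  proof -
    have dec: "a j \<le> a i" if "ae_le \<Omega> (z i) (z j)" for i j
      using subsolution_gradient_estimate[OF um z(1,2) zH that] E_nonneg[of "\<lambda>x. z j x - z i x"]
      unfolding a_def by linarith
    from mono have "incseq a \<or> decseq a"
    proof
      assume "\<forall>m n. m \<le> n \<longrightarrow> ae_le \<Omega> (z m) (z n)"
      then have "decseq a" unfolding decseq_def using dec by simp
      then show ?thesis ..
    next
      assume "\<forall>m n. m \<le> n \<longrightarrow> ae_le \<Omega> (z n) (z m)"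
      then have "incseq a" unfolding incseq_def using dec by simp
      then show ?thesis ..
    qed
    moreover have "Bseq a"
    proof (rule BseqI')
      show "norm (a n) \<le> C" for n using C[of n] by simp
    qed
    ultimately show ?thesis using Bseq_monoseq_convergent monoseq_iff by blast
  qed
  then have "Cauchy a" by (simp add: Cauchy_convergent_iff)
  have crit: "\<exists>N. \<forall>i\<ge>N. \<forall>j\<ge>N. grad_dist (z i) (z j) < e" if "e > 0" for e
  proof -
    obtain N where N: "\<forall>i\<ge>N. \<forall>j\<ge>N. \<bar>a i - a j\<bar> < e"
      using \<open>Cauchy a\<close> \<open>e > 0\<close> unfolding Cauchy_def dist_real_def by blast
    have "grad_dist (z i) (z j) < e" if "i \<ge> N" "j \<ge> N" for i j
      using N that by (intro le_less_trans[OF est]) simp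
    then show ?thesis by blast
  qed
  have "\<exists>y\<in>V. tendsto_H1 z y"
    by (rule H10_complete[OF zH]) (rule crit)
  then show thesis by (elim bexE that)
qed

end

section \<open>Extremal fixed points of monotone maps\<close>

text \<open>
  Only suprema of increasing sequences of images of \<open>S\<close> have to exist. The strictly monotone
  functional \<open>\<mu>\<close> selects a sequence whose supremum dominates all points \<open>x\<close> with \<open>R x (S x)\<close>. The
  relation is a parameter, so that its converse yields the least point dually.
\<close>

lemma greatest_post_fixed_point:
  fixes R :: "'a \<Rightarrow> 'a \<Rightarrow> bool" and \<mu> :: "'a \<Rightarrow> real"
  assumes trans: "\<And>x y z. R x y \<Longrightarrow> R y z \<Longrightarrow> R x z" and refl: "\<And>x. R x x"
    and S: "\<And>x. x \<in> P \<Longrightarrow> S x \<in> P"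
    and mono: "\<And>x y. x \<in> P \<Longrightarrow> y \<in> P \<Longrightarrow> R x y \<Longrightarrow> R (S x) (S y)"
    and j: "\<And>x y. x \<in> P \<Longrightarrow> y \<in> P \<Longrightarrow> j x y \<in> P" "\<And>x y. R x (j x y)" "\<And>x y. R y (j x y)"
      "\<And>x y z. R x z \<Longrightarrow> R y z \<Longrightarrow> R (j x y) z"
    and lub: "\<And>w. (\<forall>n::nat. w n \<in> P) \<Longrightarrow> (\<forall>m n. m \<le> n \<longrightarrow> R (S (w m)) (S (w n))) \<Longrightarrow>
      \<exists>z\<in>P. (\<forall>n. R (S (w n)) z) \<and> (\<forall>b. (\<forall>n. R (S (w n)) b) \<longrightarrow> R z b)"
    and \<mu>: "\<And>x y. x \<in> P \<Longrightarrow> y \<in> P \<Longrightarrow> R x y \<Longrightarrow> \<mu> x \<le> \<mu> y"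
      "\<And>x y. x \<in> P \<Longrightarrow> y \<in> P \<Longrightarrow> R x y \<Longrightarrow> \<mu> y \<le> \<mu> x \<Longrightarrow> R y x"
    and bound: "\<And>x. x \<in> P \<Longrightarrow> R x (S x) \<Longrightarrow> \<mu> x \<le> B"
    and start: "x0 \<in> P" "R x0 (S x0)"
  shows "\<exists>z\<in>P. R z (S z) \<and> R (S z) z \<and> (\<forall>y\<in>P. R y (S y) \<longrightarrow> R y z)"
proof -
  define Q where "Q = {x \<in> P. R x (S x)}"
  have QP: "x \<in> P" if "x \<in> Q" for x using that by (simp add: Q_def)
  have QS: "R x (S x)" if "x \<in> Q" for x using that by (simp add: Q_def)
  have jQ: "j x y \<in> Q" if x: "x \<in> Q" and y: "y \<in> Q" for x y
  proof -
    have jP: "j x y \<in> P" by (rule j(1)[OF QP[OF x] QP[OF y]])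
    have "R x (S (j x y))" by (rule trans[OF QS[OF x] mono[OF QP[OF x] jP j(2)]])
    moreover have "R y (S (j x y))" by (rule trans[OF QS[OF y] mono[OF QP[OF y] jP j(3)]])
    ultimately show ?thesis using jP j(4) by (simp add: Q_def)
  qed
  define I where "I = Sup (\<mu> ` Q)"
  have x0: "x0 \<in> Q" using start by (simp add: Q_def)
  have bdd: "bdd_above (\<mu> ` Q)" using bound QP QS by (intro bdd_aboveI2[of _ _ B]) blast
  have le_I: "\<mu> x \<le> I" if "x \<in> Q" for x unfolding I_def using bdd that by (intro cSup_upper) auto
  have "\<exists>q\<in>Q. I - inverse (real (Suc n)) < \<mu> q" for n
  proof -
    have "I - inverse (real (Suc n)) < Sup (\<mu> ` Q)" by (simp add: I_def)
    then show ?thesis using less_cSupD[of "\<mu> ` Q"] x0 by blast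
  qed
  then obtain q where q: "\<And>n. q n \<in> Q" "\<And>n. I - inverse (real (Suc n)) < \<mu> (q n)" by metis
  define w where "w = rec_nat (q 0) (\<lambda>n x. j x (q (Suc n)))"
  have w_simps: "w 0 = q 0" "w (Suc n) = j (w n) (q (Suc n))" for n by (simp_all add: w_def)
  have wQ: "w n \<in> Q" for n by (induction n) (auto simp: w_simps q jQ)
  have qw: "R (q n) (w n)" for n by (cases n) (auto simp: w_simps refl j)
  have w_mono: "R (w m) (w n)" if "m \<le> n" for m n
    using that by (induction n rule: dec_induct) (auto simp: refl w_simps intro: trans j(2))
  obtain z where z: "z \<in> P" "\<And>n. R (S (w n)) z" "\<And>b. (\<forall>n. R (S (w n)) b) \<Longrightarrow> R z b"
    using lub[of w] wQ QP mono w_mono by meson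
  have wz: "R (w n) z" for n by (rule trans[OF QS[OF wQ] z(2)])
  have "R (S (w n)) (S z)" for n by (rule mono[OF QP[OF wQ] z(1) wz])
  then have zS: "R z (S z)" using z(3) by blast
  then have zQ: "z \<in> Q" using z(1) by (simp add: Q_def)
  have "I \<le> \<mu> z"
  proof (rule LIMSEQ_le_const2)
    have "(\<lambda>n. I - inverse (real (Suc n))) \<longlonglongrightarrow> I - 0" by (intro tendsto_intros LIMSEQ_inverse_real_of_nat)
    then show "(\<lambda>n. I - inverse (real (Suc n))) \<longlonglongrightarrow> I" by simp
    have "I - inverse (real (Suc n)) \<le> \<mu> z" for n
      using q(2)[of n] \<mu>(1)[OF QP[OF q(1)] z(1) trans[OF qw wz], of n] by linarith
    then show "\<exists>N. \<forall>n\<ge>N. I - inverse (real (Suc n)) \<le> \<mu> z" by blast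
  qed
  have top: "R y z" if y: "y \<in> Q" for y
  proof -
    have jyz: "j y z \<in> Q" by (rule jQ[OF y zQ])
    have "R (j y z) z"
      using \<mu>(2)[OF z(1) QP[OF jyz] j(3)] le_I[OF jyz] \<open>I \<le> \<mu> z\<close> by simp
    then show ?thesis by (rule trans[OF j(2)])
  qed
  have "S z \<in> Q" using S[OF z(1)] mono[OF z(1) S[OF z(1)] zS] by (simp add: Q_def)
  then have "R (S z) z" by (rule top)
  with z(1) zS top show ?thesis unfolding Q_def by blast
qed

section \<open>The intervention operator\<close>

lemma lebesgue_measurable_translation:
  "(\<lambda>\<xi>. a + \<xi>) \<in> lebesgue \<rightarrow>\<^sub>M (lebesgue :: 'a::euclidean_space measure)"
proof (rule measurableI)
  fix A :: "'a set" assume "A \<in> sets lebesgue"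
  moreover have "(\<lambda>\<xi>. a + \<xi>) -` A \<inter> space lebesgue = (\<lambda>\<xi>. - a + \<xi>) ` A"
    by (auto simp: image_iff algebra_simps)
  ultimately show "(\<lambda>\<xi>. a + \<xi>) -` A \<inter> space lebesgue \<in> sets lebesgue"
    using lebesgue_sets_translation[of A "- a"] by simp
qed simp

lemma AE_lebesgue_translation:
  assumes "AE x in (lebesgue :: 'a::euclidean_space measure). P x"
  shows "AE \<xi> in lebesgue. P (a + \<xi>)"
proof -
  obtain N where N: "N \<in> null_sets lebesgue" "{x. \<not> P x} \<subseteq> N"
    using assms unfolding eventually_ae_filter by auto
  have "negligible ((+) (- a) ` N)" using N(1) by (intro negligible_translation) (simp add: negligible_iff_null_sets)
  then have "(+) (- a) ` N \<in> null_sets lebesgue" by (simp add: negligible_iff_null_sets)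
  moreover have "{\<xi>. \<not> P (a + \<xi>)} \<subseteq> (+) (- a) ` N"
  proof
    fix \<xi> assume "\<xi> \<in> {\<xi>. \<not> P (a + \<xi>)}"
    then have "a + \<xi> \<in> N" using N(2) by blast
    then have "- a + (a + \<xi>) \<in> (+) (- a) ` N" by (rule imageI)
    then show "\<xi> \<in> (+) (- a) ` N" by simp
  qed
  ultimately show ?thesis unfolding eventually_ae_filter by auto
qed

lemma ereal_le_minus_swap: "a \<le> - b \<longleftrightarrow> b \<le> - (a :: ereal)"
  by (metis ereal_minus_le_minus ereal_uminus_uminus)

lemma ess_inf_ge_iff:
  assumes "g \<in> borel_measurable N"
  shows "c \<le> ess_inf N g \<longleftrightarrow> (AE x in N. c \<le> g x)"
proof
  assume "c \<le> ess_inf N g"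
  then have "esssup N (\<lambda>x. - g x) \<le> - c" by (simp add: ess_inf_def ereal_le_minus_swap[of c])
  have "AE x in N. - g x \<le> esssup N (\<lambda>x. - g x)" by (rule esssup_AE)
  then show "AE x in N. c \<le> g x"
  proof eventually_elim
    case (elim x)
    then have "- g x \<le> - c" using \<open>esssup N (\<lambda>x. - g x) \<le> - c\<close> by (rule order_trans)
    then show ?case by simp
  qed
next
  assume "AE x in N. c \<le> g x"
  then have "AE x in N. - g x \<le> - c" by eventually_elim simp
  then have "esssup N (\<lambda>x. - g x) \<le> - c" using assms by (intro esssup_I) auto
  then show "c \<le> ess_inf N g" by (simp add: ess_inf_def ereal_le_minus_swap[of c])
qed

lemma ereal_le_by_reals:
  assumes "\<And>a. ereal a \<le> S \<Longrightarrow> ereal a \<le> T" shows "S \<le> T"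
proof (rule ccontr)
  assume "\<not> S \<le> T"
  then obtain a where "T < ereal a" "ereal a < S" using ereal_dense2[of T S] by (auto simp: not_le)
  then show False using assms[of a] by (meson leD less_imp_le)
qed

locale impulse_control = semilinear_domain \<Omega> f L for \<Omega> :: "(real^'n::finite) set" and f L +
  fixes \<kappa> :: real and c0 :: "real^'n \<Rightarrow> real"
  assumes \<kappa>_nonneg: "0 \<le> \<kappa>" and c0_measurable: "c0 \<in> borel_measurable lebesgue"
    and c0_nonneg: "AE \<xi> in lebesgue. 0 \<le> c0 \<xi>"
begin

abbreviation T where "T \<equiv> \<Theta> \<Omega> \<kappa> c0"
abbreviation solutions where "solutions \<equiv> QVI_solutions \<Omega> \<kappa> c0 f"
abbreviation max_sol where "max_sol \<equiv> max_solution \<Omega> \<kappa> c0 f"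
abbreviation shifts where "shifts x \<equiv> {\<xi>. 0 \<le> \<xi> \<and> x + \<xi> \<in> \<Omega>}"

lemma shifts_sets: "shifts x \<in> sets lebesgue"
proof -
  have "open ((\<lambda>\<xi>. x + \<xi>) -` \<Omega>)"
    by (rule open_vimage[OF open_domain]) (intro continuous_intros)
  moreover have "closed {\<xi>::real^'n. 0 \<le> \<xi>}"
    unfolding less_eq_vec_def by (intro closed_Collect_all closed_Collect_le continuous_intros)
  ultimately have "{\<xi>. 0 \<le> \<xi>} \<inter> (\<lambda>\<xi>. x + \<xi>) -` \<Omega> \<in> sets lebesgue" by (intro sets.Int) auto
  moreover have "{\<xi>. 0 \<le> \<xi>} \<inter> (\<lambda>\<xi>. x + \<xi>) -` \<Omega> = shifts x" by auto
  ultimately show ?thesis by simp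
qed

lemma AE_shifts_iff: "(AE \<xi> in lebesgue_on (shifts x). Q \<xi>) \<longleftrightarrow> (AE \<xi> in lebesgue. \<xi> \<in> shifts x \<longrightarrow> Q \<xi>)"
  using shifts_sets by (simp add: AE_restrict_space_iff)

lemma AE_shiftsI:
  assumes "AE x in M. Q x" shows "AE \<xi> in lebesgue_on (shifts x). Q (x + \<xi>)"
proof -
  have "AE y in lebesgue. y \<in> \<Omega> \<longrightarrow> Q y" using assms by (simp only: AE_M_iff)
  from AE_lebesgue_translation[OF this, of x] show ?thesis
    unfolding AE_shifts_iff by eventually_elim simp
qed

lemma AE_shifts_c0: "AE \<xi> in lebesgue_on (shifts x). 0 \<le> c0 \<xi>"
  using c0_nonneg unfolding AE_shifts_iff by eventually_elim simp

text \<open>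
  All properties of \<open>\<Theta>\<close> are read off from its real lower bounds, for which the essential infimum
  becomes an almost everywhere statement about shifts.
\<close>

lemma T_ge_iff:
  assumes y: "y \<in> borel_measurable M"
  shows "ereal a \<le> T y x \<longleftrightarrow> (AE \<xi> in lebesgue_on (shifts x). a \<le> \<kappa> + c0 \<xi> + y (x + \<xi>))"
proof -
  have "(\<lambda>z. if z \<in> \<Omega> then y z else 0) \<in> borel_measurable lebesgue"
    using y domain_sets by (rule borel_measurable_if_I)
  from measurable_compose[OF lebesgue_measurable_translation this]
  have "(\<lambda>\<xi>. if x + \<xi> \<in> \<Omega> then y (x + \<xi>) else 0) \<in> borel_measurable (lebesgue_on (shifts x))"
    by (rule measurable_restrict_space1)
  then have "(\<lambda>\<xi>. y (x + \<xi>)) \<in> borel_measurable (lebesgue_on (shifts x))"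
    by (rule measurable_lebesgue_cong[THEN iffD1, rotated]) simp
  moreover have "c0 \<in> borel_measurable (lebesgue_on (shifts x))"
    by (rule measurable_restrict_space1[OF c0_measurable])
  ultimately have "(\<lambda>\<xi>. ereal (c0 \<xi> + y (x + \<xi>))) \<in> borel_measurable (lebesgue_on (shifts x))" by measurable
  note ess = ess_inf_ge_iff[OF this]
  have "ereal a \<le> ereal \<kappa> + S \<longleftrightarrow> ereal (a - \<kappa>) \<le> S" for S
    by (cases S) (auto simp: algebra_simps)
  then have "ereal a \<le> T y x \<longleftrightarrow> (AE \<xi> in lebesgue_on (shifts x). ereal (a - \<kappa>) \<le> ereal (c0 \<xi> + y (x + \<xi>)))"
    unfolding \<Theta>_def using ess by simp
  also have "\<dots> \<longleftrightarrow> (AE \<xi> in lebesgue_on (shifts x). a \<le> \<kappa> + c0 \<xi> + y (x + \<xi>))"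
    by (intro AE_cong) (auto simp: algebra_simps)
  finally show ?thesis .
qed

lemma T_mono:
  assumes "v \<in> V" "w \<in> V" "ae_le \<Omega> v w"
  shows "T v x \<le> T w x"
proof (rule ereal_le_by_reals)
  have m: "v \<in> borel_measurable M" "w \<in> borel_measurable M"
    using assms(1,2) by (auto intro: square_integrable_measurable H10_L2)
  fix a assume "ereal a \<le> T v x"
  then have "AE \<xi> in lebesgue_on (shifts x). a \<le> \<kappa> + c0 \<xi> + v (x + \<xi>)" by (simp only: T_ge_iff[OF m(1)])
  moreover have "AE \<xi> in lebesgue_on (shifts x). v (x + \<xi>) \<le> w (x + \<xi>)"
    using assms(3) unfolding ae_le_def by (rule AE_shiftsI)
  ultimately show "ereal a \<le> T w x"
    unfolding T_ge_iff[OF m(2)] by eventually_elim simp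
qed

definition nonneg :: "(real^'n \<Rightarrow> real) set" where
  "nonneg = {y \<in> V. ae_le \<Omega> (\<lambda>_. 0) y}"

lemma nonneg_H10: "y \<in> nonneg \<Longrightarrow> y \<in> V"
  by (simp add: nonneg_def)

lemma T_nonneg:
  assumes "y \<in> nonneg" shows "0 \<le> T y x"
proof -
  have m: "y \<in> borel_measurable M" using assms by (auto intro: square_integrable_measurable H10_L2 nonneg_H10)
  have "AE \<xi> in lebesgue_on (shifts x). 0 \<le> y (x + \<xi>)"
    using assms unfolding nonneg_def ae_le_def by (intro AE_shiftsI) simp
  with AE_shifts_c0 have "ereal 0 \<le> T y x"
    unfolding T_ge_iff[OF m] by eventually_elim (simp add: \<kappa>_nonneg)
  then show ?thesis by (simp add: zero_ereal_def)
qed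

text \<open>Concavity, formulated with real lower bounds to avoid arithmetic with infinite values.\<close>

lemma T_concave:
  assumes "v \<in> V" "w \<in> V" "0 \<le> t" "t \<le> 1" "ereal a \<le> T v x" "ereal b \<le> T w x"
  shows "ereal (t * a + (1 - t) * b) \<le> T (\<lambda>x. t * v x + (1 - t) * w x) x"
proof -
  have m: "v \<in> borel_measurable M" "w \<in> borel_measurable M" "(\<lambda>x. t * v x + (1 - t) * w x) \<in> borel_measurable M"
    using assms(1,2) by (auto intro!: square_integrable_measurable H10_L2 H10_add H10_cmult)
  have "AE \<xi> in lebesgue_on (shifts x). a \<le> \<kappa> + c0 \<xi> + v (x + \<xi>)" using assms(5) by (simp only: T_ge_iff[OF m(1)])
  moreover have "AE \<xi> in lebesgue_on (shifts x). b \<le> \<kappa> + c0 \<xi> + w (x + \<xi>)" using assms(6) by (simp only: T_ge_iff[OF m(2)])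
  ultimately show ?thesis
    unfolding T_ge_iff[OF m(3)]
  proof eventually_elim
    case (elim \<xi>)
    have "t * a + (1 - t) * b \<le> t * (\<kappa> + c0 \<xi> + v (x + \<xi>)) + (1 - t) * (\<kappa> + c0 \<xi> + w (x + \<xi>))"
      using elim assms(3,4) by (intro add_mono mult_left_mono) auto
    then show ?case by (simp add: algebra_simps)
  qed
qed

section \<open>Extremal solutions\<close>

lemma ae_le_ereal [simp]: "below v (\<lambda>x. ereal (w x)) \<longleftrightarrow> ae_le \<Omega> v w"
  by (simp add: ae_le_def)

lemma ae_le_refl: "ae_le \<Omega> (v :: real^'n \<Rightarrow> 'b::order) v"
  by (simp add: ae_le_def)

lemma ae_le_trans: "ae_le \<Omega> (v :: real^'n \<Rightarrow> 'b::order) w \<Longrightarrow> ae_le \<Omega> w z \<Longrightarrow> ae_le \<Omega> v z"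
  unfolding ae_le_def by (rule AE_mp, assumption, rule AE_mp, assumption) (auto intro!: always_eventually)

lemma QVI_solutions_iff:
  "y \<in> solutions u \<longleftrightarrow> y \<in> nonneg \<and> obstacle_solution u (T y) y"
  unfolding QVI_solutions_def obstacle_solution_def nonneg_def residual_def Let_def L2_functional_def Laplacian_eq
  by auto

text \<open>
  The fixed point map of the quasi-variational inequality. Solutions of obstacle problems are unique
  only up to null sets, so one of them is chosen.
\<close>

definition S :: "((real^'n \<Rightarrow> real) \<Rightarrow> real) \<Rightarrow> (real^'n \<Rightarrow> real) \<Rightarrow> real^'n \<Rightarrow> real" where
  "S u y = (SOME z. obstacle_solution u (T y) z)"

context
  fixes u assumes u: "u \<in> Hm1_plus \<Omega>"
begin

lemma S_obstacle_solution:
  assumes "y \<in> nonneg" shows "obstacle_solution u (T y) (S u y)"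
proof -
  have "ae_le \<Omega> (\<lambda>x. ereal 0) (T y)" using T_nonneg[OF assms] by (simp add: ae_le_def zero_ereal_def)
  from obstacle_solution_exists[OF Hm1_plus_Hm1[OF u] H10_zero this] show ?thesis
    unfolding S_def by (rule someI_ex)
qed

lemma S_subsolution: "y \<in> nonneg \<Longrightarrow> subsolution u (S u y)"
  using obstacle_solution_subsolution[OF Hm1_plus_Hm1[OF u] S_obstacle_solution] .

lemma subsolution_le_S: "y \<in> nonneg \<Longrightarrow> subsolution u z \<Longrightarrow> below z (T y) \<Longrightarrow> ae_le \<Omega> z (S u y)"
  using subsolution_le_obstacle_solution[OF Hm1_plus_Hm1[OF u] S_obstacle_solution] .

lemma S_nonneg:
  assumes "y \<in> nonneg" shows "S u y \<in> nonneg"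
proof -
  have "ae_le \<Omega> (\<lambda>x. ereal 0) (T y)" using T_nonneg[OF assms] by (simp add: ae_le_def zero_ereal_def)
  from subsolution_le_S[OF assms subsolution_zero[OF u] this] show ?thesis
    using obstacle_solution_H10[OF S_obstacle_solution[OF assms]] by (simp add: nonneg_def)
qed

lemma S_mono:
  assumes "v \<in> nonneg" "w \<in> nonneg" "ae_le \<Omega> v w" shows "ae_le \<Omega> (S u v) (S u w)"
proof (rule subsolution_le_S[OF assms(2) S_subsolution[OF assms(1)]])
  have "ae_le \<Omega> (T v) (T w)"
    using T_mono[OF nonneg_H10[OF assms(1)] nonneg_H10[OF assms(2)] assms(3)] by (simp add: ae_le_def)
  with obstacle_solution_le[OF S_obstacle_solution[OF assms(1)]]
  show "below (S u v) (T w)" by (rule ae_le_trans)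
qed

text \<open>The solution of the equation without obstacle dominates all subsolutions.\<close>

lemma S_bounded: "\<exists>b\<in>nonneg. \<forall>y\<in>nonneg. ae_le \<Omega> (S u y) b"
proof -
  have "ae_le \<Omega> (\<lambda>x. ereal 0) (\<lambda>x. \<infinity>)" by (simp add: ae_le_def)
  from obstacle_solution_exists[OF Hm1_plus_Hm1[OF u] H10_zero this]
  obtain b where b: "obstacle_solution u (\<lambda>x. \<infinity>) b" by (elim exE)
  note le = subsolution_le_obstacle_solution[OF Hm1_plus_Hm1[OF u] b]
  have "ae_le \<Omega> (\<lambda>x. 0) b" by (rule le[OF subsolution_zero[OF u]]) (simp add: ae_le_def)
  then have "b \<in> nonneg" using obstacle_solution_H10[OF b] by (simp add: nonneg_def)
  moreover have "ae_le \<Omega> (S u y) b" if "y \<in> nonneg" for y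
    by (rule le[OF S_subsolution[OF that]]) (simp add: ae_le_def)
  ultimately show ?thesis by blast
qed

text \<open>
  A fixed point up to null sets suffices: \<open>\<Theta>\<close> does not see null sets, so \<open>S u z\<close> solves the obstacle
  problem for its own obstacle.
\<close>

lemma fixed_point_QVI_solution:
  assumes z: "z \<in> nonneg" "ae_le \<Omega> z (S u z)" "ae_le \<Omega> (S u z) z"
  shows "S u z \<in> solutions u"
proof -
  note H = nonneg_H10[OF z(1)] nonneg_H10[OF S_nonneg[OF z(1)]]
  have "T (S u z) = T z"
    by (rule ext, rule antisym) (use T_mono[OF H(2,1) z(3)] T_mono[OF H z(2)] in simp_all)
  then show ?thesis
    unfolding QVI_solutions_iff using S_nonneg[OF z(1)] S_obstacle_solution[OF z(1)] by simp
qed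

lemma nonneg_integrable: "y \<in> nonneg \<Longrightarrow> integrable M y"
  by (rule square_integrable_integrable[OF finite_measure_M H10_L2[OF nonneg_H10]])

lemma integral_mono_nonneg:
  assumes "v \<in> nonneg" "w \<in> nonneg" "ae_le \<Omega> v w"
  shows "(\<integral>x. v x \<partial>M) \<le> (\<integral>x. w x \<partial>M)"
  using assms by (intro integral_mono_AE nonneg_integrable) (simp_all add: ae_le_def)

text \<open>The integral is the strictly monotone functional for the fixed point argument.\<close>

lemma integral_strict_mono_nonneg:
  assumes "v \<in> nonneg" "w \<in> nonneg" "ae_le \<Omega> v w" "(\<integral>x. w x \<partial>M) \<le> (\<integral>x. v x \<partial>M)"
  shows "ae_le \<Omega> w v"
proof -
  have i: "integrable M (\<lambda>x. w x - v x)" using assms nonneg_integrable by simp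
  have nn: "AE x in M. 0 \<le> w x - v x" using assms(3) unfolding ae_le_def by eventually_elim simp
  have "(\<integral>x. w x - v x \<partial>M) \<le> 0" using assms nonneg_integrable by simp
  moreover have "0 \<le> (\<integral>x. w x - v x \<partial>M)" using nn by (rule integral_nonneg_AE)
  ultimately have "(\<integral>x. w x - v x \<partial>M) = 0" by simp
  then have "AE x in M. w x - v x = 0" using integral_nonneg_eq_0_iff_AE[OF i nn] by simp
  then show ?thesis unfolding ae_le_def by eventually_elim simp
qed

text \<open>The limit in \<open>H10 \<Omega>\<close> is the supremum or the infimum, since order bounds pass to it almost everywhere.\<close>

lemma monotone_S_limit:
  assumes w: "\<forall>n::nat. w n \<in> nonneg"
  shows "\<forall>m n. m \<le> n \<longrightarrow> ae_le \<Omega> (S u (w m)) (S u (w n)) \<Longrightarrow>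
      \<exists>z\<in>nonneg. (\<forall>n. ae_le \<Omega> (S u (w n)) z) \<and> (\<forall>b. (\<forall>n. ae_le \<Omega> (S u (w n)) b) \<longrightarrow> ae_le \<Omega> z b)"
    and "\<forall>m n. m \<le> n \<longrightarrow> ae_le \<Omega> (S u (w n)) (S u (w m)) \<Longrightarrow>
      \<exists>z\<in>nonneg. (\<forall>n. ae_le \<Omega> z (S u (w n))) \<and> (\<forall>b. (\<forall>n. ae_le \<Omega> b (S u (w n))) \<longrightarrow> ae_le \<Omega> b z)"
proof -
  define s where "s n = S u (w n)" for n
  have s: "subsolution u (s n)" "s n \<in> nonneg" for n
    using S_subsolution S_nonneg w by (simp_all add: s_def)
  have s0: "ae_le \<Omega> (\<lambda>_. 0) (s n)" and sH: "s n \<in> V" for n using s(2)[of n] by (simp_all add: nonneg_def)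
  have lim_ge: "ae_le \<Omega> b z" if z: "z \<in> V" "tendsto_H1 s z"
    and le: "\<And>n. n \<ge> N \<Longrightarrow> ae_le \<Omega> b (s n)" for b z N
  proof -
    have "(\<lambda>n. H1_sq (\<lambda>x. z x - s (n + N) x)) \<longlonglongrightarrow> 0" by (rule LIMSEQ_ignore_initial_segment[OF z(2)])
    from ae_le_limit(2)[OF sH z(1) this, of "\<lambda>x. ereal (b x)"] le show ?thesis by simp
  qed
  have lim_le: "ae_le \<Omega> z b" if z: "z \<in> V" "tendsto_H1 s z"
    and le: "\<And>n. n \<ge> N \<Longrightarrow> ae_le \<Omega> (s n) b" for b z N
  proof -
    have "(\<lambda>n. H1_sq (\<lambda>x. z x - s (n + N) x)) \<longlonglongrightarrow> 0" by (rule LIMSEQ_ignore_initial_segment[OF z(2)])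
    from ae_le_limit(1)[OF sH z(1) this, of "\<lambda>x. ereal (b x)"] le show ?thesis by simp
  qed
  show "\<exists>z\<in>nonneg. (\<forall>n. ae_le \<Omega> (S u (w n)) z) \<and> (\<forall>b. (\<forall>n. ae_le \<Omega> (S u (w n)) b) \<longrightarrow> ae_le \<Omega> z b)"
    if mono: "\<forall>m n. m \<le> n \<longrightarrow> ae_le \<Omega> (S u (w m)) (S u (w n))"
  proof -
    obtain z where z: "z \<in> V" "tendsto_H1 s z"
      by (rule monotone_subsolutions_convergent[OF u s(1) s0]) (rule disjI1, use mono in \<open>simp add: s_def\<close>)
    have "z \<in> nonneg" using z(1) lim_ge[OF z, of 0 "\<lambda>_. 0"] s0 by (simp add: nonneg_def)
    moreover have "\<forall>n. ae_le \<Omega> (s n) z"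
    proof
      fix n show "ae_le \<Omega> (s n) z" by (rule lim_ge[OF z, of n]) (use mono in \<open>simp add: s_def\<close>)
    qed
    moreover have "\<forall>b. (\<forall>n. ae_le \<Omega> (s n) b) \<longrightarrow> ae_le \<Omega> z b"
    proof (intro allI impI)
      fix b assume "\<forall>n. ae_le \<Omega> (s n) b"
      then show "ae_le \<Omega> z b" by (intro lim_le[OF z, of 0]) simp
    qed
    ultimately show ?thesis unfolding s_def by (intro bexI[of _ z] conjI)
  qed
  show "\<exists>z\<in>nonneg. (\<forall>n. ae_le \<Omega> z (S u (w n))) \<and> (\<forall>b. (\<forall>n. ae_le \<Omega> b (S u (w n))) \<longrightarrow> ae_le \<Omega> b z)"
    if mono: "\<forall>m n. m \<le> n \<longrightarrow> ae_le \<Omega> (S u (w n)) (S u (w m))"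
  proof -
    obtain z where z: "z \<in> V" "tendsto_H1 s z"
      by (rule monotone_subsolutions_convergent[OF u s(1) s0]) (rule disjI2, use mono in \<open>simp add: s_def\<close>)
    have "z \<in> nonneg" using z(1) lim_ge[OF z, of 0 "\<lambda>_. 0"] s0 by (simp add: nonneg_def)
    moreover have "\<forall>n. ae_le \<Omega> z (s n)"
    proof
      fix n show "ae_le \<Omega> z (s n)" by (rule lim_le[OF z, of n]) (use mono in \<open>simp add: s_def\<close>)
    qed
    moreover have "\<forall>b. (\<forall>n. ae_le \<Omega> b (s n)) \<longrightarrow> ae_le \<Omega> b z"
    proof (intro allI impI)
      fix b assume "\<forall>n. ae_le \<Omega> b (s n)"
      then show "ae_le \<Omega> b z" by (intro lim_ge[OF z, of 0]) simp
    qed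
    ultimately show ?thesis unfolding s_def by (intro bexI[of _ z] conjI)
  qed
qed

text \<open>
  The largest solution dominates not only the solutions but all \<open>y\<close> with \<open>y \<le> S u y\<close>, in particular
  the nonnegative subsolutions below their own obstacle.
\<close>

lemma greatest_solution:
  "\<exists>m\<in>solutions u. \<forall>y\<in>nonneg. subsolution u y \<longrightarrow> below y (T y) \<longrightarrow> ae_le \<Omega> y m"
proof -
  obtain b where b: "b \<in> nonneg" "\<forall>y\<in>nonneg. ae_le \<Omega> (S u y) b" using S_bounded by (elim bexE)
  have zero: "(\<lambda>x. 0) \<in> nonneg" using H10_zero by (simp add: nonneg_def ae_le_refl)
  have "\<exists>z\<in>nonneg. ae_le \<Omega> z (S u z) \<and> ae_le \<Omega> (S u z) z \<and> (\<forall>y\<in>nonneg. ae_le \<Omega> y (S u y) \<longrightarrow> ae_le \<Omega> y z)"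
  proof (rule greatest_post_fixed_point[where j = "\<lambda>v w x. max (v x) (w x)" and \<mu> = "\<lambda>y. \<integral>x. y x \<partial>M"
        and B = "\<integral>x. b x \<partial>M"])
    fix v w :: "real^'n \<Rightarrow> real" assume vw: "v \<in> nonneg" "w \<in> nonneg"
    have "ae_le \<Omega> (\<lambda>_. 0) (\<lambda>x. max (v x) (w x))"
      using vw unfolding nonneg_def ae_le_def by auto
    then show "(\<lambda>x. max (v x) (w x)) \<in> nonneg" using vw H10_max by (simp add: nonneg_def)
  next
    fix v w z :: "real^'n \<Rightarrow> real" assume "ae_le \<Omega> v z" "ae_le \<Omega> w z"
    then show "ae_le \<Omega> (\<lambda>x. max (v x) (w x)) z" unfolding ae_le_def by eventually_elim simp
  next
    fix y assume y: "y \<in> nonneg" "ae_le \<Omega> y (S u y)"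
    have "ae_le \<Omega> y b" using y(2) b(2)[rule_format, OF y(1)] by (rule ae_le_trans)
    then show "(\<integral>x. y x \<partial>M) \<le> (\<integral>x. b x \<partial>M)" by (rule integral_mono_nonneg[OF y(1) b(1)])
  next
    show "ae_le \<Omega> (\<lambda>x. 0) (S u (\<lambda>x. 0))" using S_nonneg[OF zero] by (simp add: nonneg_def)
  next
    fix v w :: "real^'n \<Rightarrow> real"
    show "ae_le \<Omega> v (\<lambda>x. max (v x) (w x))" "ae_le \<Omega> w (\<lambda>x. max (v x) (w x))"
      by (simp_all add: ae_le_def)
  qed (fact ae_le_trans ae_le_refl S_nonneg S_mono monotone_S_limit(1) integral_mono_nonneg
      integral_strict_mono_nonneg zero)+
  then obtain z where z: "z \<in> nonneg" "ae_le \<Omega> z (S u z)" "ae_le \<Omega> (S u z) z"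
    and top: "\<forall>y\<in>nonneg. ae_le \<Omega> y (S u y) \<longrightarrow> ae_le \<Omega> y z" by (elim bexE conjE)
  show ?thesis
  proof (intro bexI[of _ "S u z"] ballI impI fixed_point_QVI_solution z)
    fix y assume y: "y \<in> nonneg" "subsolution u y" "below y (T y)"
    have "ae_le \<Omega> y z" using top y(1) subsolution_le_S[OF y] by simp
    then show "ae_le \<Omega> y (S u z)" using z(2) by (rule ae_le_trans)
  qed
qed

text \<open>The dual argument starts from the solution without obstacle and uses minima and the reversed order.\<close>

lemma least_solution: "\<exists>m\<in>solutions u. \<forall>y\<in>solutions u. ae_le \<Omega> m y"
proof -
  obtain b where b: "b \<in> nonneg" "\<forall>y\<in>nonneg. ae_le \<Omega> (S u y) b" using S_bounded by (elim bexE)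
  have "\<exists>z\<in>nonneg. ae_le \<Omega> (S u z) z \<and> ae_le \<Omega> z (S u z) \<and> (\<forall>y\<in>nonneg. ae_le \<Omega> (S u y) y \<longrightarrow> ae_le \<Omega> z y)"
  proof (rule greatest_post_fixed_point[where R = "\<lambda>v w. ae_le \<Omega> w v" and j = "\<lambda>v w x. min (v x) (w x)"
        and \<mu> = "\<lambda>y. - (\<integral>x. y x \<partial>M)" and B = 0])
    fix v w :: "real^'n \<Rightarrow> real" assume vw: "v \<in> nonneg" "w \<in> nonneg"
    have "ae_le \<Omega> (\<lambda>_. 0) (\<lambda>x. min (v x) (w x))"
      using vw unfolding nonneg_def ae_le_def by auto
    then show "(\<lambda>x. min (v x) (w x)) \<in> nonneg" using vw H10_min by (simp add: nonneg_def)
  next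
    fix v w z :: "real^'n \<Rightarrow> real" assume "ae_le \<Omega> z v" "ae_le \<Omega> z w"
    then show "ae_le \<Omega> z (\<lambda>x. min (v x) (w x))" unfolding ae_le_def by eventually_elim simp
  next
    fix y assume "y \<in> nonneg"
    then have "AE x in M. 0 \<le> y x" by (simp add: nonneg_def ae_le_def)
    then have "0 \<le> (\<integral>x. y x \<partial>M)" by (rule integral_nonneg_AE)
    then show "- (\<integral>x. y x \<partial>M) \<le> 0" by simp
  next
    fix v w :: "real^'n \<Rightarrow> real"
    show "ae_le \<Omega> (\<lambda>x. min (v x) (w x)) v" "ae_le \<Omega> (\<lambda>x. min (v x) (w x)) w"
      by (simp_all add: ae_le_def)
  next
    fix v w assume "v \<in> nonneg" "w \<in> nonneg" "ae_le \<Omega> w v"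
    then show "- (\<integral>x. v x \<partial>M) \<le> - (\<integral>x. w x \<partial>M)" using integral_mono_nonneg by simp
  next
    fix v w assume "v \<in> nonneg" "w \<in> nonneg" "ae_le \<Omega> w v" "- (\<integral>x. w x \<partial>M) \<le> - (\<integral>x. v x \<partial>M)"
    then show "ae_le \<Omega> v w" using integral_strict_mono_nonneg[of w v] by simp
  next
    show "ae_le \<Omega> (S u b) b" using b by simp
  next
    fix v w z :: "real^'n \<Rightarrow> real" assume "ae_le \<Omega> w v" "ae_le \<Omega> z w"
    then show "ae_le \<Omega> z v" using ae_le_trans by blast
  next
    fix v w :: "real^'n \<Rightarrow> real" assume "v \<in> nonneg" "w \<in> nonneg" "ae_le \<Omega> w v"
    then show "ae_le \<Omega> (S u w) (S u v)" using S_mono by blast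
  qed (fact ae_le_refl S_nonneg monotone_S_limit(2) b)+
  then obtain z where z: "z \<in> nonneg" "ae_le \<Omega> (S u z) z" "ae_le \<Omega> z (S u z)"
    and least: "\<forall>y\<in>nonneg. ae_le \<Omega> (S u y) y \<longrightarrow> ae_le \<Omega> z y" by (elim bexE conjE)
  show ?thesis
  proof (intro bexI[of _ "S u z"] ballI fixed_point_QVI_solution z)
    fix y assume "y \<in> solutions u"
    then have y: "y \<in> nonneg" "obstacle_solution u (T y) y" by (simp_all add: QVI_solutions_iff)
    have "ae_le \<Omega> (S u y) y"
      by (rule subsolution_le_obstacle_solution[OF Hm1_plus_Hm1[OF u] y(2) S_subsolution[OF y(1)]
            obstacle_solution_le[OF S_obstacle_solution[OF y(1)]]])
    then have "ae_le \<Omega> z y" using least y(1) by simp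
    with z(2) show "ae_le \<Omega> (S u z) y" by (rule ae_le_trans)
  qed
qed

lemma QVI_solutionD:
  assumes "y \<in> solutions u"
  shows "y \<in> nonneg" "subsolution u y" "below y (T y)"
proof -
  have y: "y \<in> nonneg" "obstacle_solution u (T y) y" using assms by (simp_all add: QVI_solutions_iff)
  show "y \<in> nonneg" by (rule y(1))
  show "subsolution u y" by (rule obstacle_solution_subsolution[OF Hm1_plus_Hm1[OF u] y(2)])
  show "below y (T y)" by (rule obstacle_solution_le[OF y(2)])
qed

lemma min_solution_smallest: "ae_smallest \<Omega> (solutions u) (min_solution \<Omega> \<kappa> c0 f u)"
proof -
  have "\<exists>y. ae_smallest \<Omega> (solutions u) y"
    using least_solution unfolding ae_smallest_def by blast
  then show ?thesis unfolding min_solution_def by (rule someI_ex)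
qed

lemma max_solution_largest: "ae_largest \<Omega> (solutions u) (max_sol u)"
proof -
  obtain m where m: "m \<in> solutions u"
    "\<forall>y\<in>nonneg. subsolution u y \<longrightarrow> below y (T y) \<longrightarrow> ae_le \<Omega> y m"
    using greatest_solution by (elim bexE)
  have "ae_le \<Omega> y m" if "y \<in> solutions u" for y
    using m(2) QVI_solutionD[OF that] by simp
  with m(1) have "ae_largest \<Omega> (solutions u) m" by (simp add: ae_largest_def)
  then show ?thesis unfolding max_solution_def by (rule someI[of "ae_largest \<Omega> (solutions u)"])
qed

lemma subsolution_le_max_solution:
  assumes y: "y \<in> nonneg" "subsolution u y" "below y (T y)"
  shows "ae_le \<Omega> y (max_sol u)"
proof -
  obtain m where m: "m \<in> solutions u"
    "\<forall>y\<in>nonneg. subsolution u y \<longrightarrow> below y (T y) \<longrightarrow> ae_le \<Omega> y m"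
    using greatest_solution by (elim bexE)
  have "ae_le \<Omega> y m" using m(2) y by simp
  moreover have "ae_le \<Omega> m (max_sol u)"
    using max_solution_largest m(1) by (simp add: ae_largest_def)
  ultimately show ?thesis by (rule ae_le_trans)
qed

lemma max_solution_QVI: "max_sol u \<in> solutions u"
  using max_solution_largest by (simp add: ae_largest_def)

end

end

section \<open>Concavity and directional differentiability of the largest solution\<close>

text \<open>
  The sequence \<open>\<tau>\<close> is compared with the reference sequence \<open>\<sigma>\<close> only, since the monotonicity of
  difference quotients is available for countably many step sizes at a time.
\<close>

lemma antimono_quotient_limit:
  fixes q :: "real \<Rightarrow> real" and \<sigma> \<tau> :: "nat \<Rightarrow> real"
  assumes pos: "\<And>m. 0 < \<sigma> m" "\<And>n. 0 < \<tau> n" and lim: "\<sigma> \<longlonglongrightarrow> 0" "\<tau> \<longlonglongrightarrow> 0"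
    and le: "\<And>m n. \<sigma> m \<le> \<tau> n \<Longrightarrow> q (\<tau> n) \<le> q (\<sigma> m)" "\<And>m n. \<tau> n \<le> \<sigma> m \<Longrightarrow> q (\<sigma> m) \<le> q (\<tau> n)"
  shows "(\<lambda>n. ereal (q (\<tau> n))) \<longlonglongrightarrow> (SUP m. ereal (q (\<sigma> m)))"
proof (rule order_tendstoI)
  fix a assume "a < (SUP m. ereal (q (\<sigma> m)))"
  then obtain m where m: "a < ereal (q (\<sigma> m))" by (auto simp: less_SUP_iff)
  have "\<forall>\<^sub>F n in sequentially. \<tau> n < \<sigma> m" using order_tendstoD(2)[OF lim(2) pos(1)] .
  then show "\<forall>\<^sub>F n in sequentially. a < ereal (q (\<tau> n))"
  proof eventually_elim
    case (elim n)
    then have "ereal (q (\<sigma> m)) \<le> ereal (q (\<tau> n))" using le(2) by simp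
    with m show ?case by (rule less_le_trans)
  qed
next
  fix b assume b: "(SUP m. ereal (q (\<sigma> m))) < b"
  have "ereal (q (\<tau> n)) < b" for n
  proof -
    have "\<forall>\<^sub>F m in sequentially. \<sigma> m < \<tau> n" using order_tendstoD(2)[OF lim(1) pos(2)] .
    then obtain m where "\<sigma> m < \<tau> n" by (metis eventually_happens' sequentially_bot)
    then have "ereal (q (\<tau> n)) \<le> ereal (q (\<sigma> m))" using le(1) by simp
    also have "\<dots> \<le> (SUP m. ereal (q (\<sigma> m)))" by (rule SUP_upper) simp
    finally show ?thesis using b by (rule le_less_trans)
  qed
  then show "\<forall>\<^sub>F n in sequentially. ereal (q (\<tau> n)) < b" by simp
qed

context impulse_control
begin

lemma Hm1_combination:
  assumes "u \<in> Hm1 \<Omega>" "v \<in> Hm1 \<Omega>" shows "(\<lambda>w. s * u w + t * v w) \<in> Hm1 \<Omega>"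
proof -
  obtain C where C: "\<And>w. w \<in> V \<Longrightarrow> \<bar>u w\<bar> \<le> C * H1_norm \<Omega> w" using assms(1) unfolding Hm1_def by blast
  obtain C' where C': "\<And>w. w \<in> V \<Longrightarrow> \<bar>v w\<bar> \<le> C' * H1_norm \<Omega> w" using assms(2) unfolding Hm1_def by blast
  have "\<bar>s * u w + t * v w\<bar> \<le> (\<bar>s\<bar> * C + \<bar>t\<bar> * C') * H1_norm \<Omega> w" if w: "w \<in> V" for w
  proof -
    have "\<bar>s * u w + t * v w\<bar> \<le> \<bar>s\<bar> * \<bar>u w\<bar> + \<bar>t\<bar> * \<bar>v w\<bar>" by (metis abs_mult abs_triangle_ineq)
    also have "\<dots> \<le> \<bar>s\<bar> * (C * H1_norm \<Omega> w) + \<bar>t\<bar> * (C' * H1_norm \<Omega> w)"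
      by (intro add_mono mult_left_mono C C' w) auto
    finally show ?thesis by (simp add: algebra_simps)
  qed
  then have "\<exists>K. \<forall>w\<in>V. \<bar>s * u w + t * v w\<bar> \<le> K * H1_norm \<Omega> w" by (intro exI ballI)
  then show ?thesis
    unfolding Hm1_def using assms
    by (simp add: Hm1_add Hm1_cmult distrib_left mult.left_commute)
qed

lemma Hm1_plus_convex:
  assumes "u \<in> Hm1_plus \<Omega>" "v \<in> Hm1_plus \<Omega>" "0 \<le> t" "t \<le> 1"
  shows "(\<lambda>w. t * u w + (1 - t) * v w) \<in> Hm1_plus \<Omega>"
  using assms Hm1_combination[of u v t "1 - t"] unfolding Hm1_plus_def by simp

text \<open>The convexity of \<open>f\<close> may be used because the test functions are nonnegative.\<close>

lemma subsolution_convex_combination: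
  assumes f: "convex_on UNIV f" and u: "u \<in> Hm1 \<Omega>" "v \<in> Hm1 \<Omega>"
    and y: "subsolution u y" and z: "subsolution v z" and t: "0 \<le> t" "t \<le> 1"
  shows "subsolution (\<lambda>w. t * u w + (1 - t) * v w) (\<lambda>x. t * y x + (1 - t) * z x)"
  unfolding subsolution_def
proof (intro conjI ballI impI)
  have yH: "y \<in> V" and zH: "z \<in> V" using y z by (simp_all add: subsolution_def)
  show mH: "(\<lambda>x. t * y x + (1 - t) * z x) \<in> V" by (intro H10_add H10_cmult yH zH)
  fix w assume w: "w \<in> V" "ae_le \<Omega> (\<lambda>_. 0) w"
  have i: "integrable M (\<lambda>x. f (g x) * w x)" if "g \<in> V" for g
    by (intro square_integrable_mult f_L2 H10_L2 that w)
  have "E (\<lambda>x. t * y x + (1 - t) * z x) w = t * E y w + (1 - t) * E z w"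
    using H10_cmult[OF yH, of t] H10_cmult[OF zH, of "1 - t"] yH zH w(1)
    by (simp add: E_add_left E_cmult_left H10_H1)
  moreover have "(\<integral>x. f (t * y x + (1 - t) * z x) * w x \<partial>M) \<le>
      (\<integral>x. t * (f (y x) * w x) + (1 - t) * (f (z x) * w x) \<partial>M)"
  proof (rule integral_mono_AE)
    show "AE x in M. f (t * y x + (1 - t) * z x) * w x \<le> t * (f (y x) * w x) + (1 - t) * (f (z x) * w x)"
      using w(2) unfolding ae_le_def
    proof eventually_elim
      case (elim x)
      have "f (t * y x + (1 - t) * z x) \<le> t * f (y x) + (1 - t) * f (z x)"
        using convex_onD[OF f, of "1 - t" "y x" "z x"] t by simp
      then have "f (t * y x + (1 - t) * z x) * w x \<le> (t * f (y x) + (1 - t) * f (z x)) * w x"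
        using elim by (rule mult_right_mono)
      then show ?case by (simp add: algebra_simps)
    qed
  qed (intro i mH yH zH Bochner_Integration.integrable_add integrable_mult_right)+
  moreover have "(\<integral>x. t * (f (y x) * w x) + (1 - t) * (f (z x) * w x) \<partial>M) =
      t * (\<integral>x. f (y x) * w x \<partial>M) + (1 - t) * (\<integral>x. f (z x) * w x \<partial>M)"
    using i[OF yH] i[OF zH] by simp
  ultimately have "residual (\<lambda>w. t * u w + (1 - t) * v w) (\<lambda>x. t * y x + (1 - t) * z x) w
      \<le> t * residual u y w + (1 - t) * residual v z w"
    unfolding residual_def by (simp add: algebra_simps)
  also have "\<dots> \<le> 0"
  proof -
    have "residual u y w \<le> 0" "residual v z w \<le> 0" using y z w by (simp_all add: subsolution_def)
    then have "t * residual u y w \<le> 0" "(1 - t) * residual v z w \<le> 0"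
      using t by (simp_all add: mult_nonneg_nonpos)
    then show ?thesis by simp
  qed
  finally show "residual (\<lambda>w. t * u w + (1 - t) * v w) (\<lambda>x. t * y x + (1 - t) * z x) w \<le> 0" .
qed

text \<open>
  The convex combination of the two largest solutions is a nonnegative subsolution below its own
  obstacle for the combined data.
\<close>

lemma max_solution_concave:
  assumes f: "convex_on UNIV f" and u: "u \<in> Hm1_plus \<Omega>" and v: "v \<in> Hm1_plus \<Omega>" and t: "0 \<le> t" "t \<le> 1"
  shows "ae_le \<Omega> (\<lambda>x. t * max_sol u x + (1 - t) * max_sol v x)
    (max_sol (\<lambda>w. t * u w + (1 - t) * v w))"
proof (rule subsolution_le_max_solution[OF Hm1_plus_convex[OF u v t]])
  define y z where "y = max_sol u" and "z = max_sol v"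
  have y: "y \<in> nonneg" "subsolution u y" "below y (T y)"
    unfolding y_def using QVI_solutionD[OF u max_solution_QVI[OF u]] .
  have z: "z \<in> nonneg" "subsolution v z" "below z (T z)"
    unfolding z_def using QVI_solutionD[OF v max_solution_QVI[OF v]] .
  note yH = nonneg_H10[OF y(1)] and zH = nonneg_H10[OF z(1)]
  have "ae_le \<Omega> (\<lambda>_. 0) (\<lambda>x. t * y x + (1 - t) * z x)"
  proof -
    have "AE x in M. 0 \<le> y x" "AE x in M. 0 \<le> z x" using y(1) z(1) by (simp_all add: nonneg_def ae_le_def)
    then show ?thesis unfolding ae_le_def by eventually_elim (simp add: t)
  qed
  then show "(\<lambda>x. t * max_sol u x + (1 - t) * max_sol v x) \<in> nonneg"
    using H10_add[OF H10_cmult[OF yH] H10_cmult[OF zH]] by (simp add: nonneg_def y_def z_def)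
  show "subsolution (\<lambda>w. t * u w + (1 - t) * v w)
      (\<lambda>x. t * max_sol u x + (1 - t) * max_sol v x)"
    using subsolution_convex_combination[OF f Hm1_plus_Hm1[OF u] Hm1_plus_Hm1[OF v] y(2) z(2) t]
    by (simp add: y_def z_def)
  have "ae_le \<Omega> (\<lambda>x. ereal (t * y x + (1 - t) * z x)) (T (\<lambda>x. t * y x + (1 - t) * z x))"
    using y(3) z(3) unfolding ae_le_def
  proof eventually_elim
    case (elim x)
    then show ?case by (intro T_concave yH zH t)
  qed
  then show "ae_le \<Omega> (\<lambda>x. ereal (t * max_sol u x + (1 - t) * max_sol v x))
      (T (\<lambda>x. t * max_sol u x + (1 - t) * max_sol v x))"
    by (simp add: y_def z_def)
qed

text \<open>
  Concavity between \<open>u\<close> and \<open>u + t h\<close> says that the quotient for a smaller step \<open>s\<close> is at least that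
  for \<open>t\<close>, outside a null set that depends on \<open>s\<close> and \<open>t\<close>. The derivative is the supremum over the
  reference steps \<open>\<sigma>\<close>; uniqueness follows by evaluating both derivatives along \<open>\<sigma>\<close>.
\<close>

lemma max_solution_directional_derivative:
  assumes f: "convex_on UNIV f" and u: "u \<in> Hm1_plus \<Omega>" and \<tau>0: "\<tau>0 > 0"
    and uh: "(\<lambda>v. u v + \<tau>0 * h v) \<in> Hm1_plus \<Omega>"
  shows "\<exists>D\<in>L0_ext \<Omega>. is_dir_deriv \<Omega> (max_sol) \<tau>0 u h D \<and>
    (\<forall>D'\<in>L0_ext \<Omega>. is_dir_deriv \<Omega> (max_sol) \<tau>0 u h D' \<longrightarrow> ae_eq \<Omega> D' D)"
proof -
  define m where "m s = max_sol (\<lambda>v. u v + s * h v)" for s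
  define q where "q x s = (m s x - max_sol u x) / s" for s x
  have plus: "(\<lambda>v. u v + s * h v) \<in> Hm1_plus \<Omega>" if "0 < s" "s < \<tau>0" for s
  proof -
    have "(\<lambda>v. (s / \<tau>0) * (u v + \<tau>0 * h v) + (1 - s / \<tau>0) * u v) \<in> Hm1_plus \<Omega>"
      using that \<tau>0 by (intro Hm1_plus_convex uh u) auto
    moreover have "(\<lambda>v. (s / \<tau>0) * (u v + \<tau>0 * h v) + (1 - s / \<tau>0) * u v) = (\<lambda>v. u v + s * h v)"
      using \<tau>0 by (auto simp: fun_eq_iff field_simps)
    ultimately show ?thesis by simp
  qed
  have q_mono: "AE x in M. q x t \<le> q x s" if s: "0 < s" "s \<le> t" and t: "t < \<tau>0" for s t
  proof -
    have t0: "0 < t" using s by simp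
    have eq: "(\<lambda>v. (s / t) * (u v + t * h v) + (1 - s / t) * u v) = (\<lambda>v. u v + s * h v)"
      using t0 by (auto simp: fun_eq_iff field_simps)
    have "ae_le \<Omega> (\<lambda>x. (s / t) * m t x + (1 - s / t) * max_sol u x) (m s)"
      using max_solution_concave[OF f plus[OF t0 t] u, of "s / t"] s t0 unfolding eq m_def by simp
    then show ?thesis
      unfolding ae_le_def
    proof eventually_elim
      case (elim x)
      then have "(s / t) * (m t x - max_sol u x) \<le> m s x - max_sol u x"
        by (simp add: algebra_simps)
      then have "((s / t) * (m t x - max_sol u x)) / s \<le> q x s"
        unfolding q_def using s(1) by (intro divide_right_mono) auto
      then show ?case using s t0 by (simp add: q_def)
    qed
  qed
  define \<sigma> where "\<sigma> k = \<tau>0 / 2 * inverse (real (Suc k))" for k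
  have \<sigma>: "0 < \<sigma> k" "\<sigma> k < \<tau>0" for k
  proof -
    show "0 < \<sigma> k" using \<tau>0 by (simp add: \<sigma>_def)
    have "\<sigma> k \<le> \<tau>0 / 2 * 1" unfolding \<sigma>_def using \<tau>0 by (intro mult_left_mono) (auto simp: inverse_le_1_iff)
    then show "\<sigma> k < \<tau>0" using \<tau>0 by simp
  qed
  have \<sigma>0: "\<sigma> \<longlonglongrightarrow> 0"
    unfolding \<sigma>_def using tendsto_mult_right_zero[OF LIMSEQ_inverse_real_of_nat] by simp
  define D where "D x = (SUP k. ereal (q x (\<sigma> k)))" for x
  have meas: "max_sol v \<in> borel_measurable M" if "v \<in> Hm1_plus \<Omega>" for v
    using QVI_solutionD(1)[OF that max_solution_QVI[OF that]]
    by (intro square_integrable_measurable H10_L2 nonneg_H10)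
  have "D \<in> L0_ext \<Omega>"
    unfolding L0_ext_def
  proof (intro CollectI conjI)
    have "(\<lambda>x. q x (\<sigma> k)) \<in> borel_measurable M" for k
      unfolding q_def m_def using meas[OF plus[OF \<sigma>]] meas[OF u] by measurable
    then show "D \<in> borel_measurable M" unfolding D_def[abs_def] by measurable
    have "D x \<noteq> - \<infinity>" for x
    proof -
      have "ereal (q x (\<sigma> 0)) \<le> D x" unfolding D_def by (rule SUP_upper) simp
      then show ?thesis by auto
    qed
    then show "AE x in M. D x \<noteq> - \<infinity>" by simp
  qed
  moreover have dd: "is_dir_deriv \<Omega> (max_sol) \<tau>0 u h D"
    unfolding is_dir_deriv_def
  proof (intro allI impI)
    fix \<tau> :: "nat \<Rightarrow> real" assume "(\<forall>n. 0 < \<tau> n \<and> \<tau> n < \<tau>0) \<and> \<tau> \<longlonglongrightarrow> 0"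
    then have \<tau>: "\<And>n. 0 < \<tau> n" "\<And>n. \<tau> n < \<tau>0" "\<tau> \<longlonglongrightarrow> 0" by simp_all
    have "AE x in M. \<forall>k n. \<sigma> k \<le> \<tau> n \<longrightarrow> q x (\<tau> n) \<le> q x (\<sigma> k)"
      unfolding AE_all_countable using q_mono[OF \<sigma>(1) _ \<tau>(2)] by auto
    moreover have "AE x in M. \<forall>k n. \<tau> n \<le> \<sigma> k \<longrightarrow> q x (\<sigma> k) \<le> q x (\<tau> n)"
      unfolding AE_all_countable using q_mono[OF \<tau>(1) _ \<sigma>(2)] by auto
    ultimately have "AE x in M. (\<lambda>n. ereal (q x (\<tau> n))) \<longlonglongrightarrow> D x"
    proof eventually_elim
      case (elim x)
      show ?case
        unfolding D_def using elim by (intro antimono_quotient_limit \<sigma>(1) \<tau>(1) \<sigma>0 \<tau>(3)) auto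
    qed
    then show "AE x in M. (\<lambda>n. ereal ((max_sol (\<lambda>v. u v + \<tau> n * h v) x -
        max_sol u x) / \<tau> n)) \<longlonglongrightarrow> D x"
      by (simp add: q_def m_def)
  qed
  moreover have "ae_eq \<Omega> D' D" if "is_dir_deriv \<Omega> (max_sol) \<tau>0 u h D'" for D'
  proof -
    have lim: "AE x in M. (\<lambda>n. ereal (q x (\<sigma> n))) \<longlonglongrightarrow> G x"
      if "is_dir_deriv \<Omega> (max_sol) \<tau>0 u h G" for G
      using that[unfolded is_dir_deriv_def, rule_format, of \<sigma>] \<sigma> \<sigma>0 by (simp add: q_def m_def)
    from lim[OF that] lim[OF dd] show ?thesis
      unfolding ae_eq_def by eventually_elim (rule LIMSEQ_unique)
  qed
  ultimately show ?thesis by blast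
qed

end

theorem theorem6p5:
  fixes \<Omega> :: "(real^'n::finite) set"
    and \<kappa> :: real
    and c0 :: "real^'n \<Rightarrow> real"
    and f :: "real \<Rightarrow> real"
  assumes "bounded \<Omega>" and "open \<Omega>" and "\<Omega> \<noteq> {}"
    and "\<kappa> \<ge> 0"
    and "c0 \<in> borel_measurable lebesgue" and "AE \<xi> in lebesgue. 0 \<le> c0 \<xi>"
    and "mono f" and "\<exists>L. L-lipschitz_on UNIV f" and "convex_on UNIV f" and "f 0 = 0"
  shows
    "(\<forall>u\<in>Hm1_plus \<Omega>.
        QVI_solutions \<Omega> \<kappa> c0 f u \<noteq> {} \<and>
        ae_smallest \<Omega> (QVI_solutions \<Omega> \<kappa> c0 f u) (min_solution \<Omega> \<kappa> c0 f u) \<and>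
        (\<forall>y. ae_smallest \<Omega> (QVI_solutions \<Omega> \<kappa> c0 f u) y \<longrightarrow> ae_eq \<Omega> y (min_solution \<Omega> \<kappa> c0 f u)) \<and>
        ae_largest \<Omega> (QVI_solutions \<Omega> \<kappa> c0 f u) (max_solution \<Omega> \<kappa> c0 f u) \<and>
        (\<forall>y. ae_largest \<Omega> (QVI_solutions \<Omega> \<kappa> c0 f u) y \<longrightarrow> ae_eq \<Omega> y (max_solution \<Omega> \<kappa> c0 f u)))
     \<and>
     (\<forall>u1\<in>Hm1_plus \<Omega>. \<forall>u2\<in>Hm1_plus \<Omega>. \<forall>t\<in>{0..1::real}.
        ae_le \<Omega>
          (\<lambda>x. t * max_solution \<Omega> \<kappa> c0 f u1 x + (1 - t) * max_solution \<Omega> \<kappa> c0 f u2 x)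
          (max_solution \<Omega> \<kappa> c0 f (\<lambda>v. t * u1 v + (1 - t) * u2 v)))
     \<and>
     (\<forall>u\<in>Hm1_plus \<Omega>. \<forall>h\<in>Hm1 \<Omega>. \<forall>\<tau>0>0. (\<lambda>v. u v + \<tau>0 * h v) \<in> Hm1_plus \<Omega> \<longrightarrow>
        (\<exists>D\<in>L0_ext \<Omega>. is_dir_deriv \<Omega> (max_solution \<Omega> \<kappa> c0 f) \<tau>0 u h D \<and>
           (\<forall>D'\<in>L0_ext \<Omega>. is_dir_deriv \<Omega> (max_solution \<Omega> \<kappa> c0 f) \<tau>0 u h D' \<longrightarrow> ae_eq \<Omega> D' D)))"
proof -
  obtain L where "L-lipschitz_on UNIV f" using assms(8) by blast
  then interpret impulse_control \<Omega> f L \<kappa> c0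
    using assms by unfold_locales
  have antisym: "ae_eq \<Omega> y z" if "ae_le \<Omega> y z" "ae_le \<Omega> z y" for y z :: "real^'n \<Rightarrow> real"
    using that unfolding ae_le_def ae_eq_def by eventually_elim simp
  show ?thesis
  proof (intro conjI ballI allI impI)
    fix u assume u: "u \<in> Hm1_plus \<Omega>"
    show "QVI_solutions \<Omega> \<kappa> c0 f u \<noteq> {}" using max_solution_QVI[OF u] by blast
    show "ae_smallest \<Omega> (QVI_solutions \<Omega> \<kappa> c0 f u) (min_solution \<Omega> \<kappa> c0 f u)"
      by (rule min_solution_smallest[OF u])
    then show "ae_eq \<Omega> y (min_solution \<Omega> \<kappa> c0 f u)" if "ae_smallest \<Omega> (QVI_solutions \<Omega> \<kappa> c0 f u) y" for y
      using that unfolding ae_smallest_def by (intro antisym) simp_all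
    show "ae_largest \<Omega> (QVI_solutions \<Omega> \<kappa> c0 f u) (max_solution \<Omega> \<kappa> c0 f u)"
      by (rule max_solution_largest[OF u])
    then show "ae_eq \<Omega> y (max_solution \<Omega> \<kappa> c0 f u)" if "ae_largest \<Omega> (QVI_solutions \<Omega> \<kappa> c0 f u) y" for y
      using that unfolding ae_largest_def by (intro antisym) simp_all
  next
    fix u1 u2 t assume "u1 \<in> Hm1_plus \<Omega>" "u2 \<in> Hm1_plus \<Omega>" "t \<in> {0..1::real}"
    then show "ae_le \<Omega> (\<lambda>x. t * max_solution \<Omega> \<kappa> c0 f u1 x + (1 - t) * max_solution \<Omega> \<kappa> c0 f u2 x)
        (max_solution \<Omega> \<kappa> c0 f (\<lambda>v. t * u1 v + (1 - t) * u2 v))"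
      by (intro max_solution_concave assms(9)) auto
  next
    fix u h \<tau>0 assume "u \<in> Hm1_plus \<Omega>" "0 < (\<tau>0::real)" "(\<lambda>v. u v + \<tau>0 * h v) \<in> Hm1_plus \<Omega>"
    then show "\<exists>D\<in>L0_ext \<Omega>. is_dir_deriv \<Omega> (max_solution \<Omega> \<kappa> c0 f) \<tau>0 u h D \<and>
           (\<forall>D'\<in>L0_ext \<Omega>. is_dir_deriv \<Omega> (max_solution \<Omega> \<kappa> c0 f) \<tau>0 u h D' \<longrightarrow> ae_eq \<Omega> D' D)"
      by (rule max_solution_directional_derivative[OF assms(9)])
  qed
qed

end
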